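(* Let $\alpha_1,\alpha_2\in(0,1)$, $c>0$, $n\ge1$, $p>1$, and assume that $s\mapsto\Psi(s)^{-1}=s^{(\alpha_2c+\alpha_1s)/(c+s)}$ is a Bernstein function on $(0,\infty)$. Let $0\le u_0\in L^1(\mathbb R^n)\cap L^\infty(\mathbb R^n)$ and let $u$ be the nonnegative maximal mild solution, with maximal existence time $T_{\max}\in(0,\infty]$. Then $$\|u(t)\|_1=\|u_0\|_1+\int_0^t\psi(t-s)\|u(s)\|_p^p\,ds,\qquad 0<t<T_{\max}.$$ Moreover, if $T_{\max}<\infty$, then $$\operatorname*{ess\,sup}_{T<t<T_{\max}}\|u(t)\|_\infty=\infty\qquad\text{for every }0<T<T_{\max}.$$ In particular, for any representative that is $L^\infty$-continuous for positive times, $\limsup_{t\uparrow T_{\max}}\|u(t)\|_\infty=\infty$ when $T_{\max}<\infty$.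
   Context: A Bernstein function is a $C^\infty$ function $F:(0,\infty)\to[0,\infty)$ with $(-1)^{m-1}F^{(m)}\ge0$ for all $m\ge1$. $\Psi(z)=z^{-B(z)}$ with $B(z)=\frac{\alpha_2c+\alpha_1z}{c+z}$ (principal branch), and $\psi\in L^1_{\rm loc}(0,\infty)$ is the continuous function on $(0,\infty)$ of exponential order whose Laplace transform is $\Psi$. The families are $S_{\mathcal A}(t)g=Z(t)*g$, $P_{\mathcal A}(t)g=Y(t)*g$, where, under the Bernstein condition, $Z(t)$ ($t>0$, weakly continuous in $t$) are probability measures and $Y(t)$ (a.e. $t>0$, measurable in $t$) are finite positive measures on $\mathbb R^n$ (with total mass $\psi(t)$ for a.e. $t$) determined by $$\int_0^\infty e^{-zt}\int_{\mathbb R^n}e^{-ix\cdot\xi}Z(t,dx)\,dt=\frac{\Psi(z)^{-1}}{z(\Psi(z)^{-1}+|\xi|^2)},\qquad\int_0^\infty e^{-zt}\int_{\mathbb R^n}e^{-ix\cdot\xi}Y(t,dx)\,dt=\frac1{\Psi(z)^{-1}+|\xi|^2}\quad(z>0);$$ $S_{\mathcal A}(0)=I$. A mild solution on $[0,T]$ is a function in $C([0,T];L^1(\mathbb R^n))\cap L^\infty((0,T);L^\infty(\mathbb R^n))$ satisfying $$u(t)=S_{\mathcal A}(t)u_0+\int_0^tP_{\mathcal A}(t-s)(u(s)_+)^p\,ds$$ in $L^1$ for every $t\in[0,T]$ and in $L^\infty$ for a.e. $t>0$. For each $0\le u_0\in L^1\cap L^\infty$ there is a unique nonnegative maximal mild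 solution $u$ on $[0,T_{\max})$, i.e. one that is a mild solution on $[0,T]$ for all $T<T_{\max}$ and cannot be extended to a mild solution on a strictly larger interval. *)

theory Defs
  imports "HOL-Probability.Probability"
begin

section \<open>The symbol and its Laplace original\<close>

text \<open>Polymorphic in the argument so that one definition serves both complex arguments, where
  \<open>powr\<close> is the principal branch, and positive real arguments.\<close>

definition order_B :: "real \<Rightarrow> real \<Rightarrow> real \<Rightarrow> 'a::{real_normed_field,ln} \<Rightarrow> 'a" where
  "order_B \<alpha>1 \<alpha>2 c z = (of_real (\<alpha>2 * c) + of_real \<alpha>1 * z) / (of_real c + z)"

definition Psi :: "real \<Rightarrow> real \<Rightarrow> real \<Rightarrow> 'a::{real_normed_field,ln} \<Rightarrow> 'a" where
  "Psi \<alpha>1 \<alpha>2 c z = z powr (- order_B \<alpha>1 \<alpha>2 c z)"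

definition bernstein_function :: "(real \<Rightarrow> real) \<Rightarrow> bool" where
  "bernstein_function F \<longleftrightarrow>
     (\<forall>s>0. 0 \<le> F s) \<and>
     (\<forall>m. \<forall>s>0. (deriv ^^ m) F field_differentiable (at s)) \<and>
     (\<forall>m\<ge>1. \<forall>s>0. 0 \<le> (-1) ^ (m - 1) * (deriv ^^ m) F s)"

text \<open>Local integrability is meant up to the endpoint \<open>0\<close>, as the Laplace transform requires.
  The Laplace transform need only be given by the integral on some right half-plane.\<close>

definition is_laplace_original_of_Psi :: "real \<Rightarrow> real \<Rightarrow> real \<Rightarrow> (real \<Rightarrow> real) \<Rightarrow> bool" where
  "is_laplace_original_of_Psi \<alpha>1 \<alpha>2 c \<psi> \<longleftrightarrow>
     continuous_on {0<..} \<psi> \<and>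
     (\<forall>T>0. set_integrable lborel {0<..T} \<psi>) \<and>
     (\<exists>K \<omega> t0. \<forall>t\<ge>t0. \<bar>\<psi> t\<bar> \<le> K * exp (\<omega> * t)) \<and>
     (\<exists>\<omega>\<ge>0. \<forall>z::complex. Re z > \<omega> \<longrightarrow>
        set_integrable lborel {0<..} (\<lambda>t. exp (- z * of_real t) * of_real (\<psi> t)) \<and>
        (LINT t:{0<..}|lborel. exp (- z * of_real t) * of_real (\<psi> t)) = Psi \<alpha>1 \<alpha>2 c z)"


section \<open>The measure families and the solution operators\<close>

definition fourier_measure :: "'a::euclidean_space measure \<Rightarrow> 'a \<Rightarrow> complex" where
  "fourier_measure \<mu> \<xi> = (LINT x|\<mu>. exp (- \<i> * of_real (x \<bullet> \<xi>)))"

definition is_Z_family ::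
  "real \<Rightarrow> real \<Rightarrow> real \<Rightarrow> (real \<Rightarrow> 'a::euclidean_space measure) \<Rightarrow> bool" where
  "is_Z_family \<alpha>1 \<alpha>2 c Z \<longleftrightarrow>
     (\<forall>t>0. prob_space (Z t) \<and> sets (Z t) = sets borel) \<and>
     (\<forall>f::'a \<Rightarrow> real. continuous_on UNIV f \<and> bounded (range f) \<longrightarrow>
        continuous_on {0<..} (\<lambda>t. LINT x|Z t. f x)) \<and>
     (\<forall>z>0. \<forall>\<xi>.
        set_integrable lebesgue {0<..} (\<lambda>t. of_real (exp (- z * t)) * fourier_measure (Z t) \<xi>) \<and>
        (LINT t:{0<..}|lebesgue. of_real (exp (- z * t)) * fourier_measure (Z t) \<xi>) =
          of_real (inverse (Psi \<alpha>1 \<alpha>2 c z) / (z * (inverse (Psi \<alpha>1 \<alpha>2 c z) + (norm \<xi>)\<^sup>2))))"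

text \<open>\<open>Y\<close> is specified for almost every time only, so measurability in time is with respect to
  the Lebesgue sets.\<close>

definition is_Y_family ::
  "real \<Rightarrow> real \<Rightarrow> real \<Rightarrow> (real \<Rightarrow> real) \<Rightarrow> (real \<Rightarrow> 'a::euclidean_space measure) \<Rightarrow> bool" where
  "is_Y_family \<alpha>1 \<alpha>2 c \<psi> Y \<longleftrightarrow>
     (AE t in lebesgue_on {0<..}.
        finite_measure (Y t) \<and> sets (Y t) = sets borel \<and> measure (Y t) UNIV = \<psi> t) \<and>
     (\<forall>A\<in>sets borel. (\<lambda>t. measure (Y t) A) \<in> borel_measurable (lebesgue_on {0<..})) \<and>
     (\<forall>z>0. \<forall>\<xi>.
        set_integrable lebesgue {0<..} (\<lambda>t. of_real (exp (- z * t)) * fourier_measure (Y t) \<xi>) \<and>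
        (LINT t:{0<..}|lebesgue. of_real (exp (- z * t)) * fourier_measure (Y t) \<xi>) =
          of_real (1 / (inverse (Psi \<alpha>1 \<alpha>2 c z) + (norm \<xi>)\<^sup>2)))"

definition measure_conv :: "'a::euclidean_space measure \<Rightarrow> ('a \<Rightarrow> real) \<Rightarrow> 'a \<Rightarrow> real" where
  "measure_conv \<mu> g x = (LINT y|\<mu>. g (x - y))"

definition S_op :: "(real \<Rightarrow> 'a::euclidean_space measure) \<Rightarrow> real \<Rightarrow> ('a \<Rightarrow> real) \<Rightarrow> 'a \<Rightarrow> real" where
  "S_op Z t g = (if t = 0 then g else measure_conv (Z t) g)"

definition P_op :: "(real \<Rightarrow> 'a::euclidean_space measure) \<Rightarrow> real \<Rightarrow> ('a \<Rightarrow> real) \<Rightarrow> 'a \<Rightarrow> real" where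
  "P_op Y t g = measure_conv (Y t) g"


section \<open>Lebesgue spaces and functions with values in them\<close>

text \<open>Elements of \<open>L\<^sup>q\<close> are represented by Borel functions; equality in \<open>L\<^sup>q\<close> is
  equality almost everywhere. The exponent ranges over \<open>[1,\<infinity>]\<close>.\<close>

definition Lp_norm :: "ennreal \<Rightarrow> ('a::euclidean_space \<Rightarrow> real) \<Rightarrow> ennreal" where
  "Lp_norm q f =
     (if q = \<infinity> then esssup lborel (\<lambda>x. ennreal \<bar>f x\<bar>)
      else let I = (\<integral>\<^sup>+x. ennreal (\<bar>f x\<bar> powr enn2real q) \<partial>lborel)
           in if I = \<infinity> then \<infinity> else ennreal (enn2real I powr (1 / enn2real q)))"

definition Lp_space :: "ennreal \<Rightarrow> ('a::euclidean_space \<Rightarrow> real) set" where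
  "Lp_space q = {f \<in> borel_measurable borel. Lp_norm q f < \<infinity>}"

definition continuous_on_Lp ::
  "ennreal \<Rightarrow> real set \<Rightarrow> (real \<Rightarrow> 'a::euclidean_space \<Rightarrow> real) \<Rightarrow> bool" where
  "continuous_on_Lp q I u \<longleftrightarrow>
     (\<forall>t\<in>I. u t \<in> Lp_space q \<and>
        ((\<lambda>r. Lp_norm q (\<lambda>x. u r x - u t x)) \<longlongrightarrow> 0) (at t within I))"

text \<open>Bochner measurability and Bochner integral in \<open>L\<^sup>q\<close> over a time set \<open>I\<close> of finite
  measure, by approximation with simple functions as in the library's
  \<^const>\<open>has_bochner_integral\<close>. That notion is not applicable directly, there being no type of
  \<open>L\<^sup>q\<close> classes (and \<open>L\<^sup>\<infinity>\<close> not being separable).\<close>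

definition Lp_simple ::
  "ennreal \<Rightarrow> real set \<Rightarrow> (real \<Rightarrow> 'a::euclidean_space \<Rightarrow> real) \<Rightarrow> bool" where
  "Lp_simple q I s \<longleftrightarrow> simple_function (lebesgue_on I) s \<and> s ` I \<subseteq> Lp_space q"

definition Lp_simple_integral ::
  "real set \<Rightarrow> (real \<Rightarrow> 'a::euclidean_space \<Rightarrow> real) \<Rightarrow> 'a \<Rightarrow> real" where
  "Lp_simple_integral I s = (\<lambda>x. \<Sum>y\<in>s ` I. measure lebesgue {t\<in>I. s t = y} * y x)"

definition Lp_strongly_measurable ::
  "ennreal \<Rightarrow> real set \<Rightarrow> (real \<Rightarrow> 'a::euclidean_space \<Rightarrow> real) \<Rightarrow> bool" where
  "Lp_strongly_measurable q I f \<longleftrightarrow>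
     (AE t in lebesgue_on I. f t \<in> Lp_space q) \<and>
     (\<exists>s. (\<forall>k::nat. Lp_simple q I (s k)) \<and>
       (AE t in lebesgue_on I. (\<lambda>k. Lp_norm q (\<lambda>x. f t x - s k t x)) \<longlonglongrightarrow> 0))"

definition has_Lp_bochner_integral ::
  "ennreal \<Rightarrow> real set \<Rightarrow> (real \<Rightarrow> 'a::euclidean_space \<Rightarrow> real) \<Rightarrow> ('a \<Rightarrow> real) \<Rightarrow> bool" where
  "has_Lp_bochner_integral q I f w \<longleftrightarrow>
     w \<in> Lp_space q \<and> Lp_strongly_measurable q I f \<and>
     (\<exists>s. (\<forall>k::nat. Lp_simple q I (s k)) \<and>
       (\<lambda>k. \<integral>\<^sup>+t. Lp_norm q (\<lambda>x. f t x - s k t x) \<partial>lebesgue_on I) \<longlonglongrightarrow> 0 \<and>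
       (\<lambda>k. Lp_norm q (\<lambda>x. Lp_simple_integral I (s k) x - w x)) \<longlonglongrightarrow> 0)"


section \<open>Mild solutions\<close>

definition mild_equation_at ::
  "ennreal \<Rightarrow> real \<Rightarrow> (real \<Rightarrow> 'a::euclidean_space measure) \<Rightarrow> (real \<Rightarrow> 'a measure) \<Rightarrow>
   ('a \<Rightarrow> real) \<Rightarrow> (real \<Rightarrow> 'a \<Rightarrow> real) \<Rightarrow> real \<Rightarrow> bool" where
  "mild_equation_at q p Z Y u0 u t \<longleftrightarrow>
     u t \<in> Lp_space q \<and> S_op Z t u0 \<in> Lp_space q \<and>
     (\<exists>w. has_Lp_bochner_integral q {0<..<t} (\<lambda>s. P_op Y (t - s) (\<lambda>x. max 0 (u s x) powr p)) w \<and>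
        (AE x in lborel. u t x = S_op Z t u0 x + w x))"

definition mild_solution ::
  "real \<Rightarrow> (real \<Rightarrow> 'a::euclidean_space measure) \<Rightarrow> (real \<Rightarrow> 'a measure) \<Rightarrow>
   ('a \<Rightarrow> real) \<Rightarrow> real \<Rightarrow> (real \<Rightarrow> 'a \<Rightarrow> real) \<Rightarrow> bool" where
  "mild_solution p Z Y u0 T u \<longleftrightarrow>
     continuous_on_Lp 1 {0..T} u \<and>
     Lp_strongly_measurable \<infinity> {0<..<T} u \<and>
     (\<exists>C::real. AE t in lebesgue_on {0<..<T}. Lp_norm \<infinity> (u t) \<le> ennreal C) \<and>
     (\<forall>t\<in>{0..T}. mild_equation_at 1 p Z Y u0 u t) \<and>
     (AE t in lebesgue_on {0<..<T}. mild_equation_at \<infinity> p Z Y u0 u t)"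

text \<open>Solutions live on \<open>[0,Tmax)\<close>; values of \<open>u\<close> outside this interval are irrelevant.
  The interval \<open>[0,Tmax]\<close> already counts as strictly larger.\<close>

definition maximal_mild_solution ::
  "real \<Rightarrow> (real \<Rightarrow> 'a::euclidean_space measure) \<Rightarrow> (real \<Rightarrow> 'a measure) \<Rightarrow>
   ('a \<Rightarrow> real) \<Rightarrow> ereal \<Rightarrow> (real \<Rightarrow> 'a \<Rightarrow> real) \<Rightarrow> bool" where
  "maximal_mild_solution p Z Y u0 Tmax u \<longleftrightarrow>
     0 < Tmax \<and>
     (\<forall>T. 0 < T \<and> ereal T < Tmax \<longrightarrow> mild_solution p Z Y u0 T u) \<and>
     \<not> (\<exists>T' v. {t. 0 \<le> t \<and> ereal t < Tmax} \<subset> {0..T'} \<and> mild_solution p Z Y u0 T' v \<and>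
          (\<forall>t. 0 \<le> t \<and> ereal t < Tmax \<longrightarrow> (AE x in lborel. v t x = u t x)))"

end

theory Submission
  imports Defs
begin

text \<open>
  Convolution with a probability measure preserves the integral, and convolution with
  \<open>Y(r)\<close> multiplies it by \<open>\<psi>(r)\<close>; integrating the mild equation over space
  therefore gives the mass identity.

  Suppose that \<open>T\<^sub>m\<^sub>a\<^sub>x\<close> is finite while \<open>u\<close> stays bounded by \<open>C\<close>
  near it. Since \<open>u\<^sup>p \<le> C\<^sup>p\<^sup>-\<^sup>1 u\<close>, the mass identity is a linear Volterra inequality
  for \<open>\<parallel>u(t)\<parallel>\<^sub>1\<close> with locally integrable kernel, and so the mass stays bounded as well.
  Then the right-hand side of the mild equation makes sense at \<open>T\<^sub>m\<^sub>a\<^sub>x\<close> and is the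
  \<open>L\<^sup>1\<close> limit of \<open>u(t)\<close>. Taking it as the value at \<open>T\<^sub>m\<^sub>a\<^sub>x\<close> gives a mild
  solution on the closed interval, which contradicts maximality; no local existence theory is needed.
\<close>

section \<open>Norms, reflections and convolutions\<close>

text \<open>Two obstacles shape the proof. First, solutions are classes: each \<open>u t\<close> is
  fixed only up to null sets of x, the bound on \<open>u\<close> and the properties of
  \<open>Y\<close> hold only for almost every time, and the integral in the mild equation is an
  abstract Bochner integral. Tonelli and dominated convergence need pointwise objects. Hence
  \<open>u\<close> and \<open>Y\<close> are traded for substitutes \<open>U\<close> and
  \<open>K\<close> that behave well at every time, and L1 Bochner integrals are identified with
  pointwise ones, in both directions: to read off a given mild equation, and to create the integral
  at the end point. Second, the measures K(r) depend on r only measurably. Writing the Duhamel term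
  as an integral over the age r = t - s puts all dependence on t into the source, the p-th power of
  U(t - r). This is L1-continuous before the end point because the power is Lipschitz on [0,C], and
  the locally integrable mass of the kernel dominates. The term S(t)u0 converges by weak continuity
  of Z. At the end point only the L1 equation has to be checked, since the L-infinity equation is
  demanded for almost every time.\<close>

lemma Lp_norm_1: "Lp_norm 1 f = (\<integral>\<^sup>+x. ennreal \<bar>f x\<bar> \<partial>lborel)"
  by (simp add: Lp_norm_def Let_def top.not_eq_extremum)

lemma Lp_norm_infinity: "Lp_norm \<infinity> f = esssup lborel (\<lambda>x. ennreal \<bar>f x\<bar>)"
  by (simp add: Lp_norm_def)

lemma Lp_norm_real:
  assumes "0 < p" "(\<integral>\<^sup>+x. ennreal (\<bar>f x\<bar> powr p) \<partial>lborel) < \<infinity>"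
  shows "ennreal (enn2real (Lp_norm (ennreal p) f) powr p) = (\<integral>\<^sup>+x. ennreal (\<bar>f x\<bar> powr p) \<partial>lborel)"
    and "Lp_norm (ennreal p) f < \<infinity>"
  using assms by (auto simp: Lp_norm_def Let_def powr_powr top.not_eq_extremum)

lemma AE_le_Lp_norm_infinity: "AE x in lborel. ennreal \<bar>f x\<bar> \<le> Lp_norm \<infinity> f"
  unfolding Lp_norm_infinity by (rule esssup_AE)

lemma Lp_norm_infinity_le:
  assumes "f \<in> borel_measurable borel" "AE x in lborel. ennreal \<bar>f x\<bar> \<le> c"
  shows "Lp_norm \<infinity> f \<le> c"
  unfolding Lp_norm_infinity using assms by (intro esssup_I) auto

lemma Lp_norm_infinity_cong_AE:
  fixes f g :: "'a::euclidean_space \<Rightarrow> real"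
  assumes "f \<in> borel_measurable borel" "g \<in> borel_measurable borel" "AE x in lborel. f x = g x"
  shows "Lp_norm \<infinity> f = Lp_norm \<infinity> g"
  unfolding Lp_norm_infinity by (rule esssup_AE_cong) (use assms in auto)

lemma Lp_norm_infinity_le_add:
  assumes "f \<in> borel_measurable borel" "g \<in> borel_measurable borel"
  shows "Lp_norm \<infinity> f \<le> Lp_norm \<infinity> g + Lp_norm \<infinity> (\<lambda>x. f x - g x)"
proof (rule Lp_norm_infinity_le)
  show "AE x in lborel. ennreal \<bar>f x\<bar> \<le> Lp_norm \<infinity> g + Lp_norm \<infinity> (\<lambda>x. f x - g x)"
    using AE_le_Lp_norm_infinity[of g] AE_le_Lp_norm_infinity[of "\<lambda>x. f x - g x"]
  proof eventually_elim
    case (elim x)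
    have "ennreal \<bar>f x\<bar> \<le> ennreal (\<bar>g x\<bar> + \<bar>f x - g x\<bar>)"
      by (intro ennreal_leI) auto
    also have "\<dots> = ennreal \<bar>g x\<bar> + ennreal \<bar>f x - g x\<bar>"
      by simp
    also have "\<dots> \<le> Lp_norm \<infinity> g + Lp_norm \<infinity> (\<lambda>x. f x - g x)"
      by (intro add_mono elim)
    finally show ?case .
  qed
qed (use assms in auto)

lemma Lp_norm_infinity_minus_commute:
  "Lp_norm \<infinity> (\<lambda>x. f x - g x) = Lp_norm \<infinity> (\<lambda>x. g x - f x)"
  unfolding Lp_norm_infinity by (simp add: abs_minus_commute)

text \<open>Time carries the completed measure, space the Borel one. Tonelli on the mixed product
  needs both factors to be sigma-finite, and the completion keeps the measure of Borel sets.\<close>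

lemma sigma_finite_lebesgue: "sigma_finite_measure (lebesgue :: 'a::euclidean_space measure)"
proof
  show "\<exists>A::'a set set. countable A \<and> A \<subseteq> sets lebesgue \<and> \<Union>A = space lebesgue \<and> (\<forall>a\<in>A. emeasure lebesgue a \<noteq> \<infinity>)"
    using lborel.sigma_finite_countable
    by (metis (no_types, lifting) emeasure_completion main_part_sets sets_completionI_sets
        space_completion subset_eq main_part)
qed

section \<open>Reflection of the time axis\<close>

lemma lebesgue_measurable_reflect [measurable]: "(\<lambda>s::real. t - s) \<in> lebesgue \<rightarrow>\<^sub>M lebesgue"
  using lebesgue_affine_measurable[where c= "\<lambda>x::real. -1" and t=t] by simp

lemma nn_integral_lebesgue_reflect:
  fixes f :: "real \<Rightarrow> ennreal"
  assumes "f \<in> borel_measurable lebesgue"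
  shows "(\<integral>\<^sup>+s. f (t - s) \<partial>lebesgue) = (\<integral>\<^sup>+s. f s \<partial>lebesgue)"
  using nn_integral_real_affine_lebesgue[OF assms, of "-1" t] by simp

text \<open>The kernel is known for almost every r and the source for almost every s, while the
  Duhamel integrand couples them by r = t - s. This carries a null set from one variable to the
  other.\<close>

lemma AE_lebesgue_reflect:
  fixes P :: "real \<Rightarrow> bool"
  assumes "AE s in lebesgue. P s"
  shows "AE s in lebesgue. P (t - s)"
proof -
  obtain N where N: "{s. \<not> P s} \<subseteq> N" "N \<in> null_sets lebesgue"
    using assms by (auto simp: eventually_ae_filter)
  have "(\<integral>\<^sup>+s. indicator N (t - s) \<partial>lebesgue) = (0::ennreal)"
    using N(2) by (subst nn_integral_lebesgue_reflect) (auto simp: null_sets_def)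
  moreover have "(\<lambda>s. indicator N (t - s) :: ennreal) \<in> borel_measurable lebesgue"
    using N(2) measurable_compose[OF lebesgue_measurable_reflect[of t], of "indicator N" borel]
    by (auto simp: null_sets_def)
  ultimately have "AE s in lebesgue. indicator N (t - s) = (0::ennreal)"
    by (simp add: nn_integral_0_iff_AE)
  then show ?thesis
    by eventually_elim (use N(1) in \<open>auto simp: indicator_def split: if_splits\<close>)
qed

lemma AE_lebesgue_on_iff:
  assumes "I \<in> sets lebesgue"
  shows "(AE t in lebesgue_on I. P t) \<longleftrightarrow> (AE t in lebesgue. t \<in> I \<longrightarrow> P t)"
  using assms by (subst AE_restrict_space_iff) auto

section \<open>Convolution of functions with a finite measure\<close>

lemma nn_integral_lborel_translate:
  fixes f :: "'a::euclidean_space \<Rightarrow> ennreal"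
  assumes [measurable]: "f \<in> borel_measurable borel"
  shows "(\<integral>\<^sup>+x. f (x - y) \<partial>lborel) = (\<integral>\<^sup>+x. f x \<partial>lborel)"
proof -
  have "(\<integral>\<^sup>+x. f x \<partial>lborel) = (\<integral>\<^sup>+x. f x \<partial>distr lborel borel ((+) (- y)))"
    by (simp add: lborel_distr_plus)
  also have "\<dots> = (\<integral>\<^sup>+x. f (x - y) \<partial>lborel)"
    by (subst nn_integral_distr) (auto simp: algebra_simps)
  finally show ?thesis by simp
qed

text \<open>Tonelli and translation invariance. With an indicator for f this moves null sets through
  a convolution, with the function itself it gives conservation of mass, and with an absolute
  difference it gives the L1 estimates.\<close>

lemma nn_integral_convolution:
  fixes \<mu> :: "'a::euclidean_space measure"
  assumes "finite_measure \<mu>" and [measurable_cong]: "sets \<mu> = sets borel"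
    and [measurable]: "f \<in> borel_measurable borel"
  shows "(\<integral>\<^sup>+x. (\<integral>\<^sup>+y. f (x - y) \<partial>\<mu>) \<partial>lborel) = emeasure \<mu> UNIV * (\<integral>\<^sup>+x. f x \<partial>lborel)"
proof -
  interpret finite_measure \<mu> by fact
  interpret pair_sigma_finite lborel \<mu> ..
  have "(\<integral>\<^sup>+x. (\<integral>\<^sup>+y. f (x - y) \<partial>\<mu>) \<partial>lborel) = (\<integral>\<^sup>+y. (\<integral>\<^sup>+x. f (x - y) \<partial>lborel) \<partial>\<mu>)"
    by (rule Fubini'[symmetric]) measurable
  also have "\<dots> = emeasure \<mu> UNIV * (\<integral>\<^sup>+x. f x \<partial>lborel)"
    using sets_eq_imp_space_eq[OF assms(2)] by (simp add: nn_integral_lborel_translate mult.commute)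
  finally show ?thesis .
qed

text \<open>The measure may be singular, so a Lebesgue null set can have positive
  \<open>\<mu>\<close>-mass. Only the average over all translates is controlled, which makes the
  exceptional y a \<open>\<mu>\<close>-null set for almost every x. It follows that convolution is
  well defined on classes.\<close>

lemma AE_convolution:
  fixes \<mu> :: "'a::euclidean_space measure"
  assumes "finite_measure \<mu>" and [measurable_cong]: "sets \<mu> = sets borel"
    and "AE x in lborel. P x"
  shows "AE x in lborel. AE y in \<mu>. P (x - y)"
proof -
  interpret finite_measure \<mu> by fact
  obtain N where N: "{x. \<not> P x} \<subseteq> N" "N \<in> null_sets lborel"
    using assms by (auto simp: eventually_ae_filter)
  then have [measurable]: "N \<in> sets borel" by auto
  have "(\<integral>\<^sup>+x. (\<integral>\<^sup>+y. indicator N (x - y) \<partial>\<mu>) \<partial>lborel) = emeasure \<mu> UNIV * (\<integral>\<^sup>+x. indicator N x \<partial>lborel)"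
    by (rule nn_integral_convolution) (use assms in auto)
  also have "\<dots> = 0" using N(2) by (auto simp: null_sets_def)
  finally have "AE x in lborel. (\<integral>\<^sup>+y. indicator N (x - y) \<partial>\<mu>) = 0"
    by (subst (asm) nn_integral_0_iff_AE) auto
  then show ?thesis
  proof eventually_elim
    case (elim x)
    then have "AE y in \<mu>. indicator N (x - y) = (0::ennreal)"
      by (subst (asm) nn_integral_0_iff_AE) auto
    then show ?case
      by eventually_elim (use N(1) in \<open>auto simp: indicator_def split: if_splits\<close>)
  qed
qed

lemma borel_measurable_measure_conv [measurable]:
  fixes \<mu> :: "'a::euclidean_space measure"
  assumes "finite_measure \<mu>" and [measurable_cong]: "sets \<mu> = sets borel"
    and [measurable]: "f \<in> borel_measurable borel"
  shows "measure_conv \<mu> f \<in> borel_measurable borel"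
proof -
  interpret finite_measure \<mu> by fact
  show ?thesis unfolding measure_conv_def[abs_def]
    by (rule borel_measurable_lebesgue_integral) measurable
qed

lemma measure_conv_cong_AE:
  fixes \<mu> :: "'a::euclidean_space measure"
  assumes "finite_measure \<mu>" and [measurable_cong]: "sets \<mu> = sets borel"
    and [measurable]: "f \<in> borel_measurable borel" "g \<in> borel_measurable borel"
    and "AE x in lborel. f x = g x"
  shows "AE x in lborel. measure_conv \<mu> f x = measure_conv \<mu> g x"
  using AE_convolution[OF assms(1,2,5)]
  by eventually_elim (auto simp: measure_conv_def intro!: integral_cong_AE)

text \<open>The bounds are required at every point: since \<open>\<mu>\<close> may charge Lebesgue
  null sets, an essential bound would not make the integral meaningful at a fixed x. This is why
  data and solutions are later replaced by clipped representatives.\<close>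

lemma measure_conv_bounded:
  fixes \<mu> :: "'a::euclidean_space measure"
  assumes "finite_measure \<mu>" and [measurable_cong]: "sets \<mu> = sets borel"
    and [measurable]: "f \<in> borel_measurable borel" and f: "\<And>x. 0 \<le> f x" "\<And>x. f x \<le> B"
  shows integrable_measure_conv_bounded: "integrable \<mu> (\<lambda>y. f (x - y))"
    and ennreal_measure_conv_bounded: "ennreal (measure_conv \<mu> f x) = (\<integral>\<^sup>+y. ennreal (f (x - y)) \<partial>\<mu>)"
    and measure_conv_nonneg: "0 \<le> measure_conv \<mu> f x"
    and measure_conv_le: "measure_conv \<mu> f x \<le> B * measure \<mu> UNIV"
proof -
  interpret finite_measure \<mu> by fact
  show *: "integrable \<mu> (\<lambda>y. f (x - y))"
    by (rule integrable_const_bound[where B=B]) (use f in auto)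
  show "ennreal (measure_conv \<mu> f x) = (\<integral>\<^sup>+y. ennreal (f (x - y)) \<partial>\<mu>)"
    unfolding measure_conv_def by (rule nn_integral_eq_integral[symmetric, OF *]) (use f in auto)
  show "0 \<le> measure_conv \<mu> f x" unfolding measure_conv_def using f by simp
  have "measure_conv \<mu> f x \<le> (LINT y|\<mu>. B)"
    unfolding measure_conv_def using * f by (intro integral_mono) auto
  then show "measure_conv \<mu> f x \<le> B * measure \<mu> UNIV"
    using sets_eq_imp_space_eq[OF assms(2)] by (simp add: mult.commute)
qed

lemma measure_conv_diff_le:
  assumes "integrable \<mu> (\<lambda>y. f (x - y))" "integrable \<mu> (\<lambda>y. g (x - y))"
  shows "ennreal \<bar>measure_conv \<mu> f x - measure_conv \<mu> g x\<bar> \<le> (\<integral>\<^sup>+y. ennreal \<bar>f (x - y) - g (x - y)\<bar> \<partial>\<mu>)"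
proof -
  have "measure_conv \<mu> f x - measure_conv \<mu> g x = (LINT y|\<mu>. f (x - y) - g (x - y))"
    unfolding measure_conv_def by (rule Bochner_Integration.integral_diff[OF assms, symmetric])
  then show ?thesis
    using integral_norm_bound_ennreal[OF Bochner_Integration.integrable_diff[OF assms]] by simp
qed

section \<open>Kernels in time\<close>

text \<open>The family \<open>Y\<close> is constrained at almost every time only. A \<open>time_kernel\<close> is well-behaved at every
  time and vanishes for \<open>r \<le> 0\<close>, so that integrals over \<open>(0,t)\<close> become integrals over
  the whole line.\<close>

locale time_kernel =
  fixes K :: "real \<Rightarrow> 'a::euclidean_space measure"
  assumes finite_kernel: "finite_measure (K r)"
    and sets_kernel [measurable_cong, simp]: "sets (K r) = sets borel"
    and measurable_kernel: "A \<in> sets borel \<Longrightarrow> (\<lambda>r. emeasure (K r) A) \<in> borel_measurable lebesgue"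
    and kernel_nonpos: "r \<le> 0 \<Longrightarrow> emeasure (K r) UNIV = 0"
    and kernel_mass_finite: "(\<integral>\<^sup>+r\<in>{..T}. emeasure (K r) UNIV \<partial>lebesgue) < \<infinity>"
begin

lemma space_kernel [simp]: "space (K r) = UNIV"
  using sets_eq_imp_space_eq[OF sets_kernel] by simp

lemma kernel_mass_top [simp]: "emeasure (K r) UNIV \<noteq> \<top>"
  using finite_measure.emeasure_finite[OF finite_kernel, of r UNIV] by simp

lemma measurable_kernel_mass [measurable]: "(\<lambda>r. measure (K r) UNIV) \<in> borel_measurable lebesgue"
  unfolding measure_def using measurable_kernel[of UNIV] by measurable

lemma ennreal_kernel_mass: "ennreal (measure (K r) UNIV) = emeasure (K r) UNIV"
  by (simp add: finite_measure.emeasure_eq_measure[OF finite_kernel])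

lemma kernel_mass_indicator_measurable [measurable]:
  "(\<lambda>r. emeasure (K r) UNIV * indicator {..a} r) \<in> borel_measurable lebesgue"
  using measurable_kernel[of UNIV] by (intro borel_measurable_times_ennreal borel_measurable_indicator) auto

text \<open>Dominated convergence as the interval shrinks to \<open>{..0}\<close>, where the kernel
  has no mass. The \<open>\<delta>\<close> found here is the one that permits absorption in the
  uniform mass bound.\<close>

lemma exists_small_mass:
  assumes "0 < e" "0 < b"
  obtains \<delta> where "0 < \<delta>" "\<delta> < b" "(\<integral>\<^sup>+r\<in>{..\<delta>}. emeasure (K r) UNIV \<partial>lebesgue) \<le> ennreal e"
proof -
  \<comment> \<open>The shift by 2 keeps \<open>X n\<close> strictly below b already for n =
    0.\<close>
  define X where "X n = b / (real n + 2)" for n :: nat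
  have X: "0 < X n" "X n < b" for n using assms by (auto simp: X_def field_simps intro!: add_pos_nonneg)
  have X0: "X \<longlonglongrightarrow> 0"
    unfolding X_def[abs_def]
    by (intro tendsto_divide_0[OF tendsto_const] filterlim_at_top_imp_at_infinity
        filterlim_tendsto_add_at_top[where c=2 and f="\<lambda>n. 2", simplified add.commute] filterlim_real_sequentially tendsto_const)
  have "(\<lambda>n. \<integral>\<^sup>+r\<in>{..X n}. emeasure (K r) UNIV \<partial>lebesgue) \<longlonglongrightarrow> (\<integral>\<^sup>+r. 0 \<partial>(lebesgue :: real measure))"
  proof (rule nn_integral_dominated_convergence[where w="\<lambda>r. emeasure (K r) UNIV * indicator {..b} r"])
    show "AE r in lebesgue. emeasure (K r) UNIV * indicator {..X n} r \<le> emeasure (K r) UNIV * indicator {..b} r" for n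
      using X(2)[of n] by (intro AE_I2) (auto simp: indicator_def)
    show "AE r in lebesgue. (\<lambda>n. emeasure (K r) UNIV * indicator {..X n} r) \<longlonglongrightarrow> 0"
    proof (intro AE_I2 tendsto_eventually)
      fix r :: real
      show "\<forall>\<^sub>F n in sequentially. emeasure (K r) UNIV * indicator {..X n} r = 0"
      proof (cases "0 < r")
        case True
        from order_tendstoD(2)[OF X0 this] show ?thesis by eventually_elim simp
      qed (use kernel_nonpos[of r] in simp)
    qed
  qed (use kernel_mass_finite in auto)
  then have "\<forall>\<^sub>F n in sequentially. (\<integral>\<^sup>+r\<in>{..X n}. emeasure (K r) UNIV \<partial>lebesgue) < ennreal e"
    by (intro order_tendstoD(2)[of _ 0]) (use assms in auto)
  then obtain n where "(\<integral>\<^sup>+r\<in>{..X n}. emeasure (K r) UNIV \<partial>lebesgue) < ennreal e"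
    by (auto simp: eventually_sequentially)
  with X show ?thesis by (intro that[of "X n"]) auto
qed

lemma nn_integral_kernel_measurable:
  assumes [measurable]: "(\<lambda>(z, y). f z y) \<in> borel_measurable (M \<Otimes>\<^sub>M borel)" "h \<in> M \<rightarrow>\<^sub>M lebesgue"
  shows "(\<lambda>z. \<integral>\<^sup>+y. f z y \<partial>K (h z)) \<in> borel_measurable M"
proof -
  \<comment> \<open>The library treats measurability of sub-probability kernels only, hence the normalization.\<close>
  define c where "c r = 1 / (1 + measure (K r) UNIV)" for r
  have c: "0 < c r" for r unfolding c_def by (smt (verit) divide_pos_pos measure_nonneg)
  have [measurable]: "c \<in> borel_measurable lebesgue" unfolding c_def by measurable
  have "(\<lambda>r. scale_measure (c r) (K r)) \<in> lebesgue \<rightarrow>\<^sub>M subprob_algebra borel"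
  proof (rule measurable_subprob_algebra)
    fix r
    show "subprob_space (scale_measure (c r) (K r))"
    proof
      have "ennreal (c r) * ennreal (measure (K r) UNIV) \<le> ennreal 1"
        using c[of r] unfolding c_def
        by (subst ennreal_mult[symmetric]) (auto intro!: ennreal_leI simp: field_simps add_nonneg_eq_0_iff)
      then show "emeasure (scale_measure (c r) (K r)) (space (scale_measure (c r) (K r))) \<le> 1"
        by (simp add: space_scale_measure ennreal_kernel_mass)
    qed (simp add: space_scale_measure)
  next
    fix A :: "'a set" assume [measurable]: "A \<in> sets borel"
    note measurable_kernel[measurable]
    show "(\<lambda>r. emeasure (scale_measure (c r) (K r)) A) \<in> borel_measurable lebesgue"
      by simp
  qed simp
  note this[measurable]
  have "(\<lambda>z. \<integral>\<^sup>+y. f z y \<partial>scale_measure (c (h z)) (K (h z))) \<in> borel_measurable M"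
    by (rule nn_integral_measurable_subprob_algebra2[where N=borel]) measurable
  then have "(\<lambda>z. ennreal (1 / c (h z)) * (\<integral>\<^sup>+y. f z y \<partial>scale_measure (c (h z)) (K (h z)))) \<in> borel_measurable M"
    by measurable
  also have "(\<lambda>z. ennreal (1 / c (h z)) * (\<integral>\<^sup>+y. f z y \<partial>scale_measure (c (h z)) (K (h z)))) \<in> borel_measurable M
    \<longleftrightarrow> (\<lambda>z. \<integral>\<^sup>+y. f z y \<partial>K (h z)) \<in> borel_measurable M"
  proof (rule measurable_cong)
    fix z assume z: "z \<in> space M"
    have [measurable]: "f z \<in> borel_measurable (K (h z))"
      using measurable_Pair2[OF assms(1) z] by simp
    have "ennreal (1 / c (h z)) * (\<integral>\<^sup>+y. f z y \<partial>scale_measure (c (h z)) (K (h z)))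
        = (ennreal (1 / c (h z)) * ennreal (c (h z))) * (\<integral>\<^sup>+y. f z y \<partial>K (h z))"
      by (simp add: nn_integral_scale_measure mult.assoc)
    also have "ennreal (1 / c (h z)) * ennreal (c (h z)) = 1"
      using c[of "h z"] by (subst ennreal_mult[symmetric]) auto
    finally show "ennreal (1 / c (h z)) * (\<integral>\<^sup>+y. f z y \<partial>scale_measure (c (h z)) (K (h z)))
        = (\<integral>\<^sup>+y. f z y \<partial>K (h z))" by simp
  qed
  finally show ?thesis .
qed

text \<open>The age r, not the source time, is the variable of integration, so that t occurs only in
  the source and two times can be compared under the same \<open>K r\<close>.\<close>

definition time_conv :: "(real \<Rightarrow> 'a \<Rightarrow> real) \<Rightarrow> real \<Rightarrow> 'a \<Rightarrow> real" where
  "time_conv g t x = (LINT r|lebesgue. measure_conv (K r) (g (t - r)) x)"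

end

section \<open>Space-time convolution of the kernel with a bounded source\<close>

locale time_kernel_source = time_kernel K for K :: "real \<Rightarrow> 'a::euclidean_space measure" +
  fixes g :: "real \<Rightarrow> 'a \<Rightarrow> real" and B :: real
  assumes source_measurable [measurable]: "(\<lambda>(s, x). g s x) \<in> borel_measurable (lebesgue \<Otimes>\<^sub>M borel)"
    and source_nonneg: "0 \<le> g s x" and source_le: "g s x \<le> B"
    and source_nonpos: "s \<le> 0 \<Longrightarrow> g s x = 0"
begin

lemma source_measurable' [measurable]: "g s \<in> borel_measurable borel"
  using measurable_Pair2[OF source_measurable, of s] by simp

lemma bound_nonneg: "0 \<le> B"
  using source_nonneg[of 0] source_le[of 0] order_trans by blast

lemma source_compose_measurable [measurable]:
  assumes [measurable]: "h \<in> M \<rightarrow>\<^sub>M lebesgue" "k \<in> M \<rightarrow>\<^sub>M borel"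
  shows "(\<lambda>z. g (h z) (k z)) \<in> borel_measurable M"
  using measurable_compose[OF measurable_Pair[OF assms] source_measurable] by simp

lemmas source_conv =
  measure_conv_bounded[OF finite_kernel sets_kernel source_measurable' source_nonneg source_le]

text \<open>Here the two one-sided conventions meet: a kernel without mass for r \<le> 0 and a
  source that vanishes for s \<le> 0 confine the integrand to 0 < r < t.\<close>

lemma source_conv_eq_0: "\<not> (0 < r \<and> r < t) \<Longrightarrow> measure_conv (K r) (g (t - r)) x = 0"
proof -
  assume "\<not> (0 < r \<and> r < t)"
  then consider "r \<le> 0" | "t - r \<le> 0" by linarith
  then show ?thesis
  proof cases
    case 1
    then have "measure (K r) UNIV = 0"
      using kernel_nonpos[of r] by (simp add: measure_def)
    then show ?thesis
      using source_conv(3,4)[of r "t - r" x] by simp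
  next
    case 2
    then show ?thesis by (simp add: measure_conv_def source_nonpos)
  qed
qed

text \<open>The measurability result for kernels concerns nonnegative integrals. As g is nonnegative
  and bounded, \<open>enn2real\<close> recovers the real convolution from such an integral.\<close>

lemma source_conv_measurable [measurable]:
  "(\<lambda>(r, x). measure_conv (K r) (g (t - r)) x) \<in> borel_measurable (lebesgue \<Otimes>\<^sub>M borel)"
proof -
  have "(\<lambda>z. \<integral>\<^sup>+y. ennreal (g (t - fst z) (snd z - y)) \<partial>K (fst z)) \<in> borel_measurable (lebesgue \<Otimes>\<^sub>M borel)"
    by (rule nn_integral_kernel_measurable) measurable
  then have "(\<lambda>z. enn2real (\<integral>\<^sup>+y. ennreal (g (t - fst z) (snd z - y)) \<partial>K (fst z))) \<in> borel_measurable (lebesgue \<Otimes>\<^sub>M borel)"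
    by measurable
  also have "(\<lambda>z. enn2real (\<integral>\<^sup>+y. ennreal (g (t - fst z) (snd z - y)) \<partial>K (fst z)))
    = (\<lambda>(r, x). measure_conv (K r) (g (t - r)) x)"
    by (auto simp flip: source_conv(2) simp: source_conv(3))
  finally show ?thesis .
qed

lemma source_conv_measurable' [measurable]:
  "(\<lambda>r. measure_conv (K r) (g (t - r)) x) \<in> borel_measurable lebesgue"
  using measurable_Pair1[OF source_conv_measurable, of x] by simp

lemma source_conv_integrable: "integrable lebesgue (\<lambda>r. measure_conv (K r) (g (t - r)) x)"
proof (rule integrableI_nonneg)
  have "(\<integral>\<^sup>+r. ennreal (measure_conv (K r) (g (t - r)) x) \<partial>lebesgue)
     \<le> (\<integral>\<^sup>+r. ennreal B * (emeasure (K r) UNIV * indicator {..t} r) \<partial>lebesgue)"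
  proof (rule nn_integral_mono)
    fix r
    show "ennreal (measure_conv (K r) (g (t - r)) x) \<le> ennreal B * (emeasure (K r) UNIV * indicator {..t} r)"
      using source_conv(4)[of r "t - r" x] bound_nonneg
      by (cases "r \<le> t")
         (auto simp: source_conv_eq_0 simp flip: ennreal_kernel_mass ennreal_mult intro!: ennreal_leI)
  qed
  also have "\<dots> = ennreal B * (\<integral>\<^sup>+r\<in>{..t}. emeasure (K r) UNIV \<partial>lebesgue)"
    by (rule nn_integral_cmult) measurable
  also have "\<dots> < \<infinity>"
    using kernel_mass_finite[of t] by (auto simp: ennreal_mult_less_top)
  finally show "(\<integral>\<^sup>+r. ennreal (measure_conv (K r) (g (t - r)) x) \<partial>lebesgue) < \<infinity>" .
qed (auto simp: source_conv(3))

lemma time_conv_nonneg: "0 \<le> time_conv g t x"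
  unfolding time_conv_def by (simp add: source_conv(3))

lemma ennreal_time_conv:
  "ennreal (time_conv g t x) = (\<integral>\<^sup>+r. ennreal (measure_conv (K r) (g (t - r)) x) \<partial>lebesgue)"
  unfolding time_conv_def
  by (rule nn_integral_eq_integral[symmetric, OF source_conv_integrable]) (simp add: source_conv(3))

lemma time_conv_measurable [measurable]: "time_conv g t \<in> borel_measurable borel"
proof -
  interpret sigma_finite_measure "lebesgue :: real measure" by (rule sigma_finite_lebesgue)
  have [measurable]: "(\<lambda>(x, r). measure_conv (K r) (g (t - r)) x) \<in> borel_measurable (borel \<Otimes>\<^sub>M lebesgue)"
    using measurable_compose[OF measurable_pair_swap' source_conv_measurable[of t]]
    by (simp add: case_prod_beta')
  show ?thesis unfolding time_conv_def[abs_def]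
    by (rule borel_measurable_lebesgue_integral) measurable
qed

text \<open>Tonelli in time and space, then \<open>nn_integral_convolution\<close> at each fixed r.
  Applied to the p-th power of the solution, this is the source term of the mass identity.\<close>

lemma nn_integral_time_conv:
  "(\<integral>\<^sup>+x. ennreal (time_conv g t x) \<partial>lborel) =
   (\<integral>\<^sup>+r. emeasure (K r) UNIV * (\<integral>\<^sup>+x. ennreal (g (t - r) x) \<partial>lborel) \<partial>lebesgue)"
proof -
  interpret L: sigma_finite_measure "lebesgue :: real measure" by (rule sigma_finite_lebesgue)
  interpret pair_sigma_finite "lebesgue :: real measure" "lborel :: 'a measure" ..
  have "(\<integral>\<^sup>+x. ennreal (time_conv g t x) \<partial>lborel) =
    (\<integral>\<^sup>+x. (\<integral>\<^sup>+r. ennreal (measure_conv (K r) (g (t - r)) x) \<partial>lebesgue) \<partial>lborel)"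
    by (simp add: ennreal_time_conv)
  also have "\<dots> = (\<integral>\<^sup>+r. (\<integral>\<^sup>+x. ennreal (measure_conv (K r) (g (t - r)) x) \<partial>lborel) \<partial>lebesgue)"
    by (rule Fubini') measurable
  also have "\<dots> = (\<integral>\<^sup>+r. emeasure (K r) UNIV * (\<integral>\<^sup>+x. ennreal (g (t - r) x) \<partial>lborel) \<partial>lebesgue)"
    unfolding source_conv(2) by (subst nn_integral_convolution[OF finite_kernel]) auto
  finally show ?thesis .
qed

text \<open>Since K(r) is only measurable in r, continuity in t must come from the source. Both
  convolutions use the same \<open>K r\<close>, so their difference is the convolution of a
  difference of sources.\<close>

lemma time_conv_diff_le:
  "(\<integral>\<^sup>+x. ennreal \<bar>time_conv g t x - time_conv g t' x\<bar> \<partial>lborel) \<le>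
   (\<integral>\<^sup>+r. emeasure (K r) UNIV * (\<integral>\<^sup>+x. ennreal \<bar>g (t - r) x - g (t' - r) x\<bar> \<partial>lborel) \<partial>lebesgue)"
proof -
  interpret L: sigma_finite_measure "lebesgue :: real measure" by (rule sigma_finite_lebesgue)
  interpret pair_sigma_finite "lebesgue :: real measure" "lborel :: 'a measure" ..
  let ?q = "\<lambda>t r x. measure_conv (K r) (g (t - r)) x"
  have "(\<integral>\<^sup>+x. ennreal \<bar>time_conv g t x - time_conv g t' x\<bar> \<partial>lborel)
    \<le> (\<integral>\<^sup>+x. (\<integral>\<^sup>+r. ennreal \<bar>?q t r x - ?q t' r x\<bar> \<partial>lebesgue) \<partial>lborel)"
  proof (rule nn_integral_mono)
    fix x
    have "time_conv g t x - time_conv g t' x = (LINT r|lebesgue. ?q t r x - ?q t' r x)"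
      unfolding time_conv_def by (rule Bochner_Integration.integral_diff[symmetric]) (rule source_conv_integrable)+
    then show "ennreal \<bar>time_conv g t x - time_conv g t' x\<bar> \<le> (\<integral>\<^sup>+r. ennreal \<bar>?q t r x - ?q t' r x\<bar> \<partial>lebesgue)"
      using integral_norm_bound_ennreal[OF Bochner_Integration.integrable_diff[OF source_conv_integrable source_conv_integrable], of t x t' x]
      by simp
  qed
  also have "\<dots> = (\<integral>\<^sup>+r. (\<integral>\<^sup>+x. ennreal \<bar>?q t r x - ?q t' r x\<bar> \<partial>lborel) \<partial>lebesgue)"
    by (rule Fubini') measurable
  also have "\<dots> \<le> (\<integral>\<^sup>+r. (\<integral>\<^sup>+x. (\<integral>\<^sup>+y. ennreal \<bar>g (t - r) (x - y) - g (t' - r) (x - y)\<bar> \<partial>K r) \<partial>lborel) \<partial>lebesgue)"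
    by (intro nn_integral_mono measure_conv_diff_le source_conv(1))
  also have "\<dots> = (\<integral>\<^sup>+r. emeasure (K r) UNIV * (\<integral>\<^sup>+x. ennreal \<bar>g (t - r) x - g (t' - r) x\<bar> \<partial>lborel) \<partial>lebesgue)"
    by (subst nn_integral_convolution[OF finite_kernel, where f="\<lambda>x. ennreal \<bar>g (t - _) x - g (t' - _) x\<bar>"]) auto
  finally show ?thesis .
qed

end

section \<open>Bochner integrals in \<open>L\<^sup>1\<close> as pointwise integrals\<close>

text \<open>There are finitely many values, each a Borel function of x, and on each level set of s
  the map is one of these functions of x alone.\<close>

lemma simple_function_joint_measurable:
  assumes s: "simple_function M s" and "s ` space M \<subseteq> borel_measurable borel"
  shows "(\<lambda>(t, x). s t x :: real) \<in> borel_measurable (M \<Otimes>\<^sub>M borel)"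
proof -
  have "(\<lambda>z. (\<lambda>y z. y (snd z)) (s (fst z)) z) \<in> borel_measurable (M \<Otimes>\<^sub>M borel)"
  proof (rule measurable_compose_countable'[where I="s ` space M"])
    have "s \<in> M \<rightarrow>\<^sub>M count_space (s ` space M)"
      using s by (auto simp: simple_function_def measurable_count_space_eq2)
    then show "(\<lambda>z. s (fst z)) \<in> M \<Otimes>\<^sub>M borel \<rightarrow>\<^sub>M count_space (s ` space M)"
      by (rule measurable_compose[OF measurable_fst])
    show "(\<lambda>z. y (snd z)) \<in> borel_measurable (M \<Otimes>\<^sub>M borel)" if "y \<in> s ` space M" for y
      using that assms(2) by (intro measurable_compose[OF measurable_snd]) auto
    show "countable (s ` space M)"
      using s by (auto simp: simple_function_def intro: countable_finite)
  qed
  then show ?thesis by (simp add: case_prod_beta')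
qed

lemma Lp_simple_joint_measurable:
  "Lp_simple q I s \<Longrightarrow> (\<lambda>(t, x). s t x) \<in> borel_measurable (lebesgue_on I \<Otimes>\<^sub>M borel)"
  by (rule simple_function_joint_measurable) (auto simp: Lp_simple_def Lp_space_def)

lemma measurable_pair_restrict:
  "f \<in> borel_measurable (lebesgue \<Otimes>\<^sub>M N) \<Longrightarrow> f \<in> borel_measurable (lebesgue_on I \<Otimes>\<^sub>M N)"
proof -
  assume f: "f \<in> borel_measurable (lebesgue \<Otimes>\<^sub>M N)"
  have "(\<lambda>z. (fst z, snd z)) \<in> lebesgue_on I \<Otimes>\<^sub>M N \<rightarrow>\<^sub>M lebesgue \<Otimes>\<^sub>M N"
    by (intro measurable_Pair measurable_compose[OF measurable_fst] measurable_restrict_space1 measurable_snd) auto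
  from measurable_compose[OF this f] show ?thesis by simp
qed

text \<open>With a constant value off I, limits and case distinctions can be carried out on the
  whole time line, where the sigma-algebra is that of the Lebesgue sets.\<close>

lemma Lp_simple_extend:
  assumes s: "Lp_simple q I s" and I: "I \<in> sets lebesgue" and y: "y \<in> Lp_space q"
  shows "Lp_simple q UNIV (\<lambda>t. if t \<in> I then s t else y)"
  unfolding Lp_simple_def simple_function_def
proof (intro conjI ballI)
  let ?s = "\<lambda>t. if t \<in> I then s t else y"
  have "finite (s ` I)" and sY: "s ` I \<subseteq> Lp_space q"
    using s by (auto simp: Lp_simple_def simple_function_def)
  then show "finite (?s ` space (lebesgue_on UNIV))"
    by (intro finite_subset[of "?s ` _" "insert y (s ` I)"]) auto
  show "?s ` UNIV \<subseteq> Lp_space q"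
    using sY y by auto
  fix z
  have "s -` {z} \<inter> I \<in> sets (lebesgue_on I)"
    using simple_functionD(2)[of "lebesgue_on I" s "{z}"] s by (simp add: Lp_simple_def)
  then have "s -` {z} \<inter> I \<in> sets lebesgue"
    using I by (auto simp: sets_restrict_space_iff)
  moreover have "?s -` {z} \<inter> space (lebesgue_on UNIV) = (s -` {z} \<inter> I) \<union> (if y = z then - I else {})"
    by auto
  ultimately show "?s -` {z} \<inter> space (lebesgue_on UNIV) \<in> sets (lebesgue_on UNIV)"
    using I by (auto simp: lebesgue_on_UNIV_eq intro!: sets.Un Compl_in_sets_lebesgue[THEN iffD2])
qed

lemma zero_in_Lp_space_infinity: "(\<lambda>x. 0) \<in> Lp_space \<infinity>"
  using Lp_norm_infinity_le[of "\<lambda>x::'a::euclidean_space. 0" 0] by (auto simp: Lp_space_def le_zero_eq)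

text \<open>The values \<open>u t\<close> are arbitrary representatives of their classes, so \<open>u\<close> itself need not be jointly
  measurable.\<close>

lemma Lp_strongly_measurable_joint_representative:
  fixes u :: "real \<Rightarrow> 'a::euclidean_space \<Rightarrow> real"
  assumes I: "I \<in> sets lebesgue" and "Lp_strongly_measurable \<infinity> I u"
  obtains U where "(\<lambda>(t, x). U t x) \<in> borel_measurable (lebesgue \<Otimes>\<^sub>M borel)"
    and "AE t in lebesgue_on I. AE x in lborel. u t x = U t x"
proof -
  obtain s where s: "\<And>k::nat. Lp_simple \<infinity> I (s k)"
    and lim: "AE t in lebesgue_on I. (\<lambda>k. Lp_norm \<infinity> (\<lambda>x. u t x - s k t x)) \<longlonglongrightarrow> 0"
    using assms(2) by (auto simp: Lp_strongly_measurable_def)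
  define S where "S k t = (if t \<in> I then s k t else (\<lambda>x. 0))" for k t
  have [measurable]: "(\<lambda>(t, x). S k t x) \<in> borel_measurable (lebesgue \<Otimes>\<^sub>M borel)" for k
    using Lp_simple_joint_measurable[OF Lp_simple_extend[OF s I zero_in_Lp_space_infinity, of k]]
    unfolding S_def lebesgue_on_UNIV_eq .
  \<comment> \<open>Where the sequence diverges, \<open>lim\<close> is a fixed default. The function
    is measurable all the same, and for almost every t in I such x form a null set.\<close>
  have "(\<lambda>z. lim (\<lambda>k. S k (fst z) (snd z))) \<in> borel_measurable (lebesgue \<Otimes>\<^sub>M borel)"
    by (rule borel_measurable_lim_metric) measurable
  then have "(\<lambda>(t, x). lim (\<lambda>k. S k t x)) \<in> borel_measurable (lebesgue \<Otimes>\<^sub>M borel)"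
    by (simp add: case_prod_beta')
  moreover have "AE t in lebesgue_on I. AE x in lborel. u t x = lim (\<lambda>k. S k t x)"
    using lim AE_space[of "lebesgue_on I"]
  proof eventually_elim
    case (elim t)
    \<comment> \<open>Countably many k share one null set of x, so convergence in the essential
      supremum gives pointwise convergence without passing to a subsequence.\<close>
    have "AE x in lborel. \<forall>k. ennreal \<bar>u t x - s k t x\<bar> \<le> Lp_norm \<infinity> (\<lambda>x. u t x - s k t x)"
      using AE_le_Lp_norm_infinity by (subst AE_all_countable) auto
    then show ?case
    proof eventually_elim
      case (elim x)
      have "(\<lambda>k. ennreal \<bar>u t x - s k t x\<bar>) \<longlonglongrightarrow> 0"
        by (rule tendsto_sandwich[OF _ _ tendsto_const \<open>(\<lambda>k. Lp_norm \<infinity> _) \<longlonglongrightarrow> 0\<close>])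
           (use elim in auto)
      then have "(\<lambda>k. \<bar>u t x - s k t x\<bar>) \<longlonglongrightarrow> 0"
        by (simp add: tendsto_ennreal_iff flip: ennreal_0)
      then have "(\<lambda>k. u t x - (u t x - s k t x)) \<longlonglongrightarrow> u t x - 0"
        by (intro tendsto_diff tendsto_const) (simp add: tendsto_rabs_zero_iff)
      then have "(\<lambda>k. S k t x) \<longlonglongrightarrow> u t x"
        using \<open>t \<in> space (lebesgue_on I)\<close> by (simp add: S_def)
      then show ?case by (simp add: limI)
    qed
  qed
  ultimately show ?thesis by (rule that)
qed

lemma Lp_simple_integral_eq:
  assumes s: "Lp_simple q I s" and I: "I \<in> lmeasurable"
  shows "integrable (lebesgue_on I) (\<lambda>t. s t x)" (is ?A)
    and "Lp_simple_integral I s x = (LINT t|lebesgue_on I. s t x)" (is ?B)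
proof -
  interpret finite_measure "lebesgue_on I" using I by (rule finite_measure_lebesgue_on)
  have fin: "finite (s ` I)" and E: "\<And>y. s -` {y} \<inter> I \<in> sets (lebesgue_on I)"
    using s simple_functionD[of "lebesgue_on I" s] by (auto simp: Lp_simple_def)
  have eq: "s t x = (\<Sum>y\<in>s ` I. indicator (s -` {y} \<inter> I) t * y x)" if "t \<in> I" for t
  proof -
    have "(\<Sum>y\<in>s ` I. indicator (s -` {y} \<inter> I) t * y x) = (\<Sum>y\<in>s ` I. if y = s t then y x else 0)"
      using that by (intro sum.cong) (auto simp: indicator_def)
    then show ?thesis using fin that by simp
  qed
  have int: "integrable (lebesgue_on I) (\<lambda>t. indicator (s -` {y} \<inter> I) t * y x)" for y
    using E[of y] by (intro integrable_mult_left integrable_real_indicator) (auto simp: less_top[symmetric])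
  have "integrable (lebesgue_on I) (\<lambda>t. \<Sum>y\<in>s ` I. indicator (s -` {y} \<inter> I) t * y x)"
    using int by auto
  then show ?A
    by (rule Bochner_Integration.integrable_cong[THEN iffD1, rotated -1]) (auto simp: eq)
  have "(LINT t|lebesgue_on I. s t x) = (LINT t|lebesgue_on I. (\<Sum>y\<in>s ` I. indicator (s -` {y} \<inter> I) t * y x))"
    by (rule Bochner_Integration.integral_cong) (auto simp: eq)
  also have "\<dots> = (\<Sum>y\<in>s ` I. measure (lebesgue_on I) (s -` {y} \<inter> I) * y x)"
    by (subst Bochner_Integration.integral_sum[OF int]) (auto intro!: sum.cong simp: Int_assoc)
  also have "\<dots> = (\<Sum>y\<in>s ` I. measure lebesgue {t \<in> I. s t = y} * y x)"
  proof (rule sum.cong[OF refl])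
    fix y
    have "s -` {y} \<inter> I = {t \<in> I. s t = y}" by auto
    then show "measure (lebesgue_on I) (s -` {y} \<inter> I) * y x = measure lebesgue {t \<in> I. s t = y} * y x"
      using I by (subst measure_restrict_space) auto
  qed
  finally show ?B by (simp add: Lp_simple_integral_def)
qed

text \<open>The pivot between the two notions of integral. The same estimate shows that a given
  Bochner integral must be the pointwise one and that the pointwise one is a Bochner
  integral.\<close>

lemma simple_integral_error_le:
  fixes F :: "real \<Rightarrow> 'a::euclidean_space \<Rightarrow> real"
  assumes I: "I \<in> lmeasurable"
    and F [measurable]: "(\<lambda>(t, x). F t x) \<in> borel_measurable (lebesgue_on I \<Otimes>\<^sub>M borel)"
    and int: "\<And>x. integrable (lebesgue_on I) (\<lambda>t. F t x)"
    and f: "AE t in lebesgue_on I. AE x in lborel. f t x = F t x"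
    and s: "Lp_simple q I s"
  shows "(\<integral>\<^sup>+x. ennreal \<bar>(LINT t|lebesgue_on I. F t x) - Lp_simple_integral I s x\<bar> \<partial>lborel) \<le>
    (\<integral>\<^sup>+t. Lp_norm 1 (\<lambda>x. f t x - s t x) \<partial>lebesgue_on I)"
proof -
  note [measurable] = Lp_simple_joint_measurable[OF s]
  interpret T: finite_measure "lebesgue_on I" using I by (rule finite_measure_lebesgue_on)
  interpret pair_sigma_finite "lebesgue_on I" "lborel :: 'a measure" ..
  have "(\<integral>\<^sup>+x. ennreal \<bar>(LINT t|lebesgue_on I. F t x) - Lp_simple_integral I s x\<bar> \<partial>lborel)
    \<le> (\<integral>\<^sup>+x. (\<integral>\<^sup>+t. ennreal \<bar>F t x - s t x\<bar> \<partial>lebesgue_on I) \<partial>lborel)"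
  proof (rule nn_integral_mono)
    fix x
    note s' = Lp_simple_integral_eq[OF s I, of x]
    have "(LINT t|lebesgue_on I. F t x) - Lp_simple_integral I s x = (LINT t|lebesgue_on I. F t x - s t x)"
      unfolding s'(2) by (rule Bochner_Integration.integral_diff[OF int s'(1), symmetric])
    then show "ennreal \<bar>(LINT t|lebesgue_on I. F t x) - Lp_simple_integral I s x\<bar>
      \<le> (\<integral>\<^sup>+t. ennreal \<bar>F t x - s t x\<bar> \<partial>lebesgue_on I)"
      using integral_norm_bound_ennreal[OF Bochner_Integration.integrable_diff[OF int s'(1)]] by simp
  qed
  also have "\<dots> = (\<integral>\<^sup>+t. (\<integral>\<^sup>+x. ennreal \<bar>F t x - s t x\<bar> \<partial>lborel) \<partial>lebesgue_on I)"
    by (rule Fubini') measurable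
  also have "\<dots> = (\<integral>\<^sup>+t. Lp_norm 1 (\<lambda>x. f t x - s t x) \<partial>lebesgue_on I)"
    unfolding Lp_norm_1
  proof (rule nn_integral_cong_AE)
    show "AE t in lebesgue_on I. (\<integral>\<^sup>+x. ennreal \<bar>F t x - s t x\<bar> \<partial>lborel) = (\<integral>\<^sup>+x. ennreal \<bar>f t x - s t x\<bar> \<partial>lborel)"
      using f by eventually_elim (rule nn_integral_cong_AE, auto)
  qed
  finally show ?thesis .
qed

lemma Lp_simple_integral_measurable:
  "Lp_simple q I s \<Longrightarrow> Lp_simple_integral I s \<in> borel_measurable borel"
  unfolding Lp_simple_integral_def Lp_simple_def Lp_space_def
  by (intro borel_measurable_sum borel_measurable_times) auto

lemma integral_joint_measurable:
  fixes F :: "real \<Rightarrow> 'a::euclidean_space \<Rightarrow> real"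
  assumes I: "I \<in> lmeasurable"
    and F: "(\<lambda>(t, x). F t x) \<in> borel_measurable (lebesgue_on I \<Otimes>\<^sub>M borel)"
  shows "(\<lambda>x. LINT t|lebesgue_on I. F t x) \<in> borel_measurable borel"
proof -
  interpret T: finite_measure "lebesgue_on I" using I by (rule finite_measure_lebesgue_on)
  show ?thesis
    using measurable_compose[OF measurable_pair_swap' F]
    by (intro T.borel_measurable_lebesgue_integral) (simp add: case_prod_beta')
qed

lemma nn_integral_abs_diff_triangle:
  fixes f g h :: "'a \<Rightarrow> real"
  assumes [measurable]: "f \<in> borel_measurable M" "g \<in> borel_measurable M" "h \<in> borel_measurable M"
  shows "(\<integral>\<^sup>+x. ennreal \<bar>f x - h x\<bar> \<partial>M) \<le> (\<integral>\<^sup>+x. ennreal \<bar>f x - g x\<bar> \<partial>M) + (\<integral>\<^sup>+x. ennreal \<bar>g x - h x\<bar> \<partial>M)"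
proof -
  have "(\<integral>\<^sup>+x. ennreal \<bar>f x - h x\<bar> \<partial>M) \<le> (\<integral>\<^sup>+x. ennreal \<bar>f x - g x\<bar> + ennreal \<bar>g x - h x\<bar> \<partial>M)"
    by (intro nn_integral_mono) (auto simp flip: ennreal_plus intro!: ennreal_leI)
  also have "\<dots> = (\<integral>\<^sup>+x. ennreal \<bar>f x - g x\<bar> \<partial>M) + (\<integral>\<^sup>+x. ennreal \<bar>g x - h x\<bar> \<partial>M)"
    by (rule nn_integral_add) measurable
  finally show ?thesis .
qed

text \<open>The integrals of the approximants tend in L1 to w by definition and to the pointwise
  integral by \<open>simple_integral_error_le\<close>; L1 limits are unique almost
  everywhere.\<close>

lemma L1_bochner_integral_eq:
  fixes F :: "real \<Rightarrow> 'a::euclidean_space \<Rightarrow> real"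
  assumes I: "I \<in> lmeasurable"
    and F: "(\<lambda>(t, x). F t x) \<in> borel_measurable (lebesgue_on I \<Otimes>\<^sub>M borel)"
    and int: "\<And>x. integrable (lebesgue_on I) (\<lambda>t. F t x)"
    and f: "AE t in lebesgue_on I. AE x in lborel. f t x = F t x"
    and w: "has_Lp_bochner_integral 1 I f w"
  shows "AE x in lborel. w x = (LINT t|lebesgue_on I. F t x)"
proof -
  note [measurable] = integral_joint_measurable[OF I F]
  have [measurable]: "w \<in> borel_measurable borel"
    using w by (simp add: has_Lp_bochner_integral_def Lp_space_def)
  obtain s where s: "\<And>k::nat. Lp_simple 1 I (s k)"
    and l1: "(\<lambda>k. \<integral>\<^sup>+t. Lp_norm 1 (\<lambda>x. f t x - s k t x) \<partial>lebesgue_on I) \<longlonglongrightarrow> 0"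
    and l2: "(\<lambda>k. Lp_norm 1 (\<lambda>x. Lp_simple_integral I (s k) x - w x)) \<longlonglongrightarrow> 0"
    using w by (auto simp: has_Lp_bochner_integral_def)
  note [measurable] = Lp_simple_integral_measurable[OF s]
  let ?d = "\<integral>\<^sup>+x. ennreal \<bar>(LINT t|lebesgue_on I. F t x) - w x\<bar> \<partial>lborel"
  have "?d \<le> (\<integral>\<^sup>+t. Lp_norm 1 (\<lambda>x. f t x - s k t x) \<partial>lebesgue_on I)
      + Lp_norm 1 (\<lambda>x. Lp_simple_integral I (s k) x - w x)" for k
  proof -
    have "?d \<le> (\<integral>\<^sup>+x. ennreal \<bar>(LINT t|lebesgue_on I. F t x) - Lp_simple_integral I (s k) x\<bar> \<partial>lborel)
      + (\<integral>\<^sup>+x. ennreal \<bar>Lp_simple_integral I (s k) x - w x\<bar> \<partial>lborel)"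
      by (rule nn_integral_abs_diff_triangle) measurable
    also have "\<dots> \<le> (\<integral>\<^sup>+t. Lp_norm 1 (\<lambda>x. f t x - s k t x) \<partial>lebesgue_on I)
      + Lp_norm 1 (\<lambda>x. Lp_simple_integral I (s k) x - w x)"
      unfolding Lp_norm_1[of "\<lambda>x. Lp_simple_integral I (s k) x - w x"]
      by (intro add_right_mono simple_integral_error_le[OF I F int f s])
    finally show ?thesis .
  qed
  then have "?d \<le> 0 + 0"
    by (intro tendsto_lowerbound[OF tendsto_add[OF l1 l2]]) auto
  then have "AE x in lborel. ennreal \<bar>(LINT t|lebesgue_on I. F t x) - w x\<bar> = 0"
    by (subst nn_integral_0_iff_AE[symmetric]) auto
  then show ?thesis by eventually_elim (simp add: ennreal_eq_0_iff)
qed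

section \<open>L1 approximation by functions that are simple in time\<close>

lemma Lp_space_1_iff: "f \<in> Lp_space 1 \<longleftrightarrow> integrable lborel f"
  by (auto simp: Lp_space_def Lp_norm_1 integrable_iff_bounded)

lemma Lp_simple_1_add:
  assumes "Lp_simple 1 I s" "Lp_simple 1 I s'"
  shows "Lp_simple 1 I (\<lambda>t x. s t x + s' t x)"
  using assms unfolding Lp_simple_def
  by (auto simp: simple_function_compose2[where h="\<lambda>f g x. f x + g x"] Lp_space_1_iff image_subset_iff)

lemma Lp_simple_1_scale:
  assumes "Lp_simple 1 I s"
  shows "Lp_simple 1 I (\<lambda>t x. c * s t x)"
  using assms unfolding Lp_simple_def
  by (auto simp: simple_function_compose1[where g="\<lambda>f x. c * f x"] Lp_space_1_iff image_subset_iff)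

text \<open>The approximants are step functions of time whose values are arbitrary elements of L1 in
  space. By Tonelli the error in the product measure is the time integral of the L1 errors. The
  epsilon form is stable under sums, multiples and dominated limits, as an induction over integrable
  functions requires.\<close>

definition simple_approximable :: "real set \<Rightarrow> (real \<times> 'a::euclidean_space \<Rightarrow> real) \<Rightarrow> bool" where
  "simple_approximable I F \<longleftrightarrow> F \<in> borel_measurable (lebesgue_on I \<Otimes>\<^sub>M lborel) \<and>
     (\<forall>e>0. \<exists>s. Lp_simple 1 I s \<and>
        (\<integral>\<^sup>+z. ennreal \<bar>F z - s (fst z) (snd z)\<bar> \<partial>(lebesgue_on I \<Otimes>\<^sub>M lborel)) < ennreal e)"

lemma simple_approximableI_Lp_simple:
  fixes s :: "real \<Rightarrow> 'a::euclidean_space \<Rightarrow> real"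
  assumes "Lp_simple 1 I s"
  shows "simple_approximable I (\<lambda>z. s (fst z) (snd z))"
  unfolding simple_approximable_def
  using assms Lp_simple_joint_measurable[OF assms] by (auto intro!: exI[of _ s] simp: case_prod_beta')

lemma simple_approximable_add:
  fixes F G :: "real \<times> 'a::euclidean_space \<Rightarrow> real"
  assumes F: "simple_approximable I F" and G: "simple_approximable I G"
  shows "simple_approximable I (\<lambda>z. F z + G z)"
  unfolding simple_approximable_def
proof (intro conjI allI impI)
  let ?P = "lebesgue_on I \<Otimes>\<^sub>M (lborel :: 'a measure)"
  show "(\<lambda>z. F z + G z) \<in> borel_measurable ?P"
    using F G by (auto simp: simple_approximable_def)
  fix e :: real assume "e > 0"
  then have "e / 2 > 0" by simp
  then obtain s s' where s: "Lp_simple 1 I s" "(\<integral>\<^sup>+z. ennreal \<bar>F z - s (fst z) (snd z)\<bar> \<partial>?P) < ennreal (e/2)"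
    and s': "Lp_simple 1 I s'" "(\<integral>\<^sup>+z. ennreal \<bar>G z - s' (fst z) (snd z)\<bar> \<partial>?P) < ennreal (e/2)"
    using F G unfolding simple_approximable_def by meson
  have [measurable]: "F \<in> borel_measurable ?P" "G \<in> borel_measurable ?P"
    "(\<lambda>z. s (fst z) (snd z)) \<in> borel_measurable ?P" "(\<lambda>z. s' (fst z) (snd z)) \<in> borel_measurable ?P"
    using F G Lp_simple_joint_measurable[OF s(1)] Lp_simple_joint_measurable[OF s'(1)]
    by (auto simp: simple_approximable_def case_prod_beta')
  have "(\<integral>\<^sup>+z. ennreal \<bar>F z + G z - (s (fst z) (snd z) + s' (fst z) (snd z))\<bar> \<partial>?P)
    \<le> (\<integral>\<^sup>+z. ennreal \<bar>F z - s (fst z) (snd z)\<bar> + ennreal \<bar>G z - s' (fst z) (snd z)\<bar> \<partial>?P)"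
    by (intro nn_integral_mono) (auto simp flip: ennreal_plus intro!: ennreal_leI)
  also have "\<dots> = (\<integral>\<^sup>+z. ennreal \<bar>F z - s (fst z) (snd z)\<bar> \<partial>?P) + (\<integral>\<^sup>+z. ennreal \<bar>G z - s' (fst z) (snd z)\<bar> \<partial>?P)"
    by (rule nn_integral_add) measurable
  also have "\<dots> < ennreal (e/2) + ennreal (e/2)"
    by (rule add_strict_mono[OF s(2) s'(2)])
  also have "\<dots> = ennreal e" using \<open>e > 0\<close> by (simp flip: ennreal_plus)
  finally show "\<exists>s. Lp_simple 1 I s \<and>
        (\<integral>\<^sup>+z. ennreal \<bar>F z + G z - s (fst z) (snd z)\<bar> \<partial>?P) < ennreal e"
    using Lp_simple_1_add[OF s(1) s'(1)] by blast
qed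

lemma simple_approximable_scale:
  fixes F :: "real \<times> 'a::euclidean_space \<Rightarrow> real"
  assumes F: "simple_approximable I F"
  shows "simple_approximable I (\<lambda>z. c * F z)"
  unfolding simple_approximable_def
proof (intro conjI allI impI)
  let ?P = "lebesgue_on I \<Otimes>\<^sub>M (lborel :: 'a measure)"
  have [measurable]: "F \<in> borel_measurable ?P" using F by (auto simp: simple_approximable_def)
  show "(\<lambda>z. c * F z) \<in> borel_measurable ?P" by simp
  fix e :: real assume "e > 0"
  then have e': "e / (\<bar>c\<bar> + 1) > 0" by simp
  then obtain s where s: "Lp_simple 1 I s" "(\<integral>\<^sup>+z. ennreal \<bar>F z - s (fst z) (snd z)\<bar> \<partial>?P) < ennreal (e / (\<bar>c\<bar> + 1))"
    using F unfolding simple_approximable_def by meson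
  have [measurable]: "(\<lambda>z. s (fst z) (snd z)) \<in> borel_measurable ?P"
    using Lp_simple_joint_measurable[OF s(1)] by (auto simp: case_prod_beta')
  have "(\<integral>\<^sup>+z. ennreal \<bar>c * F z - c * s (fst z) (snd z)\<bar> \<partial>?P)
    = (\<integral>\<^sup>+z. ennreal \<bar>c\<bar> * ennreal \<bar>F z - s (fst z) (snd z)\<bar> \<partial>?P)"
    by (intro nn_integral_cong) (simp add: abs_mult flip: ennreal_mult right_diff_distrib)
  also have "\<dots> = ennreal \<bar>c\<bar> * (\<integral>\<^sup>+z. ennreal \<bar>F z - s (fst z) (snd z)\<bar> \<partial>?P)"
    by (rule nn_integral_cmult) measurable
  also have "\<dots> \<le> ennreal \<bar>c\<bar> * ennreal (e / (\<bar>c\<bar> + 1))"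
    using s(2) by (intro mult_left_mono) auto
  also have "\<dots> = ennreal (\<bar>c\<bar> * (e / (\<bar>c\<bar> + 1)))"
    using e' by (subst ennreal_mult) auto
  also have "\<dots> < ennreal e"
    using \<open>e > 0\<close> by (intro ennreal_lessI) (auto simp: field_simps)
  finally show "\<exists>s. Lp_simple 1 I s \<and>
        (\<integral>\<^sup>+z. ennreal \<bar>c * F z - s (fst z) (snd z)\<bar> \<partial>?P) < ennreal e"
    using Lp_simple_1_scale[OF s(1)] by blast
qed

lemma simple_approximable_limit:
  fixes F :: "real \<times> 'a::euclidean_space \<Rightarrow> real"
  assumes G: "\<And>k::nat. simple_approximable I (G k)"
    and F: "F \<in> borel_measurable (lebesgue_on I \<Otimes>\<^sub>M lborel)"
    and lim: "\<And>z. z \<in> space (lebesgue_on I \<Otimes>\<^sub>M (lborel :: 'a measure)) \<Longrightarrow> (\<lambda>k. G k z) \<longlonglongrightarrow> F z"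
    and W: "W \<in> borel_measurable (lebesgue_on I \<Otimes>\<^sub>M lborel)"
      "(\<integral>\<^sup>+z. ennreal (W z) \<partial>(lebesgue_on I \<Otimes>\<^sub>M lborel)) < \<infinity>"
    and dom: "\<And>k z. z \<in> space (lebesgue_on I \<Otimes>\<^sub>M (lborel :: 'a measure)) \<Longrightarrow> \<bar>F z - G k z\<bar> \<le> W z"
  shows "simple_approximable I F"
  unfolding simple_approximable_def
proof (intro conjI allI impI)
  let ?P = "lebesgue_on I \<Otimes>\<^sub>M (lborel :: 'a measure)"
  note [measurable] = F W(1)
  have G'[measurable]: "G k \<in> borel_measurable ?P" for k using G by (auto simp: simple_approximable_def)
  have "(\<lambda>k. \<integral>\<^sup>+z. ennreal \<bar>F z - G k z\<bar> \<partial>?P) \<longlonglongrightarrow> (\<integral>\<^sup>+z. 0 \<partial>?P)"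
  proof (rule nn_integral_dominated_convergence[where w="\<lambda>z. ennreal (W z)"])
    show "AE z in ?P. (\<lambda>k. ennreal \<bar>F z - G k z\<bar>) \<longlonglongrightarrow> 0"
    proof (rule AE_I2)
      fix z assume "z \<in> space ?P"
      from tendsto_rabs[OF tendsto_diff[OF tendsto_const lim[OF this]], of "F z"]
      show "(\<lambda>k. ennreal \<bar>F z - G k z\<bar>) \<longlonglongrightarrow> 0"
        by (simp add: tendsto_ennreal_iff flip: ennreal_0)
    qed
  qed (use W(2) dom in \<open>auto intro!: ennreal_leI AE_I2\<close>)
  then have lim0: "(\<lambda>k. \<integral>\<^sup>+z. ennreal \<bar>F z - G k z\<bar> \<partial>?P) \<longlonglongrightarrow> 0" by simp
  fix e :: real assume "e > 0"
  then have e: "0 < e / 2" by simp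
  then have "eventually (\<lambda>k. (\<integral>\<^sup>+z. ennreal \<bar>F z - G k z\<bar> \<partial>?P) < ennreal (e / 2)) sequentially"
    by (intro order_tendstoD(2)[OF lim0]) auto
  then obtain k where k: "(\<integral>\<^sup>+z. ennreal \<bar>F z - G k z\<bar> \<partial>?P) < ennreal (e / 2)"
    by (auto simp: eventually_sequentially)
  obtain s where s: "Lp_simple 1 I s" "(\<integral>\<^sup>+z. ennreal \<bar>G k z - s (fst z) (snd z)\<bar> \<partial>?P) < ennreal (e / 2)"
    using G[of k] e unfolding simple_approximable_def by meson
  have [measurable]: "(\<lambda>z. s (fst z) (snd z)) \<in> borel_measurable ?P"
    using Lp_simple_joint_measurable[OF s(1)] by (auto simp: case_prod_beta')
  have "(\<integral>\<^sup>+z. ennreal \<bar>F z - s (fst z) (snd z)\<bar> \<partial>?P)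
     \<le> (\<integral>\<^sup>+z. ennreal \<bar>F z - G k z\<bar> \<partial>?P) + (\<integral>\<^sup>+z. ennreal \<bar>G k z - s (fst z) (snd z)\<bar> \<partial>?P)"
    by (rule nn_integral_abs_diff_triangle) measurable
  also have "\<dots> < ennreal (e/2) + ennreal (e/2)"
    by (rule add_strict_mono[OF k s(2)])
  also have "\<dots> = ennreal e" using \<open>e > 0\<close> by (simp flip: ennreal_plus)
  finally show "\<exists>s. Lp_simple 1 I s \<and>
        (\<integral>\<^sup>+z. ennreal \<bar>F z - s (fst z) (snd z)\<bar> \<partial>?P) < ennreal e"
    using s(1) by blast
qed (rule F)

text \<open>Boundedness of B makes its measure finite and so places the value
  \<open>indicator B\<close> in L1.\<close>

lemma simple_approximable_rectangle:
  fixes B :: "'a::euclidean_space set"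
  assumes A: "A \<in> sets (lebesgue_on I)" and B: "B \<in> sets borel" "bounded B"
  shows "simple_approximable I (indicator (A \<times> B))"
proof -
  have "emeasure lborel B < \<infinity>" using emeasure_bounded_finite[OF B(2)] by simp
  then have "Lp_simple 1 I (\<lambda>t x. indicator A t * indicator B x)"
    unfolding Lp_simple_def
    using simple_function_compose1[OF simple_function_indicator[OF A], where g="\<lambda>a x. a * indicator B x"] B
    by (auto simp: Lp_space_1_iff)
  from simple_approximableI_Lp_simple[OF this]
  have "simple_approximable I (\<lambda>z. indicator A (fst z) * indicator B (snd z))" .
  also have "(\<lambda>z. indicator A (fst z) * indicator B (snd z)) = (indicator (A \<times> B) :: _ \<Rightarrow> real)"
    by (auto simp: indicator_def fun_eq_iff)
  finally show ?thesis .
qed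

lemma simple_approximable_zero: "simple_approximable I (\<lambda>z :: real \<times> 'a::euclidean_space. 0)"
proof -
  have "(indicator {} :: real \<times> 'a \<Rightarrow> real) = (\<lambda>z. 0)" by auto
  then show ?thesis using simple_approximable_rectangle[of "{}" I "{} :: 'a set"] by simp
qed

text \<open>Dynkin induction starting from rectangles. Cutting with a fixed set of finite measure
  turns complements into differences of approximable functions and provides an integrable majorant
  for disjoint unions.\<close>

lemma simple_approximable_indicator_bounded:
  fixes n :: nat and A :: "(real \<times> 'a::euclidean_space) set"
  assumes I: "I \<in> lmeasurable" and A: "A \<in> sets (lebesgue_on I \<Otimes>\<^sub>M lborel)"
  shows "simple_approximable I (indicator (A \<inter> (I \<times> ball 0 (real n))))"
proof -
  let ?P = "lebesgue_on I \<Otimes>\<^sub>M (lborel :: 'a measure)"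
  let ?R = "I \<times> ball (0::'a) (real n)"
  interpret T: finite_measure "lebesgue_on I" using I by (rule finite_measure_lebesgue_on)
  have R [measurable]: "?R \<in> sets ?P" by (intro pair_measureI) auto
  have "emeasure ?P ?R = emeasure (lebesgue_on I) I * emeasure lborel (ball (0::'a) n)"
    by (subst lborel.emeasure_pair_measure_Times) auto
  also have "\<dots> < \<infinity>"
    using T.emeasure_finite[of I] emeasure_bounded_finite[OF bounded_ball, of "0::'a" "real n"]
    by (simp add: ennreal_mult_eq_top_iff less_top[symmetric])
  finally have Rfin: "emeasure ?P ?R < \<infinity>" .
  have sets_P: "sets ?P = sigma_sets (I \<times> UNIV) {a \<times> b | a b. a \<in> sets (lebesgue_on I) \<and> b \<in> sets lborel}"
    by (simp add: sets_pair_measure)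
  have W: "indicator ?R \<in> borel_measurable ?P" "(\<integral>\<^sup>+z. ennreal (indicator ?R z) \<partial>?P) < \<infinity>"
    using Rfin by (auto simp: ennreal_indicator)
  have sub: "{a \<times> b | a b. a \<in> sets (lebesgue_on I) \<and> b \<in> sets (lborel :: 'a measure)} \<subseteq> Pow (I \<times> UNIV)"
    using sets.sets_into_space[of _ "lebesgue_on I"] by auto
  from A show ?thesis
    unfolding sets_P
  proof (induction rule: sigma_sets_induct_disjoint[OF Int_stable_pair_measure_generator sub, consumes 1, case_names basic empty compl union])
    case (basic A)
    then obtain a b where ab: "A = a \<times> b" "a \<in> sets (lebesgue_on I)" "b \<in> sets borel" by auto
    have "A \<inter> ?R = a \<times> (b \<inter> ball 0 n)"
      using sets.sets_into_space[OF ab(2)] ab(1) by auto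
    then show ?case
      using ab by (auto intro!: simple_approximable_rectangle)
  next
    case empty
    have "(indicator ({} \<inter> ?R) :: _ \<Rightarrow> real) = (\<lambda>z. 0)" by auto
    then show ?case using simple_approximable_zero by simp
  next
    case (compl A)
    have "simple_approximable I (\<lambda>z. indicator ?R z + (- 1) * indicator (A \<inter> ?R) z)"
      by (intro simple_approximable_add simple_approximable_scale compl.IH simple_approximable_rectangle) auto
    also have "(\<lambda>z. indicator ?R z + (- 1) * indicator (A \<inter> ?R) z) = (indicator ((I \<times> UNIV - A) \<inter> ?R) :: _ \<Rightarrow> real)"
      by (auto simp: indicator_def fun_eq_iff)
    finally show ?case .
  next
    case (union A)
    have A: "A i \<in> sets ?P" for i using union.hyps(2) unfolding sets_P by auto
    have sum_eq: "(\<Sum>i<k. indicator (A i \<inter> ?R) z) = (indicator (\<Union>i<k. A i \<inter> ?R) z :: real)" for k z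
      by (rule indicator_UN_disjoint[symmetric])
         (use union.hyps(1) in \<open>auto simp: disjoint_family_on_def\<close>)
    show ?case
    proof (rule simple_approximable_limit[where W="indicator ?R" and G="\<lambda>k z. \<Sum>i<k. indicator (A i \<inter> ?R) z"])
      show "simple_approximable I (\<lambda>z. \<Sum>i<k. indicator (A i \<inter> ?R) z)" for k
      proof (induction k)
        case 0
        then show ?case using simple_approximable_zero by simp
      next
        case (Suc k)
        then show ?case using simple_approximable_add[OF Suc union.IH[of k]] by simp
      qed
      show "indicator ((\<Union>i. A i) \<inter> ?R) \<in> borel_measurable ?P" using A R by auto
      show "(\<lambda>k. \<Sum>i<k. indicator (A i \<inter> ?R) z) \<longlonglongrightarrow> (indicator ((\<Union>i. A i) \<inter> ?R) z :: real)" for z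
        unfolding sum_eq using LIMSEQ_indicator_UN[of "\<lambda>i. A i \<inter> ?R" z] by (simp add: Int_UN_distrib2)
      show "\<bar>indicator ((\<Union>i. A i) \<inter> ?R) z - (\<Sum>i<k. indicator (A i \<inter> ?R) z)\<bar> \<le> (indicator ?R z :: real)" for k z
        unfolding sum_eq by (auto simp: indicator_def)
    qed (rule W)+
  qed
qed

lemma simple_approximable_integrable:
  fixes F :: "real \<times> 'a::euclidean_space \<Rightarrow> real"
  assumes I: "I \<in> lmeasurable" and F: "integrable (lebesgue_on I \<Otimes>\<^sub>M lborel) F"
  shows "simple_approximable I F"
  using F
proof (induction rule: integrable_induct)
  let ?P = "lebesgue_on I \<Otimes>\<^sub>M (lborel :: 'a measure)"
  case (base A c)
  have "simple_approximable I (indicator A)"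
  \<comment> \<open>The set A has finite measure but may be unbounded in space, so it is exhausted
    by its intersections with balls.\<close>
  proof (rule simple_approximable_limit)
    show "simple_approximable I (indicator (A \<inter> (I \<times> ball 0 (real n))))" for n
      by (rule simple_approximable_indicator_bounded[OF I base(1)])
    show "indicator A \<in> borel_measurable ?P" "indicator A \<in> borel_measurable ?P" using base(1) by auto
    show "(\<integral>\<^sup>+z. ennreal (indicator A z) \<partial>?P) < \<infinity>" using base by (simp add: ennreal_indicator)
    show "\<bar>indicator A z - indicator (A \<inter> (I \<times> ball 0 (real n))) z\<bar> \<le> (indicator A z :: real)" for n z
      by (auto simp: indicator_def)
    show "(\<lambda>n. indicator (A \<inter> (I \<times> ball 0 (real n))) z) \<longlonglongrightarrow> (indicator A z :: real)" if "z \<in> space ?P" for z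
    proof (rule tendsto_eventually)
      obtain n0 :: nat where "norm (snd z) < n0" using reals_Archimedean2 by blast
      then show "\<forall>\<^sub>F n in sequentially. indicator (A \<inter> (I \<times> ball 0 (real n))) z = (indicator A z :: real)"
        using that unfolding eventually_sequentially
        by (intro exI[of _ n0]) (auto simp: indicator_def space_pair_measure)
    qed
  qed
  from simple_approximable_scale[OF this, of c] show ?case by (simp add: mult.commute)
next
  case (add f g)
  then show ?case by (intro simple_approximable_add)
next
  case (lim f s)
  show ?case
  \<comment> \<open>The induction supplies approximants bounded by twice the norm of f, hence the
    factor 3 for the difference.\<close>
  proof (rule simple_approximable_limit[where W="\<lambda>z. 3 * norm (f z)" and G=s])
    have "integrable (lebesgue_on I \<Otimes>\<^sub>M lborel) (\<lambda>z. 3 * norm (f z))" using lim by auto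
    then show "(\<integral>\<^sup>+z. ennreal (3 * norm (f z)) \<partial>(lebesgue_on I \<Otimes>\<^sub>M lborel)) < \<infinity>"
      unfolding integrable_iff_bounded by simp
    fix k z assume "z \<in> space (lebesgue_on I \<Otimes>\<^sub>M (lborel :: 'a measure))"
    from lim.hyps(3)[OF this, of k] show "\<bar>f z - s k z\<bar> \<le> 3 * norm (f z)" by simp
  qed (use lim in auto)
qed

text \<open>This direction produces the Bochner integral needed at the end point. Borel
  measurability of \<open>f t\<close> is asked for separately because members of
  \<open>Lp_space\<close> are Borel functions, and agreement almost everywhere with a Borel function
  does not give that.\<close>

lemma has_L1_bochner_integral_joint:
  fixes F :: "real \<Rightarrow> 'a::euclidean_space \<Rightarrow> real"
  assumes I: "I \<in> lmeasurable"
    and F: "(\<lambda>(t, x). F t x) \<in> borel_measurable (lebesgue_on I \<Otimes>\<^sub>M borel)"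
    and fin: "(\<integral>\<^sup>+t. (\<integral>\<^sup>+x. ennreal \<bar>F t x\<bar> \<partial>lborel) \<partial>lebesgue_on I) < \<infinity>"
    and int: "\<And>x. integrable (lebesgue_on I) (\<lambda>t. F t x)"
    and fF: "AE t in lebesgue_on I. AE x in lborel. f t x = F t x"
    and f: "AE t in lebesgue_on I. f t \<in> borel_measurable borel"
  shows "has_Lp_bochner_integral 1 I f (\<lambda>x. LINT t|lebesgue_on I. F t x)"
proof -
  let ?P = "lebesgue_on I \<Otimes>\<^sub>M (lborel :: 'a measure)"
  interpret T: finite_measure "lebesgue_on I" using I by (rule finite_measure_lebesgue_on)
  interpret pair_sigma_finite "lebesgue_on I" "lborel :: 'a measure" ..
  have F' [measurable]: "(\<lambda>z. F (fst z) (snd z)) \<in> borel_measurable ?P"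
    using F by (simp add: case_prod_beta')
  have fin': "(\<integral>\<^sup>+z. ennreal \<bar>F (fst z) (snd z)\<bar> \<partial>?P) < \<infinity>"
    using fin by (subst lborel.nn_integral_fst[symmetric]) auto
  then have "integrable ?P (\<lambda>z. F (fst z) (snd z))"
    by (auto simp: integrable_iff_bounded)
  from simple_approximable_integrable[OF I this]
  have "\<exists>s. Lp_simple 1 I s \<and>
     (\<integral>\<^sup>+z. ennreal \<bar>F (fst z) (snd z) - s (fst z) (snd z)\<bar> \<partial>?P) < ennreal ((1/2)^k)" for k
    by (simp add: simple_approximable_def)
  then have "\<exists>s. \<forall>k::nat. Lp_simple 1 I (s k) \<and>
     (\<integral>\<^sup>+z. ennreal \<bar>F (fst z) (snd z) - s k (fst z) (snd z)\<bar> \<partial>?P) < ennreal ((1/2)^k)"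
    by (intro choice allI)
  then obtain s where s: "\<And>k::nat. Lp_simple 1 I (s k)"
    and le: "\<And>k. (\<integral>\<^sup>+z. ennreal \<bar>F (fst z) (snd z) - s k (fst z) (snd z)\<bar> \<partial>?P) < ennreal ((1/2)^k)"
    by blast
  have sm [measurable]: "(\<lambda>z. s k (fst z) (snd z)) \<in> borel_measurable ?P" for k
    using Lp_simple_joint_measurable[OF s] by (auto simp: case_prod_beta')
  define d where "d k t = (\<integral>\<^sup>+x. ennreal \<bar>F t x - s k t x\<bar> \<partial>lborel)" for k t
  have d_meas [measurable]: "d k \<in> borel_measurable (lebesgue_on I)" for k
    unfolding d_def[abs_def]
    using lborel.borel_measurable_nn_integral_fst[of "\<lambda>z. ennreal \<bar>F (fst z) (snd z) - s k (fst z) (snd z)\<bar>" "lebesgue_on I"]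
    by simp
  have d_int: "(\<integral>\<^sup>+t. d k t \<partial>lebesgue_on I) < ennreal ((1/2)^k)" for k
    using le[of k] unfolding d_def by (subst (asm) lborel.nn_integral_fst[symmetric]) auto
  have d_eq: "AE t in lebesgue_on I. \<forall>k. Lp_norm 1 (\<lambda>x. f t x - s k t x) = d k t"
    using fF unfolding Lp_norm_1 d_def
    by eventually_elim (auto intro!: nn_integral_cong_AE)
  have half: "(\<lambda>k. ennreal ((1/2)^k)) \<longlonglongrightarrow> 0"
    using LIMSEQ_realpow_zero[of "1/2::real"] by (simp add: tendsto_ennreal_iff flip: ennreal_0)
  \<comment> \<open>The errors were chosen below \<open>(1/2)^k\<close> to be summable: then the sum
    of the \<open>d k t\<close> is finite for almost every t, and convergence in the mean is
    upgraded to the convergence at almost every time that strong measurability demands.\<close>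
  have "(\<integral>\<^sup>+t. (\<Sum>k. d k t) \<partial>lebesgue_on I) = (\<Sum>k. \<integral>\<^sup>+t. d k t \<partial>lebesgue_on I)"
    by (rule nn_integral_suminf) measurable
  also have "\<dots> \<le> (\<Sum>k. ennreal ((1/2)^k))"
    using d_int by (intro suminf_le) (auto intro: less_imp_le)
  also have "\<dots> = ennreal (\<Sum>k. (1/2)^k)"
    by (rule suminf_ennreal2) (auto simp: summable_geometric)
  finally have "(\<integral>\<^sup>+t. (\<Sum>k. d k t) \<partial>lebesgue_on I) \<noteq> \<infinity>"
    by (auto simp: top_unique)
  then have "AE t in lebesgue_on I. (\<Sum>k. d k t) \<noteq> \<infinity>"
    by (intro nn_integral_PInf_AE) auto
  then have "AE t in lebesgue_on I. (\<lambda>k. d k t) \<longlonglongrightarrow> 0"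
  proof eventually_elim
    case (elim t)
    have *: "d k t \<noteq> \<infinity>" for k
      using elim sum_le_suminf[of "\<lambda>k. d k t" "{k}"] by (auto simp: top_unique)
    then have eq: "d k t = ennreal (enn2real (d k t))" for k
      by (simp add: top.not_eq_extremum)
    have "summable (\<lambda>k. enn2real (d k t))"
      using elim by (intro summable_suminf_not_top) (auto simp flip: eq)
    from tendsto_ennrealI[OF summable_LIMSEQ_zero[OF this]] show ?case
      by (simp flip: eq)
  qed
  then have ae: "AE t in lebesgue_on I. (\<lambda>k. Lp_norm 1 (\<lambda>x. f t x - s k t x)) \<longlonglongrightarrow> 0"
    using d_eq by eventually_elim simp
  have int_eq: "(\<integral>\<^sup>+t. Lp_norm 1 (\<lambda>x. f t x - s k t x) \<partial>lebesgue_on I) = (\<integral>\<^sup>+t. d k t \<partial>lebesgue_on I)" for k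
    using d_eq by (intro nn_integral_cong_AE) auto
  have int0: "(\<lambda>k. \<integral>\<^sup>+t. Lp_norm 1 (\<lambda>x. f t x - s k t x) \<partial>lebesgue_on I) \<longlonglongrightarrow> 0"
    unfolding int_eq
    by (rule tendsto_sandwich[OF _ _ tendsto_const half]) (auto intro!: always_eventually less_imp_le[OF d_int])
  have w [measurable]: "(\<lambda>x. LINT t|lebesgue_on I. F t x) \<in> borel_measurable borel"
    by (rule integral_joint_measurable[OF I F])
  have "AE t in lebesgue_on I. (\<integral>\<^sup>+x. ennreal \<bar>F t x\<bar> \<partial>lborel) \<noteq> \<infinity>"
    using fin lborel.borel_measurable_nn_integral_fst[of "\<lambda>z. ennreal \<bar>F (fst z) (snd z)\<bar>" "lebesgue_on I"]
    by (intro nn_integral_PInf_AE) auto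
  then have "AE t in lebesgue_on I. f t \<in> Lp_space 1"
    using fF f
  proof eventually_elim
    case (elim t)
    have "(\<integral>\<^sup>+x. ennreal \<bar>f t x\<bar> \<partial>lborel) = (\<integral>\<^sup>+x. ennreal \<bar>F t x\<bar> \<partial>lborel)"
      using elim(2) by (intro nn_integral_cong_AE) auto
    then show ?case
      using elim by (simp add: Lp_space_def Lp_norm_1 less_top)
  qed
  then have "Lp_strongly_measurable 1 I f"
    using s ae by (auto simp: Lp_strongly_measurable_def)
  moreover have "(\<lambda>x. LINT t|lebesgue_on I. F t x) \<in> Lp_space 1"
  proof -
    have "(\<integral>\<^sup>+x. ennreal \<bar>LINT t|lebesgue_on I. F t x\<bar> \<partial>lborel)
      \<le> (\<integral>\<^sup>+x. (\<integral>\<^sup>+t. ennreal \<bar>F t x\<bar> \<partial>lebesgue_on I) \<partial>lborel)"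
      using integral_norm_bound_ennreal[OF int] by (intro nn_integral_mono) simp
    also have "\<dots> = (\<integral>\<^sup>+t. (\<integral>\<^sup>+x. ennreal \<bar>F t x\<bar> \<partial>lborel) \<partial>lebesgue_on I)"
      using F' by (intro Fubini') (simp add: case_prod_beta')
    finally show ?thesis
      using fin by (simp add: Lp_space_def Lp_norm_1 le_less_trans)
  qed
  moreover have "(\<lambda>k. Lp_norm 1 (\<lambda>x. Lp_simple_integral I (s k) x - (LINT t|lebesgue_on I. F t x))) \<longlonglongrightarrow> 0"
  proof (rule tendsto_sandwich[OF _ _ tendsto_const int0])
    show "\<forall>\<^sub>F k in sequentially. Lp_norm 1 (\<lambda>x. Lp_simple_integral I (s k) x - (LINT t|lebesgue_on I. F t x))
        \<le> (\<integral>\<^sup>+t. Lp_norm 1 (\<lambda>x. f t x - s k t x) \<partial>lebesgue_on I)"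
      using simple_integral_error_le[OF I F int fF s] by (simp add: Lp_norm_1 abs_minus_commute)
  qed simp
  ultimately show ?thesis
    unfolding has_Lp_bochner_integral_def using s int0 by blast
qed

section \<open>Weak convergence and convolution\<close>

text \<open>Measurability in the sense of \<open>measurable_on\<close> gives continuous functions
  converging to h off a negligible set, but without any bounds. A cutoff in space and clipping to
  [0,B] make them dominated, and keep the pointwise bounds that the convolution estimates
  use.\<close>

lemma exists_continuous_L1_approximation:
  fixes h :: "'a::euclidean_space \<Rightarrow> real"
  assumes h: "integrable lborel h" and bd: "\<And>x. 0 \<le> h x" "\<And>x. h x \<le> B" and "0 < e"
  obtains \<phi> where "continuous_on UNIV \<phi>" "\<And>x. 0 \<le> \<phi> x" "\<And>x. \<phi> x \<le> B" "integrable lborel \<phi>"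
    "(\<integral>\<^sup>+x. ennreal \<bar>h x - \<phi> x\<bar> \<partial>lborel) < ennreal e"
proof -
  have [measurable]: "h \<in> borel_measurable borel" using borel_measurable_integrable[OF h] by simp
  have B: "0 \<le> B" using bd[of 0] by linarith
  have "h measurable_on UNIV"
    by (intro lebesgue_measurable_imp_measurable_on_nnreal_UNIV) (auto intro: measurable_completion bd)
  then obtain N g where N: "negligible N" and g: "\<And>n. continuous_on UNIV (g n)"
    and gh: "\<And>x. x \<notin> N \<Longrightarrow> (\<lambda>n. g n x) \<longlonglongrightarrow> h x"
    by (auto simp: measurable_on_def)
  have gm [measurable]: "g n \<in> borel_measurable borel" for n
    by (rule borel_measurable_continuous_onI[OF g])
  \<comment> \<open>A continuous cutoff, equal to 1 on the ball of radius m and to 0 outside radius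
    m + 1.\<close>
  define \<eta> :: "nat \<Rightarrow> 'a \<Rightarrow> real" where "\<eta> m x = max 0 (min 1 (real m + 1 - norm x))" for m x
  have \<eta>: "0 \<le> \<eta> m x" "\<eta> m x \<le> 1" for m x by (auto simp: \<eta>_def)
  have [measurable]: "\<eta> m \<in> borel_measurable borel" for m unfolding \<eta>_def[abs_def] by measurable
  have e: "ennreal (e/2) > 0" using \<open>0 < e\<close> by simp
  have hfin: "(\<integral>\<^sup>+x. ennreal (h x) \<partial>lborel) < \<infinity>"
    using h bd unfolding integrable_iff_bounded by simp
  have "(\<lambda>m. \<integral>\<^sup>+x. ennreal \<bar>h x - \<eta> m x * h x\<bar> \<partial>lborel) \<longlonglongrightarrow> (\<integral>\<^sup>+x. 0 \<partial>(lborel :: 'a measure))"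
  proof (rule nn_integral_dominated_convergence[where w="\<lambda>x. ennreal (h x)"])
    have "\<bar>h x - \<eta> m x * h x\<bar> \<le> h x" for m x
      using mult_right_mono[OF \<eta>(2)[of m x] bd(1)[of x]] mult_nonneg_nonneg[OF \<eta>(1)[of m x] bd(1)[of x]]
      by simp
    then show "AE x in lborel. ennreal \<bar>h x - \<eta> m x * h x\<bar> \<le> ennreal (h x)" for m
      by (intro AE_I2 ennreal_leI)
    show "AE x in lborel. (\<lambda>m. ennreal \<bar>h x - \<eta> m x * h x\<bar>) \<longlonglongrightarrow> 0"
    proof (intro AE_I2 tendsto_eventually)
      fix x :: 'a
      obtain n0 :: nat where "norm x < n0" using reals_Archimedean2 by blast
      then show "\<forall>\<^sub>F m in sequentially. ennreal \<bar>h x - \<eta> m x * h x\<bar> = 0"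
        unfolding eventually_sequentially by (intro exI[of _ n0]) (auto simp: \<eta>_def)
    qed
  qed (use hfin in auto)
  from order_tendstoD(2)[OF this, of "ennreal (e/2)"] e
  obtain m where m: "(\<integral>\<^sup>+x. ennreal \<bar>h x - \<eta> m x * h x\<bar> \<partial>lborel) < ennreal (e/2)"
    by (auto simp: eventually_sequentially)
  \<comment> \<open>Clipping to [0,B] leaves the pointwise limit unchanged because h takes its
    values there.\<close>
  define \<phi> where "\<phi> n x = \<eta> m x * max 0 (min B (g n x))" for n x
  have \<phi>m [measurable]: "\<phi> n \<in> borel_measurable borel" for n unfolding \<phi>_def[abs_def] by measurable
  have \<phi>_le: "0 \<le> \<phi> n x" "\<phi> n x \<le> B * indicator (ball 0 (real m + 1)) x" "\<phi> n x \<le> B" for n x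
  proof -
    show "0 \<le> \<phi> n x" using \<eta>(1) by (simp add: \<phi>_def)
    have "\<phi> n x \<le> 1 * B"
      unfolding \<phi>_def using \<eta>[of m x] B by (intro mult_mono) auto
    then show "\<phi> n x \<le> B" by simp
    then show "\<phi> n x \<le> B * indicator (ball 0 (real m + 1)) x"
      by (auto simp: indicator_def \<phi>_def \<eta>_def)
  qed
  have ball: "emeasure lborel (ball (0::'a) (real m + 1)) < \<infinity>"
    using emeasure_bounded_finite[OF bounded_ball] by simp
  have ind: "integrable lborel (\<lambda>x. B * indicator (ball (0::'a) (real m + 1)) x)"
    using ball by (intro integrable_mult_right integrable_real_indicator) auto
  have \<phi>_int: "integrable lborel (\<phi> n)" for n
    by (rule Bochner_Integration.integrable_bound[OF ind]) (use \<phi>_le[of n] B in auto)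
  have "(\<lambda>n. \<integral>\<^sup>+x. ennreal \<bar>\<eta> m x * h x - \<phi> n x\<bar> \<partial>lborel) \<longlonglongrightarrow> (\<integral>\<^sup>+x. 0 \<partial>(lborel :: 'a measure))"
  proof (rule nn_integral_dominated_convergence[where w="\<lambda>x. ennreal (B * indicator (ball 0 (real m + 1)) x)"])
    have "\<eta> m x * h x \<le> B * indicator (ball 0 (real m + 1)) x" for x
    proof -
      have "\<eta> m x * h x \<le> 1 * B" using \<eta>[of m x] bd[of x] B by (intro mult_mono) auto
      then show ?thesis by (auto simp: indicator_def \<eta>_def)
    qed
    moreover have "0 \<le> \<eta> m x * h x" for x using \<eta>(1)[of m x] bd(1)[of x] by simp
    ultimately have "\<bar>\<eta> m x * h x - \<phi> n x\<bar> \<le> B * indicator (ball 0 (real m + 1)) x" for n x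
      using \<phi>_le(1,2)[of n x] by (smt (verit))
    then show "AE x in lborel. ennreal \<bar>\<eta> m x * h x - \<phi> n x\<bar> \<le> ennreal (B * indicator (ball 0 (real m + 1)) x)" for n
      by (intro AE_I2 ennreal_leI)
    have "AE x in lebesgue. x \<notin> N"
      using N by (auto simp: negligible_iff_null_sets intro: AE_not_in)
    then have "AE x in lborel. x \<notin> N" by (simp add: AE_completion_iff)
    then show "AE x in lborel. (\<lambda>n. ennreal \<bar>\<eta> m x * h x - \<phi> n x\<bar>) \<longlonglongrightarrow> 0"
    proof eventually_elim
      case (elim x)
      have "(\<lambda>n. \<bar>\<eta> m x * h x - \<phi> n x\<bar>) \<longlonglongrightarrow> \<bar>\<eta> m x * h x - \<eta> m x * max 0 (min B (h x))\<bar>"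
        unfolding \<phi>_def by (intro tendsto_intros gh elim)
      also have "max 0 (min B (h x)) = h x" using bd[of x] by auto
      finally show ?case by (simp add: tendsto_ennreal_iff flip: ennreal_0)
    qed
    show "(\<integral>\<^sup>+x. ennreal (B * indicator (ball (0::'a) (real m + 1)) x) \<partial>lborel) < \<infinity>"
      using ind B unfolding integrable_iff_bounded by (simp add: abs_mult)
    show "(\<lambda>x. ennreal (B * indicator (ball (0::'a) (real m + 1)) x)) \<in> borel_measurable lborel"
      by (rule measurable_compose[OF borel_measurable_integrable[OF ind] measurable_ennreal])
  qed auto
  from order_tendstoD(2)[OF this, of "ennreal (e/2)"] e
  obtain n where n: "(\<integral>\<^sup>+x. ennreal \<bar>\<eta> m x * h x - \<phi> n x\<bar> \<partial>lborel) < ennreal (e/2)"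
    by (auto simp: eventually_sequentially)
  have "(\<integral>\<^sup>+x. ennreal \<bar>h x - \<phi> n x\<bar> \<partial>lborel)
    \<le> (\<integral>\<^sup>+x. ennreal \<bar>h x - \<eta> m x * h x\<bar> \<partial>lborel) + (\<integral>\<^sup>+x. ennreal \<bar>\<eta> m x * h x - \<phi> n x\<bar> \<partial>lborel)"
    by (rule nn_integral_abs_diff_triangle) measurable
  also have "\<dots> < ennreal (e/2) + ennreal (e/2)" by (rule add_strict_mono[OF m n])
  also have "\<dots> = ennreal e" using \<open>e > 0\<close> by (simp flip: ennreal_plus)
  finally have lt: "(\<integral>\<^sup>+x. ennreal \<bar>h x - \<phi> n x\<bar> \<partial>lborel) < ennreal e" .
  have "continuous_on UNIV (\<phi> n)"
    unfolding \<phi>_def[abs_def] \<eta>_def[abs_def] by (intro continuous_intros g)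
  from that[OF this \<phi>_le(1) \<phi>_le(3) \<phi>_int lt] show ?thesis .
qed

lemma measure_conv_diff_L1_le:
  fixes \<mu> :: "'a::euclidean_space measure"
  assumes \<mu>: "finite_measure \<mu>" and [measurable_cong]: "sets \<mu> = sets borel"
    and [measurable]: "f \<in> borel_measurable borel" "g \<in> borel_measurable borel"
    and f: "\<And>x. 0 \<le> f x" "\<And>x. f x \<le> B" and g: "\<And>x. 0 \<le> g x" "\<And>x. g x \<le> B"
  shows "(\<integral>\<^sup>+x. ennreal \<bar>measure_conv \<mu> f x - measure_conv \<mu> g x\<bar> \<partial>lborel) \<le>
    emeasure \<mu> UNIV * (\<integral>\<^sup>+x. ennreal \<bar>f x - g x\<bar> \<partial>lborel)"
proof -
  have "(\<integral>\<^sup>+x. ennreal \<bar>measure_conv \<mu> f x - measure_conv \<mu> g x\<bar> \<partial>lborel)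
    \<le> (\<integral>\<^sup>+x. (\<integral>\<^sup>+y. ennreal \<bar>f (x - y) - g (x - y)\<bar> \<partial>\<mu>) \<partial>lborel)"
    by (intro nn_integral_mono measure_conv_diff_le integrable_measure_conv_bounded[OF assms(1-3) f]
        integrable_measure_conv_bounded[OF assms(1,2,4) g])
  also have "\<dots> = emeasure \<mu> UNIV * (\<integral>\<^sup>+x. ennreal \<bar>f x - g x\<bar> \<partial>lborel)"
    by (rule nn_integral_convolution[OF \<mu> assms(2), where f="\<lambda>x. ennreal \<bar>f x - g x\<bar>"]) measurable
  finally show ?thesis .
qed

lemma emeasure_prob_UNIV:
  assumes "prob_space \<mu>" "sets \<mu> = sets borel"
  shows "emeasure \<mu> UNIV = 1"
  using prob_space.emeasure_space_1[OF assms(1)] sets_eq_imp_space_eq[OF assms(2)] by simp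

lemma nn_integral_measure_conv_prob:
  fixes \<mu> :: "'a::euclidean_space measure"
  assumes \<mu>: "prob_space \<mu>" "sets \<mu> = sets borel"
    and [measurable]: "f \<in> borel_measurable borel" and f: "\<And>x. 0 \<le> f x" "\<And>x. f x \<le> B"
  shows "(\<integral>\<^sup>+x. ennreal (measure_conv \<mu> f x) \<partial>lborel) = (\<integral>\<^sup>+x. ennreal (f x) \<partial>lborel)"
proof -
  interpret prob_space \<mu> by fact
  show ?thesis
    unfolding ennreal_measure_conv_bounded[OF finite_measure_axioms \<mu>(2) assms(3) f]
    by (subst nn_integral_convolution[OF finite_measure_axioms \<mu>(2)])
       (auto simp: emeasure_prob_UNIV[OF \<mu>])
qed

text \<open>For continuous \<open>h\<close> the convolutions converge pointwise and keep their mass, so Scheffe's lemma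
  applies; the general case follows by density.\<close>

lemma measure_conv_L1_tendsto:
  fixes \<mu> :: "nat \<Rightarrow> 'a::euclidean_space measure"
  assumes \<mu>: "\<And>n. prob_space (\<mu> n)" "\<And>n. sets (\<mu> n) = sets borel"
    and \<nu>: "prob_space \<nu>" "sets \<nu> = sets borel"
    and weak: "\<And>f::'a \<Rightarrow> real. continuous_on UNIV f \<Longrightarrow> bounded (range f) \<Longrightarrow>
      (\<lambda>n. LINT x|\<mu> n. f x) \<longlonglongrightarrow> (LINT x|\<nu>. f x)"
    and h: "integrable lborel h" "\<And>x. 0 \<le> h x" "\<And>x. h x \<le> B"
  shows "(\<lambda>n. \<integral>\<^sup>+x. ennreal \<bar>measure_conv (\<mu> n) h x - measure_conv \<nu> h x\<bar> \<partial>lborel) \<longlonglongrightarrow> 0"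
proof -
  have fin: "finite_measure (\<mu> n)" "finite_measure \<nu>" for n
    using \<mu>(1) \<nu>(1) by (auto simp: prob_space_def)
  have hm [measurable]: "h \<in> borel_measurable borel" using borel_measurable_integrable[OF h(1)] by simp
  note [measurable] = borel_measurable_measure_conv[OF fin(1) \<mu>(2)] borel_measurable_measure_conv[OF fin(2) \<nu>(2)]
  let ?d = "\<lambda>f n. \<integral>\<^sup>+x. ennreal \<bar>measure_conv (\<mu> n) f x - measure_conv \<nu> f x\<bar> \<partial>lborel"
  have continuous_case: "?d \<phi> \<longlonglongrightarrow> 0"
    if \<phi>: "continuous_on UNIV \<phi>" "\<And>x. 0 \<le> \<phi> x" "\<And>x. \<phi> x \<le> B" "integrable lborel \<phi>" for \<phi> :: "'a \<Rightarrow> real"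
  proof -
    have \<phi>m [measurable]: "\<phi> \<in> borel_measurable borel" by (rule borel_measurable_continuous_onI[OF \<phi>(1)])
    note nonneg = measure_conv_nonneg[OF fin(1) \<mu>(2) \<phi>m \<phi>(2,3)] measure_conv_nonneg[OF fin(2) \<nu>(2) \<phi>m \<phi>(2,3)]
    note mass = nn_integral_measure_conv_prob[OF \<mu> \<phi>m \<phi>(2,3)] nn_integral_measure_conv_prob[OF \<nu> \<phi>m \<phi>(2,3)]
    have "(\<lambda>n. \<integral>\<^sup>+x. norm (measure_conv (\<mu> n) \<phi> x - measure_conv \<nu> \<phi> x) \<partial>lborel) \<longlonglongrightarrow> 0"
    proof (rule Scheffe_lemma2)
      show "integrable lborel (measure_conv \<nu> \<phi>)"
        using \<phi>(2,4) mass(2) nonneg(2) unfolding integrable_iff_bounded by simp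
      show "AE x in lborel. (\<lambda>n. measure_conv (\<mu> n) \<phi> x) \<longlonglongrightarrow> measure_conv \<nu> \<phi> x"
      proof (rule AE_I2)
        fix x
        show "(\<lambda>n. measure_conv (\<mu> n) \<phi> x) \<longlonglongrightarrow> measure_conv \<nu> \<phi> x"
          unfolding measure_conv_def
        proof (rule weak)
          show "continuous_on UNIV (\<lambda>y. \<phi> (x - y))"
            by (rule continuous_on_compose2[OF \<phi>(1)]) (auto intro!: continuous_intros)
          show "bounded (range (\<lambda>y. \<phi> (x - y)))"
            using \<phi>(2,3) by (auto simp: bounded_iff intro!: exI[of _ B])
        qed
      qed
    qed (use nonneg mass in auto)
    then show ?thesis by simp
  qed
  show ?thesis
  proof (rule order_tendstoI)
    fix \<epsilon> :: ennreal assume "0 < \<epsilon>"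
    then obtain \<delta> where \<delta>: "0 < \<delta>" "\<delta> < \<epsilon>" using dense by blast
    then have "\<delta> < \<top>" using order_less_le_trans[OF _ top_greatest] by blast
    then obtain e where e: "0 < e" "ennreal e < \<epsilon>"
      using \<delta> that[of "enn2real \<delta>"] by (simp add: enn2real_positive_iff)
    \<comment> \<open>One third each for replacing h by \<phi> under \<open>\<mu> n\<close>, for the
      continuous case, and for returning to h under \<nu>. The first and last errors are uniform in
      n because all masses are 1.\<close>
    have "0 < e / 3" using e by simp
    from exists_continuous_L1_approximation[OF h this]
    obtain \<phi> where \<phi>: "continuous_on UNIV \<phi>" "\<And>x. 0 \<le> \<phi> x" "\<And>x. \<phi> x \<le> B" "integrable lborel \<phi>"
      and close: "(\<integral>\<^sup>+x. ennreal \<bar>h x - \<phi> x\<bar> \<partial>lborel) < ennreal (e/3)" by blast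
    have \<phi>m [measurable]: "\<phi> \<in> borel_measurable borel" by (rule borel_measurable_continuous_onI[OF \<phi>(1)])
    have "\<forall>\<^sub>F n in sequentially. ?d \<phi> n < ennreal (e/3)"
      using e by (intro order_tendstoD(2)[OF continuous_case[OF \<phi>]]) auto
    then show "\<forall>\<^sub>F n in sequentially. ?d h n < \<epsilon>"
    proof eventually_elim
      case (elim n)
      have "?d h n \<le> (\<integral>\<^sup>+x. ennreal \<bar>measure_conv (\<mu> n) h x - measure_conv (\<mu> n) \<phi> x\<bar> \<partial>lborel)
        + (\<integral>\<^sup>+x. ennreal \<bar>measure_conv (\<mu> n) \<phi> x - measure_conv \<nu> h x\<bar> \<partial>lborel)"
        by (rule nn_integral_abs_diff_triangle) measurable
      also have "\<dots> \<le> (\<integral>\<^sup>+x. ennreal \<bar>measure_conv (\<mu> n) h x - measure_conv (\<mu> n) \<phi> x\<bar> \<partial>lborel)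
        + (?d \<phi> n + (\<integral>\<^sup>+x. ennreal \<bar>measure_conv \<nu> \<phi> x - measure_conv \<nu> h x\<bar> \<partial>lborel))"
        by (intro add_left_mono nn_integral_abs_diff_triangle) measurable
      also have "\<dots> \<le> (\<integral>\<^sup>+x. ennreal \<bar>h x - \<phi> x\<bar> \<partial>lborel) + (?d \<phi> n + (\<integral>\<^sup>+x. ennreal \<bar>h x - \<phi> x\<bar> \<partial>lborel))"
        using measure_conv_diff_L1_le[OF fin(1) \<mu>(2) hm \<phi>m h(2,3) \<phi>(2,3), of n]
          measure_conv_diff_L1_le[OF fin(2) \<nu>(2) \<phi>m hm \<phi>(2,3) h(2,3)]
        by (intro add_mono) (auto simp: emeasure_prob_UNIV[OF \<mu>] emeasure_prob_UNIV[OF \<nu>] abs_minus_commute)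
      also have "\<dots> \<le> ennreal (e/3) + (ennreal (e/3) + ennreal (e/3))"
        using elim close by (intro add_mono less_imp_le)
      also have "\<dots> = ennreal e" using e by (simp flip: ennreal_plus)
      finally show ?case using e(2) by (rule le_less_trans)
    qed
  qed simp
qed

section \<open>The Duhamel term\<close>

text \<open>The family is set to zero for r \<le> 0 and on the null set of bad times, which
  completeness of the time measure allows. At the remaining times \<psi> is a total mass and
  therefore nonnegative; its integrability up to 0 bounds the mass of the kernel on
  \<open>{..T}\<close>.\<close>

lemma exists_time_kernel:
  fixes Y :: "real \<Rightarrow> 'a::euclidean_space measure"
  assumes Y: "is_Y_family \<alpha>1 \<alpha>2 c \<psi> Y" and \<psi>: "is_laplace_original_of_Psi \<alpha>1 \<alpha>2 c \<psi>"
  obtains K where "time_kernel K"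
    "AE r in lebesgue. 0 < r \<longrightarrow> K r = Y r \<and> 0 \<le> \<psi> r \<and> emeasure (K r) UNIV = ennreal (\<psi> r)"
proof -
  have "AE t in lebesgue_on {0<..}.
        finite_measure (Y t) \<and> sets (Y t) = sets borel \<and> measure (Y t) UNIV = \<psi> t"
    and Ym: "\<And>A. A \<in> sets borel \<Longrightarrow> (\<lambda>t. measure (Y t) A) \<in> borel_measurable (lebesgue_on {0<..})"
    using Y by (auto simp: is_Y_family_def)
  then have "AE t in lebesgue. 0 < t \<longrightarrow>
        finite_measure (Y t) \<and> sets (Y t) = sets borel \<and> measure (Y t) UNIV = \<psi> t"
    by (subst (asm) AE_lebesgue_on_iff) auto
  then obtain N where N: "N \<in> null_sets lebesgue"
    and good: "\<And>t. 0 < t \<Longrightarrow> t \<notin> N \<Longrightarrow> finite_measure (Y t) \<and> sets (Y t) = sets borel \<and> measure (Y t) UNIV = \<psi> t"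
    by (auto simp: eventually_ae_filter subset_eq)
  define K where "K r = (if 0 < r \<and> r \<notin> N then Y r else null_measure borel)" for r
  have finK: "finite_measure (K r)" and setsK: "sets (K r) = sets borel" for r
    using good[of r] by (auto simp: K_def intro!: finite_measureI)
  have mass: "emeasure (K r) UNIV = ennreal (\<psi> r) \<and> 0 \<le> \<psi> r" if "0 < r" "r \<notin> N" for r
    using good[OF that] that finite_measure.emeasure_eq_measure[of "Y r" UNIV]
      measure_nonneg[of "Y r" UNIV]
    by (auto simp: K_def)
  have ae: "AE r in lebesgue. r \<notin> N" using N by (rule AE_not_in)
  have "time_kernel K"
  proof (rule time_kernel.intro)
    fix A :: "'a set" assume A: "A \<in> sets borel"
    have "(\<lambda>r. if r \<in> {0<..} then measure (Y r) A else 0) \<in> borel_measurable lebesgue"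
      using Ym[OF A] by (subst borel_measurable_if) auto
    moreover have "- N \<in> sets lebesgue"
      using N by (auto simp: Compl_in_sets_lebesgue null_sets_def)
    ultimately have "(\<lambda>r. (if r \<in> {0<..} then measure (Y r) A else 0) * indicator (- N) r) \<in> borel_measurable lebesgue"
      by (intro borel_measurable_times borel_measurable_indicator)
    then have "(\<lambda>r. ennreal ((if r \<in> {0<..} then measure (Y r) A else 0) * indicator (- N) r)) \<in> borel_measurable lebesgue"
      by (rule measurable_compose[OF _ measurable_ennreal])
    also have "(\<lambda>r. ennreal ((if r \<in> {0<..} then measure (Y r) A else 0) * indicator (- N) r)) = (\<lambda>r. emeasure (K r) A)"
    proof
      fix r
      show "ennreal ((if r \<in> {0<..} then measure (Y r) A else 0) * indicator (- N) r) = emeasure (K r) A"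
        using good[of r] finite_measure.emeasure_eq_measure[of "Y r" A]
        by (auto simp: K_def indicator_def)
    qed
    finally show "(\<lambda>r. emeasure (K r) A) \<in> borel_measurable lebesgue" .
  next
    fix T :: real
    show "(\<integral>\<^sup>+r\<in>{..T}. emeasure (K r) UNIV \<partial>lebesgue) < \<infinity>"
    proof (cases "0 < T")
      case True
      have "set_integrable lborel {0<..T} \<psi>"
        using \<psi> True by (simp add: is_laplace_original_of_Psi_def)
      then have fin: "(\<integral>\<^sup>+r. ennreal \<bar>indicator {0<..T} r * \<psi> r\<bar> \<partial>lborel) < \<infinity>"
        by (simp add: set_integrable_def integrable_iff_bounded)
      have "(\<integral>\<^sup>+r\<in>{..T}. emeasure (K r) UNIV \<partial>lebesgue)
        \<le> (\<integral>\<^sup>+r. ennreal \<bar>indicator {0<..T} r * \<psi> r\<bar> \<partial>lebesgue)"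
      proof (rule nn_integral_mono)
        fix r
        show "emeasure (K r) UNIV * indicator {..T} r \<le> ennreal \<bar>indicator {0<..T} r * \<psi> r\<bar>"
          using mass[of r] by (cases "0 < r \<and> r \<notin> N") (auto simp: indicator_def K_def)
      qed
      also have "\<dots> < \<infinity>" using fin by (simp add: nn_integral_completion)
      finally show ?thesis .
    next
      case False
      then have "(\<integral>\<^sup>+r\<in>{..T}. emeasure (K r) UNIV \<partial>lebesgue) = (\<integral>\<^sup>+(r::real). 0 \<partial>lebesgue)"
        by (intro nn_integral_cong) (auto simp: K_def indicator_def)
      then show ?thesis by simp
    qed
  next
    show "emeasure (K r) UNIV = 0" if "r \<le> 0" for r
      using that by (simp add: K_def)
  qed (rule finK setsK)+
  moreover have "AE r in lebesgue. 0 < r \<longrightarrow> K r = Y r \<and> 0 \<le> \<psi> r \<and> emeasure (K r) UNIV = ennreal (\<psi> r)"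
    using ae by eventually_elim (use mass in \<open>auto simp: K_def\<close>)
  ultimately show ?thesis by (rule that)
qed

text \<open>A jointly measurable representative is clipped to [0,C] and cut off outside (0,T). For
  almost every time in (0,T) this changes it on a null set only, yet the bounds now hold at every
  point, as convolution with singular measures demands.\<close>

lemma bounded_joint_representative:
  fixes u :: "real \<Rightarrow> 'a::euclidean_space \<Rightarrow> real"
  assumes meas: "Lp_strongly_measurable \<infinity> {0<..<T} u"
    and bd: "AE t in lebesgue_on {0<..<T}. Lp_norm \<infinity> (u t) \<le> ennreal C" and C: "0 \<le> C"
    and nn: "AE t in lebesgue_on {0<..<T}. AE x in lborel. 0 \<le> u t x"
  obtains U where "(\<lambda>(s, x). U s x) \<in> borel_measurable (lebesgue \<Otimes>\<^sub>M borel)"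
    "\<And>s x. 0 \<le> U s x" "\<And>s x. U s x \<le> C" "\<And>s x. s \<notin> {0<..<T} \<Longrightarrow> U s x = 0"
    "AE s in lebesgue. s \<in> {0<..<T} \<longrightarrow> (AE x in lborel. u s x = U s x)"
proof -
  have I: "{0<..<T} \<in> sets lebesgue" by simp
  obtain V where V [measurable]: "(\<lambda>(s, x). V s x) \<in> borel_measurable (lebesgue \<Otimes>\<^sub>M borel)"
    and uV: "AE t in lebesgue_on {0<..<T}. AE x in lborel. u t x = V t x"
    using Lp_strongly_measurable_joint_representative[OF I meas] by blast
  define U where "U s x = indicator {0<..<T} s * max 0 (min C (V s x))" for s x
  have ind: "(\<lambda>z. indicator {0<..<T} (fst z) :: real) \<in> borel_measurable (lebesgue \<Otimes>\<^sub>M (borel :: 'a measure))"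
    by (rule measurable_compose[OF measurable_fst borel_measurable_indicator[OF I]])
  have "(\<lambda>z. indicator {0<..<T} (fst z) * max 0 (min C (V (fst z) (snd z)))) \<in> borel_measurable (lebesgue \<Otimes>\<^sub>M borel)"
    using V by (intro borel_measurable_times[OF ind] borel_measurable_max borel_measurable_min borel_measurable_const)
      (simp add: case_prod_beta')
  then have "(\<lambda>(s, x). U s x) \<in> borel_measurable (lebesgue \<Otimes>\<^sub>M borel)"
    by (simp add: U_def case_prod_beta')
  moreover have "AE t in lebesgue_on {0<..<T}. AE x in lborel. u t x = U t x"
    using uV bd nn AE_space[of "lebesgue_on {0<..<T}"]
  proof eventually_elim
    case (elim t)
    from elim(1,3) AE_le_Lp_norm_infinity[of "u t"] show ?case
    proof eventually_elim
      case (elim x)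
      have "ennreal \<bar>u t x\<bar> \<le> ennreal C"
        using elim(3) \<open>Lp_norm \<infinity> (u t) \<le> ennreal C\<close> by (rule order_trans)
      then have "\<bar>u t x\<bar> \<le> C" using C by simp
      then show ?case
        using elim \<open>t \<in> space (lebesgue_on {0<..<T})\<close> by (auto simp: U_def indicator_def)
    qed
  qed
  then have "AE s in lebesgue. s \<in> {0<..<T} \<longrightarrow> (AE x in lborel. u s x = U s x)"
    by (subst (asm) AE_lebesgue_on_iff) auto
  ultimately show ?thesis
    using C by (intro that[of U]) (auto simp: U_def indicator_def)
qed

section \<open>The Duhamel integral in the source variable s = t - r\<close>

context time_kernel_source
begin

lemma reflected_conv_measurable:
  "(\<lambda>(s, x). measure_conv (K (t - s)) (g s) x) \<in> borel_measurable (lebesgue \<Otimes>\<^sub>M borel)"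
proof -
  have "(\<lambda>z. (t - fst z, snd z)) \<in> lebesgue \<Otimes>\<^sub>M borel \<rightarrow>\<^sub>M lebesgue \<Otimes>\<^sub>M borel"
    by measurable
  from measurable_compose[OF this source_conv_measurable[of t]]
  show ?thesis by (simp add: case_prod_beta')
qed

lemma reflected_conv_integrable: "integrable lebesgue (\<lambda>s. measure_conv (K (t - s)) (g s) x)"
  using lebesgue_integrable_real_affine_iff[of "-1" "\<lambda>r. measure_conv (K r) (g (t - r)) x" t]
    source_conv_integrable[of t x] by simp

lemma reflected_conv_eq_0: "s \<notin> {0<..<t} \<Longrightarrow> measure_conv (K (t - s)) (g s) x = 0"
  using source_conv_eq_0[of "t - s" t x] by auto

lemma indicator_reflected_conv:
  "indicator {0<..<t} s * measure_conv (K (t - s)) (g s) x = measure_conv (K (t - s)) (g s) x"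
  using reflected_conv_eq_0[of s t x] by (cases "s \<in> {0<..<t}") auto

lemma time_conv_eq_reflected: "time_conv g t x = (LINT s|lebesgue. measure_conv (K (t - s)) (g s) x)"
  using lebesgue_integral_real_affine[of "-1" "\<lambda>r. measure_conv (K r) (g (t - r)) x" t]
  by (simp add: time_conv_def)

lemma time_conv_eq_set_integral:
  "time_conv g t x = (LINT s|lebesgue_on {0<..<t}. measure_conv (K (t - s)) (g s) x)"
proof -
  have "(LINT s|lebesgue_on {0<..<t}. measure_conv (K (t - s)) (g s) x) =
    (LINT s|lebesgue. indicator {0<..<t} s *\<^sub>R measure_conv (K (t - s)) (g s) x)"
    by (rule integral_restrict_space) simp
  also have "\<dots> = (LINT s|lebesgue. measure_conv (K (t - s)) (g s) x)"
    by (simp add: indicator_reflected_conv)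
  finally show ?thesis by (simp add: time_conv_eq_reflected)
qed

lemma nn_integral_reflected_conv:
  "(\<integral>\<^sup>+s. (\<integral>\<^sup>+x. ennreal (measure_conv (K (t - s)) (g s) x) \<partial>lborel) \<partial>lebesgue) =
   (\<integral>\<^sup>+x. ennreal (time_conv g t x) \<partial>lborel)"
proof -
  interpret L: sigma_finite_measure "lebesgue :: real measure" by (rule sigma_finite_lebesgue)
  interpret pair_sigma_finite "lebesgue :: real measure" "lborel :: 'a measure" ..
  have "(\<integral>\<^sup>+s. (\<integral>\<^sup>+x. ennreal (measure_conv (K (t - s)) (g s) x) \<partial>lborel) \<partial>lebesgue)
    = (\<integral>\<^sup>+x. (\<integral>\<^sup>+s. ennreal (measure_conv (K (t - s)) (g s) x) \<partial>lebesgue) \<partial>lborel)"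
    using reflected_conv_measurable[of t] by (intro Fubini'[symmetric]) (simp add: case_prod_beta')
  also have "\<dots> = (\<integral>\<^sup>+x. ennreal (time_conv g t x) \<partial>lborel)"
    unfolding time_conv_eq_reflected
    by (intro nn_integral_cong nn_integral_eq_integral reflected_conv_integrable) (simp add: source_conv(3))
  finally show ?thesis .
qed

end

section \<open>The Duhamel term of a mild solution\<close>

locale mild_representation = time_kernel K for K :: "real \<Rightarrow> 'a::euclidean_space measure" +
  fixes p C T :: real and Y :: "real \<Rightarrow> 'a measure" and u U :: "real \<Rightarrow> 'a \<Rightarrow> real"
  assumes p: "1 < p"
    and U_measurable: "(\<lambda>(s, x). U s x) \<in> borel_measurable (lebesgue \<Otimes>\<^sub>M borel)"
    and U_nonneg: "0 \<le> U s x" and U_le: "U s x \<le> C"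
    and U_eq_0: "s \<notin> {0<..<T} \<Longrightarrow> U s x = 0"
    and u_borel: "s \<in> {0<..<T} \<Longrightarrow> u s \<in> borel_measurable borel"
    and u_eq_U: "AE s in lebesgue. s \<in> {0<..<T} \<longrightarrow> (AE x in lborel. u s x = U s x)"
    and K_eq_Y: "AE r in lebesgue. 0 < r \<longrightarrow> K r = Y r"
begin

sublocale time_kernel_source K "\<lambda>s x. U s x powr p" "C powr p"
proof
  show "(\<lambda>(s, x). U s x powr p) \<in> borel_measurable (lebesgue \<Otimes>\<^sub>M borel)"
    using U_measurable by (simp add: case_prod_beta')
qed (use p U_nonneg U_le U_eq_0 in \<open>auto intro!: powr_mono2\<close>)

abbreviation duhamel :: "real \<Rightarrow> 'a \<Rightarrow> real" where
  "duhamel \<equiv> time_conv (\<lambda>s x. U s x powr p)"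

text \<open>Two null sets of s are discarded: the times where \<open>u s\<close> and
  \<open>U s\<close> differ as classes, and the reflected times where K and Y differ. The positive
  part disappears because U is nonnegative.\<close>

lemma duhamel_integrand_eq:
  assumes t: "t \<le> T"
  shows "AE s in lebesgue_on {0<..<t}. P_op Y (t - s) (\<lambda>x. max 0 (u s x) powr p) \<in> borel_measurable borel \<and>
    (AE x in lborel. P_op Y (t - s) (\<lambda>x. max 0 (u s x) powr p) x = measure_conv (K (t - s)) (\<lambda>x. U s x powr p) x)"
proof (subst AE_lebesgue_on_iff, simp)
  show "AE s in lebesgue. s \<in> {0<..<t} \<longrightarrow> P_op Y (t - s) (\<lambda>x. max 0 (u s x) powr p) \<in> borel_measurable borel \<and>
    (AE x in lborel. P_op Y (t - s) (\<lambda>x. max 0 (u s x) powr p) x = measure_conv (K (t - s)) (\<lambda>x. U s x powr p) x)"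
    using u_eq_U AE_lebesgue_reflect[OF K_eq_Y, of t]
  proof eventually_elim
    case (elim s)
    show ?case
    proof
      assume "s \<in> {0<..<t}"
      with elim t have K: "K (t - s) = Y (t - s)" and uU: "AE x in lborel. u s x = U s x"
        and um [measurable]: "u s \<in> borel_measurable borel"
        by (auto intro: u_borel)
      have "AE x in lborel. max 0 (u s x) powr p = U s x powr p"
        using uU by eventually_elim (use U_nonneg[of s] in auto)
      then show "P_op Y (t - s) (\<lambda>x. max 0 (u s x) powr p) \<in> borel_measurable borel \<and>
        (AE x in lborel. P_op Y (t - s) (\<lambda>x. max 0 (u s x) powr p) x = measure_conv (K (t - s)) (\<lambda>x. U s x powr p) x)"
        unfolding P_op_def K[symmetric]
        by (intro conjI measure_conv_cong_AE[OF finite_kernel sets_kernel]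
            borel_measurable_measure_conv[OF finite_kernel sets_kernel]) measurable
    qed
  qed
qed

lemma duhamel_integrand_integrable:
  "integrable (lebesgue_on {0<..<t}) (\<lambda>s. measure_conv (K (t - s)) (\<lambda>x. U s x powr p) x)"
  using reflected_conv_integrable[of t x]
  by (subst integrable_restrict_space) (auto simp: indicator_reflected_conv)

lemma duhamel_unique:
  assumes t: "t \<le> T"
    and w: "has_Lp_bochner_integral 1 {0<..<t} (\<lambda>s. P_op Y (t - s) (\<lambda>x. max 0 (u s x) powr p)) w"
  shows "AE x in lborel. w x = duhamel t x"
  unfolding time_conv_eq_set_integral
proof (rule L1_bochner_integral_eq[OF _ _ _ _ w])
  show "AE s in lebesgue_on {0<..<t}. AE x in lborel.
    P_op Y (t - s) (\<lambda>x. max 0 (u s x) powr p) x = measure_conv (K (t - s)) (\<lambda>x. U s x powr p) x"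
    using duhamel_integrand_eq[OF t] by eventually_elim simp
qed (auto intro!: measurable_pair_restrict reflected_conv_measurable duhamel_integrand_integrable)

text \<open>Nonnegativity and Tonelli turn the finite mass of the Duhamel term into absolute
  integrability of the integrand. At the end point the finiteness comes from the uniform mass
  bound.\<close>

lemma duhamel_has_integral:
  assumes t: "t \<le> T" and fin: "(\<integral>\<^sup>+x. ennreal (duhamel t x) \<partial>lborel) < \<infinity>"
  shows "has_Lp_bochner_integral 1 {0<..<t} (\<lambda>s. P_op Y (t - s) (\<lambda>x. max 0 (u s x) powr p)) (duhamel t)"
proof -
  let ?F = "\<lambda>s. measure_conv (K (t - s)) (\<lambda>x. U s x powr p)"
  have "(\<integral>\<^sup>+s. (\<integral>\<^sup>+x. ennreal \<bar>?F s x\<bar> \<partial>lborel) \<partial>lebesgue_on {0<..<t})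
    = (\<integral>\<^sup>+s. (\<integral>\<^sup>+x. ennreal (?F s x) \<partial>lborel) * indicator {0<..<t} s \<partial>lebesgue)"
    by (subst nn_integral_restrict_space) (auto simp: source_conv(3))
  also have "\<dots> \<le> (\<integral>\<^sup>+s. (\<integral>\<^sup>+x. ennreal (?F s x) \<partial>lborel) \<partial>lebesgue)"
    by (intro nn_integral_mono) (auto simp: indicator_def)
  also have "\<dots> < \<infinity>" using fin by (simp add: nn_integral_reflected_conv)
  finally have fin': "(\<integral>\<^sup>+s. (\<integral>\<^sup>+x. ennreal \<bar>?F s x\<bar> \<partial>lborel) \<partial>lebesgue_on {0<..<t}) < \<infinity>" .
  have "has_Lp_bochner_integral 1 {0<..<t} (\<lambda>s. P_op Y (t - s) (\<lambda>x. max 0 (u s x) powr p))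
    (\<lambda>x. LINT s|lebesgue_on {0<..<t}. ?F s x)"
  proof (rule has_L1_bochner_integral_joint[OF _ _ fin'])
    show "AE s in lebesgue_on {0<..<t}. AE x in lborel.
      P_op Y (t - s) (\<lambda>x. max 0 (u s x) powr p) x = ?F s x"
      using duhamel_integrand_eq[OF t] by eventually_elim simp
    show "AE s in lebesgue_on {0<..<t}. P_op Y (t - s) (\<lambda>x. max 0 (u s x) powr p) \<in> borel_measurable borel"
      using duhamel_integrand_eq[OF t] by eventually_elim simp
  qed (auto intro!: measurable_pair_restrict reflected_conv_measurable duhamel_integrand_integrable)
  then show ?thesis
    by (simp add: time_conv_eq_set_integral[symmetric, abs_def])
qed

end

section \<open>Exhausting the time interval\<close>

lemma borel_measurable_lebesgue_AE_eq:
  fixes f g :: "'a::euclidean_space \<Rightarrow> 'b::topological_space"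
  assumes f: "f \<in> borel_measurable lebesgue" and eq: "AE t in lebesgue. f t = g t"
  shows "g \<in> borel_measurable lebesgue"
proof (rule measurableI)
  fix A :: "'b set" assume A: "A \<in> sets borel"
  show "g -` A \<inter> space lebesgue \<in> sets lebesgue"
  proof (rule completion.in_sets_AE)
    show "AE t in lebesgue. (t \<in> f -` A) = (t \<in> g -` A \<inter> space lebesgue)"
      using eq by eventually_elim auto
    show "f -` A \<in> sets lebesgue"
      using measurable_sets[OF f A] by simp
  qed auto
qed auto

lemma borel_measurable_lebesgue_on_AE_eq:
  fixes f g :: "real \<Rightarrow> ennreal"
  assumes I: "I \<in> sets lebesgue" and f: "f \<in> borel_measurable (lebesgue_on I)"
    and eq: "AE t in lebesgue_on I. f t = g t"
  shows "g \<in> borel_measurable (lebesgue_on I)"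
proof -
  have I': "I \<inter> space lebesgue \<in> sets lebesgue" using I by simp
  have f': "(\<lambda>t. f t * indicator I t) \<in> borel_measurable lebesgue"
    using f by (subst (asm) borel_measurable_restrict_space_iff_ennreal[OF I'])
  have eq': "AE t in lebesgue. f t * indicator I t = g t * indicator I t"
    using eq unfolding AE_lebesgue_on_iff[OF I] by eventually_elim (auto simp: indicator_def)
  from borel_measurable_lebesgue_AE_eq[OF f' eq']
  show ?thesis by (subst borel_measurable_restrict_space_iff_ennreal[OF I'])
qed

text \<open>Strong measurability makes the norm an almost-everywhere limit of norms of simple
  functions. The limsup is defined and measurable at every time, also where the sequence diverges.
  This gives the blow-up claim its content, because \<open>esssup\<close> is infinite by convention
  on non-measurable functions.\<close>

lemma Lp_norm_infinity_measurable:
  assumes I: "I \<in> sets lebesgue" and u: "Lp_strongly_measurable \<infinity> I u"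
    and ub: "\<And>t. t \<in> I \<Longrightarrow> u t \<in> borel_measurable borel"
  shows "(\<lambda>t. Lp_norm \<infinity> (u t)) \<in> borel_measurable (lebesgue_on I)"
proof -
  obtain s where s: "\<And>k::nat. Lp_simple \<infinity> I (s k)"
    and lim: "AE t in lebesgue_on I. (\<lambda>k. Lp_norm \<infinity> (\<lambda>x. u t x - s k t x)) \<longlonglongrightarrow> 0"
    using u by (auto simp: Lp_strongly_measurable_def)
  have sm: "(\<lambda>t. Lp_norm \<infinity> (s k t)) \<in> borel_measurable (lebesgue_on I)" for k
    using s[of k] unfolding Lp_simple_def
    by (intro borel_measurable_simple_function simple_function_compose1[where f="s k" and g="Lp_norm \<infinity>"]) auto
  show ?thesis
  proof (rule borel_measurable_lebesgue_on_AE_eq[OF I])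
    show "(\<lambda>t. limsup (\<lambda>k. Lp_norm \<infinity> (s k t))) \<in> borel_measurable (lebesgue_on I)"
      using sm by measurable
    show "AE t in lebesgue_on I. limsup (\<lambda>k. Lp_norm \<infinity> (s k t)) = Lp_norm \<infinity> (u t)"
      using lim AE_space[of "lebesgue_on I"]
    proof eventually_elim
      case (elim t)
      then have t: "t \<in> I" by simp
      have sb: "s k t \<in> borel_measurable borel" for k
        using s[of k] t by (auto simp: Lp_simple_def Lp_space_def)
      let ?d = "\<lambda>k. Lp_norm \<infinity> (\<lambda>x. u t x - s k t x)"
      have up: "Lp_norm \<infinity> (s k t) \<le> Lp_norm \<infinity> (u t) + ?d k" for k
        using Lp_norm_infinity_le_add[OF sb ub[OF t]] unfolding Lp_norm_infinity_minus_commute[of "u t"] .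
      have lo: "Lp_norm \<infinity> (u t) \<le> Lp_norm \<infinity> (s k t) + ?d k" for k
        by (rule Lp_norm_infinity_le_add[OF ub[OF t] sb])
      have "limsup (\<lambda>k. Lp_norm \<infinity> (s k t)) \<le> limsup (\<lambda>k. Lp_norm \<infinity> (u t) + ?d k)"
        by (intro Limsup_mono always_eventually allI up)
      also have "\<dots> = Lp_norm \<infinity> (u t) + 0"
        by (intro lim_imp_Limsup tendsto_add tendsto_const elim) simp
      finally have 1: "limsup (\<lambda>k. Lp_norm \<infinity> (s k t)) \<le> Lp_norm \<infinity> (u t)" by simp
      have "Lp_norm \<infinity> (u t) \<le> limsup (\<lambda>k. Lp_norm \<infinity> (s k t))"
      proof (rule ennreal_le_epsilon)
        fix e :: real assume "0 < e"
        then have "\<forall>\<^sub>F k in sequentially. ?d k < ennreal e"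
          by (intro order_tendstoD(2)[OF elim(1)]) auto
        then have "\<forall>\<^sub>F k in sequentially. Lp_norm \<infinity> (u t) \<le> ennreal e + Lp_norm \<infinity> (s k t)"
        proof eventually_elim
          case (elim k)
          then show ?case
            using order_trans[OF lo add_left_mono[OF less_imp_le[OF elim]]] by (simp add: add.commute)
        qed
        then have "limsup (\<lambda>k. Lp_norm \<infinity> (u t)) \<le> limsup (\<lambda>k. ennreal e + Lp_norm \<infinity> (s k t))"
          by (rule Limsup_mono)
        also have "\<dots> = ennreal e + limsup (\<lambda>k. Lp_norm \<infinity> (s k t))"
          by (rule Limsup_const_add) simp
        finally show "Lp_norm \<infinity> (u t) \<le> limsup (\<lambda>k. Lp_norm \<infinity> (s k t)) + ennreal e"
          by (simp add: Limsup_const add.commute)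
      qed
      with 1 show ?case by simp
    qed
  qed
qed

section \<open>Passage from all shorter intervals to (0,T)\<close>

lemma exhausting_times:
  fixes T :: real
  assumes "0 < T"
  obtains \<tau> :: "nat \<Rightarrow> real" where "incseq \<tau>" "\<And>j. 0 < \<tau> j" "\<And>j. \<tau> j < T"
    "\<And>t. t < T \<Longrightarrow> \<exists>j. t < \<tau> j"
proof -
  \<comment> \<open>The shift by 2 makes the first time T/2, hence positive.\<close>
  define \<tau> where "\<tau> j = T - T / (real j + 2)" for j :: nat
  have "T / (real j + 2) > 0" "T / (real j + 2) < T" for j
    using assms by (auto simp: field_simps intro!: add_pos_nonneg)
  moreover have "incseq \<tau>"
    using assms by (auto simp: incseq_def \<tau>_def intro!: divide_left_mono)
  moreover have "\<exists>j. t < \<tau> j" if "t < T" for t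
  proof -
    obtain j :: nat where "T / (T - t) < real j" using reals_Archimedean2 by blast
    then have "T < (T - t) * (real j + 2)"
      using that by (simp add: field_simps)
    then have "T / (real j + 2) < T - t" by (simp add: field_simps)
    then show ?thesis unfolding \<tau>_def by (intro exI[of _ j]) linarith
  qed
  ultimately show ?thesis by (intro that[of \<tau>]) (auto simp: \<tau>_def)
qed

lemma AE_lebesgue_on_exhaust:
  fixes T :: real
  assumes "0 < T" and P: "\<And>T'. 0 < T' \<Longrightarrow> T' < T \<Longrightarrow> AE t in lebesgue_on {0<..<T'}. P t"
  shows "AE t in lebesgue_on {0<..<T}. P t"
proof -
  obtain \<tau> where \<tau>: "\<And>j. 0 < \<tau> j" "\<And>j. \<tau> j < T" "\<And>t. t < T \<Longrightarrow> \<exists>j::nat. t < \<tau> j"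
    using exhausting_times[OF \<open>0 < T\<close>] by metis
  have "AE t in lebesgue. \<forall>j. t \<in> {0<..<\<tau> j} \<longrightarrow> P t"
    using P[OF \<tau>(1,2)] by (subst AE_all_countable) (auto simp: AE_lebesgue_on_iff)
  then have "AE t in lebesgue. t \<in> {0<..<T} \<longrightarrow> P t"
    by eventually_elim (use \<tau>(3) in auto)
  then show ?thesis by (subst AE_lebesgue_on_iff) auto
qed

lemma Lp_simple_UNIV_restrict:
  assumes s: "Lp_simple q UNIV s" and I: "I \<in> sets lebesgue"
  shows "Lp_simple q I s"
  unfolding Lp_simple_def simple_function_def
proof (intro conjI ballI)
  have "finite (range s)" "range s \<subseteq> Lp_space q"
    using s by (auto simp: Lp_simple_def simple_function_def)
  then show "finite (s ` space (lebesgue_on I))" "s ` I \<subseteq> Lp_space q"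
    by (auto intro: finite_subset[of "s ` I" "range s"])
  fix z
  have "s -` {z} \<in> sets lebesgue"
    using simple_functionD(2)[of "lebesgue_on UNIV" s "{z}"] s by (simp add: Lp_simple_def lebesgue_on_UNIV_eq)
  then show "s -` {z} \<inter> space (lebesgue_on I) \<in> sets (lebesgue_on I)"
    using I by (auto simp: sets_restrict_space_iff)
qed

lemma Lp_simple_UNIV_If:
  assumes "Lp_simple q UNIV s" "Lp_simple q UNIV s'"
  shows "Lp_simple q UNIV (\<lambda>t. if t < a then s t else s' t)"
  unfolding Lp_simple_def
proof
  have "{t::real. t < a} \<in> sets lebesgue" by (rule sets_completionI_sets) simp
  then show "simple_function (lebesgue_on UNIV) (\<lambda>t. if t < a then s t else s' t)"
    using assms unfolding Lp_simple_def lebesgue_on_UNIV_eq by (intro simple_function_If) auto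
qed (use assms in \<open>auto simp: Lp_simple_def\<close>)

text \<open>Each shorter interval comes with its own approximating sequence, whereas measurability
  on (0,T) asks for a single one; the given sequences have to be glued.\<close>

lemma Lp_strongly_measurable_exhaust:
  fixes u :: "real \<Rightarrow> 'a::euclidean_space \<Rightarrow> real"
  assumes T: "0 < T" and u: "\<And>T'. 0 < T' \<Longrightarrow> T' < T \<Longrightarrow> Lp_strongly_measurable \<infinity> {0<..<T'} u"
  shows "Lp_strongly_measurable \<infinity> {0<..<T} u"
proof -
  obtain \<tau> where inc: "incseq \<tau>" and \<tau>: "\<And>j. 0 < \<tau> j" "\<And>j. \<tau> j < T" "\<And>t. t < T \<Longrightarrow> \<exists>j::nat. t < \<tau> j"
    using exhausting_times[OF T] by metis
  have "\<forall>j. \<exists>s. (\<forall>k::nat. Lp_simple \<infinity> {0<..<\<tau> j} (s k)) \<and>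
       (AE t in lebesgue_on {0<..<\<tau> j}. (\<lambda>k. Lp_norm \<infinity> (\<lambda>x. u t x - s k t x)) \<longlonglongrightarrow> 0)"
    using u[OF \<tau>(1,2)] by (simp add: Lp_strongly_measurable_def)
  then obtain s where s: "\<And>j k::nat. Lp_simple \<infinity> {0<..<\<tau> j} (s j k)"
    and lim: "\<And>j. AE t in lebesgue_on {0<..<\<tau> j}. (\<lambda>k. Lp_norm \<infinity> (\<lambda>x. u t x - s j k t x)) \<longlonglongrightarrow> 0"
    by (auto dest!: choice)
  define e where "e j k t = (if t \<in> {0<..<\<tau> j} then s j k t else (\<lambda>x. 0))" for j k t
  \<comment> \<open>\<open>R j\<close> follows the approximants of the first interval \<open>(0, \<tau> i)\<close>, \<open>i \<le> j\<close>, that contains the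
    given time, so the diagonal sequence \<open>R k k\<close> is eventually one of the original sequences.\<close>
  define R where "R = rec_nat (e 0) (\<lambda>j r k t. if t < \<tau> j then r k t else e (Suc j) k t)"
  have R0: "R 0 = e 0" and RS: "R (Suc j) k t = (if t < \<tau> j then R j k t else e (Suc j) k t)" for j k t
    by (auto simp: R_def)
  have e: "Lp_simple \<infinity> UNIV (e j k)" for j k
    unfolding e_def[abs_def] by (intro Lp_simple_extend s zero_in_Lp_space_infinity) simp
  have R: "Lp_simple \<infinity> UNIV (R j k)" for j k
  proof (induction j)
    case (Suc j)
    have "R (Suc j) k = (\<lambda>t. if t < \<tau> j then R j k t else e (Suc j) k t)" by (simp add: RS fun_eq_iff)
    then show ?case using Lp_simple_UNIV_If[OF Suc e] by simp
  next
    case 0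
    show ?case unfolding R0 by (rule e)
  qed
  have R_stable_add: "R (j + d) k t = R j k t" if "t < \<tau> j" for j d k t
  proof (induction d)
    case (Suc d)
    have "t < \<tau> (j + d)" using that incseqD[OF inc, of j "j + d"] by simp
    then have "R (Suc (j + d)) k t = R (j + d) k t" unfolding RS by (rule if_P)
    with Suc show ?case by simp
  qed simp
  have R_stable: "R i k t = R j k t" if "t < \<tau> j" "j \<le> i" for i j k t
    using R_stable_add[OF that(1), of "i - j" k] that(2) by simp
  have R_lim: "AE t in lebesgue. t \<in> {0<..<\<tau> j} \<longrightarrow> (\<lambda>k. Lp_norm \<infinity> (\<lambda>x. u t x - R j k t x)) \<longlonglongrightarrow> 0" for j
  proof (induction j)
    case 0
    have "AE t in lebesgue. t \<in> {0<..<\<tau> 0} \<longrightarrow> (\<lambda>k. Lp_norm \<infinity> (\<lambda>x. u t x - s 0 k t x)) \<longlonglongrightarrow> 0"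
      using lim[of 0] by (subst (asm) AE_lebesgue_on_iff) auto
    then show ?case by eventually_elim (auto simp: R0 e_def)
  next
    case (Suc j)
    have "AE t in lebesgue. t \<in> {0<..<\<tau> (Suc j)} \<longrightarrow> (\<lambda>k. Lp_norm \<infinity> (\<lambda>x. u t x - s (Suc j) k t x)) \<longlonglongrightarrow> 0"
      using lim[of "Suc j"] by (subst (asm) AE_lebesgue_on_iff) auto
    with Suc show ?case
    proof eventually_elim
      case (elim t)
      then show ?case by (cases "t < \<tau> j") (auto simp: RS e_def)
    qed
  qed
  have "AE t in lebesgue. \<forall>j. t \<in> {0<..<\<tau> j} \<longrightarrow> (\<lambda>k. Lp_norm \<infinity> (\<lambda>x. u t x - R j k t x)) \<longlonglongrightarrow> 0"
    using R_lim by (subst AE_all_countable) auto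
  then have "AE t in lebesgue. t \<in> {0<..<T} \<longrightarrow> (\<lambda>k. Lp_norm \<infinity> (\<lambda>x. u t x - R k k t x)) \<longlonglongrightarrow> 0"
  proof eventually_elim
    case (elim t)
    show ?case
    proof
      assume t: "t \<in> {0<..<T}"
      then obtain j where j: "t < \<tau> j" using \<tau>(3) by auto
      have "\<forall>\<^sub>F k in sequentially. Lp_norm \<infinity> (\<lambda>x. u t x - R j k t x) = Lp_norm \<infinity> (\<lambda>x. u t x - R k k t x)"
        using eventually_ge_at_top[of j]
      proof eventually_elim
        case (elim k)
        then have "R k k t = R j k t" by (rule R_stable[OF j])
        then show ?case by (simp only:)
      qed
      then show "(\<lambda>k. Lp_norm \<infinity> (\<lambda>x. u t x - R k k t x)) \<longlonglongrightarrow> 0"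
        by (rule Lim_transform_eventually[rotated]) (use elim t j in auto)
    qed
  qed
  then have lim_R: "AE t in lebesgue_on {0<..<T}. (\<lambda>k. Lp_norm \<infinity> (\<lambda>x. u t x - R k k t x)) \<longlonglongrightarrow> 0"
    by (subst AE_lebesgue_on_iff) auto
  show ?thesis
    unfolding Lp_strongly_measurable_def
  proof (intro conjI exI[of _ "\<lambda>k. R k k"] allI)
    show "Lp_simple \<infinity> {0<..<T} (R k k)" for k
      by (rule Lp_simple_UNIV_restrict[OF R]) simp
    show "AE t in lebesgue_on {0<..<T}. u t \<in> Lp_space \<infinity>"
      using u by (intro AE_lebesgue_on_exhaust[OF T]) (simp add: Lp_strongly_measurable_def)
  qed (rule lim_R)
qed

section \<open>Continuity of the L1 norm and a Lipschitz bound for the power\<close>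

lemma ennreal_L1_norm:
  assumes "f \<in> Lp_space 1"
  shows "ennreal (LINT x|lborel. \<bar>f x\<bar>) = Lp_norm 1 f"
proof -
  have "integrable lborel (\<lambda>x. \<bar>f x\<bar>)" using assms by (simp add: Lp_space_1_iff)
  then show ?thesis unfolding Lp_norm_1 by (intro nn_integral_eq_integral[symmetric]) simp_all
qed

text \<open>By the reverse triangle inequality the norm is continuous on a compact interval. That
  the maximum is finite matters: a multiple of it is later subtracted from both sides of an
  inequality.\<close>

lemma L1_norm_attains_max:
  assumes u: "continuous_on_Lp 1 {0..T} u" and T: "(0::real) \<le> T"
  obtains s where "s \<in> {0..T}" "\<And>t. t \<in> {0..T} \<Longrightarrow> Lp_norm 1 (u t) \<le> Lp_norm 1 (u s)" "Lp_norm 1 (u s) < \<infinity>"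
proof -
  have uL: "u t \<in> Lp_space 1" if "t \<in> {0..T}" for t using u that by (auto simp: continuous_on_Lp_def)
  define \<phi> where "\<phi> t = (LINT x|lborel. \<bar>u t x\<bar>)" for t
  have \<phi>: "ennreal (\<phi> t) = Lp_norm 1 (u t)" if "t \<in> {0..T}" for t
    using ennreal_L1_norm[OF uL[OF that]] by (simp add: \<phi>_def)
  have \<phi>_diff: "ennreal \<bar>\<phi> r - \<phi> t\<bar> \<le> Lp_norm 1 (\<lambda>x. u r x - u t x)" if "r \<in> {0..T}" "t \<in> {0..T}" for r t
  proof -
    have int: "integrable lborel (u r)" "integrable lborel (u t)"
      using uL that by (auto simp: Lp_space_1_iff)
    have "\<phi> r - \<phi> t = (LINT x|lborel. \<bar>u r x\<bar> - \<bar>u t x\<bar>)"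
      using int unfolding \<phi>_def by (intro Bochner_Integration.integral_diff[symmetric]) auto
    then have "ennreal \<bar>\<phi> r - \<phi> t\<bar> \<le> (\<integral>\<^sup>+x. ennreal \<bar>\<bar>u r x\<bar> - \<bar>u t x\<bar>\<bar> \<partial>lborel)"
      using integral_norm_bound_ennreal[of lborel "\<lambda>x. \<bar>u r x\<bar> - \<bar>u t x\<bar>"] int by simp
    also have "\<dots> \<le> Lp_norm 1 (\<lambda>x. u r x - u t x)"
      unfolding Lp_norm_1 by (intro nn_integral_mono ennreal_leI) auto
    finally show ?thesis .
  qed
  have "continuous_on {0..T} \<phi>"
    unfolding continuous_on_def
  proof
    fix t assume t: "t \<in> {0..T}"
    have "((\<lambda>r. ennreal \<bar>\<phi> r - \<phi> t\<bar>) \<longlongrightarrow> 0) (at t within {0..T})"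
    proof (rule tendsto_sandwich[OF _ _ tendsto_const])
      show "((\<lambda>r. Lp_norm 1 (\<lambda>x. u r x - u t x)) \<longlongrightarrow> 0) (at t within {0..T})"
        using u t by (auto simp: continuous_on_Lp_def)
      show "\<forall>\<^sub>F r in at t within {0..T}. ennreal \<bar>\<phi> r - \<phi> t\<bar> \<le> Lp_norm 1 (\<lambda>x. u r x - u t x)"
        unfolding eventually_at_filter using \<phi>_diff t by auto
    qed simp
    then have "((\<lambda>r. \<bar>\<phi> r - \<phi> t\<bar>) \<longlongrightarrow> 0) (at t within {0..T})"
      by (simp add: tendsto_ennreal_iff flip: ennreal_0)
    then show "(\<phi> \<longlongrightarrow> \<phi> t) (at t within {0..T})"
      by (simp add: tendsto_rabs_zero_iff Lim_null[of \<phi>])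
  qed
  then obtain s where s: "s \<in> {0..T}" "\<And>t. t \<in> {0..T} \<Longrightarrow> \<phi> t \<le> \<phi> s"
    using continuous_attains_sup[of "{0..T}" \<phi>] T by auto
  show ?thesis
  proof (rule that[OF s(1)])
    show "Lp_norm 1 (u t) \<le> Lp_norm 1 (u s)" if "t \<in> {0..T}" for t
      using s(2)[OF that] \<phi>[OF that] \<phi>[OF s(1)] by (metis ennreal_leI)
    show "Lp_norm 1 (u s) < \<infinity>" using uL[OF s(1)] by (simp add: Lp_space_def)
  qed
qed

text \<open>Mean value theorem. The derivative is taken at interior points only, so the end point 0
  causes no trouble, and p > 1 makes it increasing and bounded by its value at C.\<close>

lemma powr_diff_le:
  fixes a b C p :: real
  assumes "0 \<le> a" "a \<le> C" "0 \<le> b" "b \<le> C" "1 < p"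
  shows "\<bar>a powr p - b powr p\<bar> \<le> p * C powr (p - 1) * \<bar>a - b\<bar>"
proof -
  have le: "b powr p - a powr p \<le> p * C powr (p - 1) * (b - a)" if "0 \<le> a" "a < b" "b \<le> C" for a b
  proof -
    have d: "((\<lambda>x. x powr p) has_real_derivative p * z powr (p - 1)) (at z)" if "a < z" for z
      using that \<open>0 \<le> a\<close> has_real_derivative_powr[of z p] by simp
    have "\<exists>l z. a < z \<and> z < b \<and> ((\<lambda>x. x powr p) has_real_derivative l) (at z) \<and> b powr p - a powr p = (b - a) * l"
    proof (rule MVT[OF \<open>a < b\<close>])
      show "continuous_on {a..b} (\<lambda>x. x powr p)"
        using that assms(5) by (intro continuous_on_powr' continuous_intros) auto
      show "(\<lambda>x. x powr p) differentiable (at x)" if "a < x" "x < b" for x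
        using d[OF that(1)] real_differentiable_def by blast
    qed
    then obtain z where z: "a < z" "z < b" "b powr p - a powr p = (b - a) * (p * z powr (p - 1))"
      using d DERIV_unique by metis
    have "z powr (p - 1) \<le> C powr (p - 1)"
      using z that assms(5) by (intro powr_mono2) auto
    then have "(b - a) * (p * z powr (p - 1)) \<le> (b - a) * (p * C powr (p - 1))"
      using that assms(5) by (intro mult_left_mono) auto
    then show ?thesis using z(3) by (simp add: mult.commute)
  qed
  show ?thesis
    using le[of a b] le[of b a] assms powr_mono2[of p a b] powr_mono2[of p b a]
    by (cases a b rule: linorder_cases) (auto simp: abs_if)
qed

section \<open>The mass identity\<close>

lemma bounded_nonneg_representative:
  fixes f :: "'a::euclidean_space \<Rightarrow> real"
  assumes f1: "f \<in> Lp_space 1" and fi: "f \<in> Lp_space \<infinity>" and nn: "AE x in lborel. 0 \<le> f x"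
  obtains h B where "integrable lborel h" "\<And>x. 0 \<le> h x" "\<And>x. h x \<le> B" "AE x in lborel. f x = h x"
proof -
  define B where "B = enn2real (Lp_norm \<infinity> f)"
  define h where "h x = max 0 (min B (f x))" for x
  have [measurable]: "f \<in> borel_measurable borel" using f1 by (simp add: Lp_space_def)
  have "Lp_norm \<infinity> f < \<top>" using fi by (simp add: Lp_space_def)
  then have B: "ennreal B = Lp_norm \<infinity> f" by (simp add: B_def)
  have eq: "AE x in lborel. f x = h x"
    using AE_le_Lp_norm_infinity[of f] nn
  proof eventually_elim
    case (elim x)
    then have "ennreal \<bar>f x\<bar> \<le> ennreal B" by (simp only: B)
    then have "\<bar>f x\<bar> \<le> B" by (simp add: B_def)
    then show ?case using elim by (simp add: h_def)
  qed
  have "integrable lborel h"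
    by (rule integrable_cong_AE_imp[OF f1[unfolded Lp_space_1_iff]])
       (use eq in \<open>auto simp: h_def[abs_def]\<close>)
  then show ?thesis
    using eq by (intro that[of h B]) (auto simp: h_def B_def)
qed

section \<open>The orbit of the initial datum under S\<close>

locale initial_datum =
  fixes \<alpha>1 \<alpha>2 c :: real and Z :: "real \<Rightarrow> 'a::euclidean_space measure" and u0 :: "'a \<Rightarrow> real"
  assumes Z: "is_Z_family \<alpha>1 \<alpha>2 c Z"
    and u0_1: "u0 \<in> Lp_space 1" and u0_infinity: "u0 \<in> Lp_space \<infinity>"
    and u0_nonneg: "AE x in lborel. 0 \<le> u0 x"
begin

lemma Z_prob: "0 < t \<Longrightarrow> prob_space (Z t)" and Z_sets: "0 < t \<Longrightarrow> sets (Z t) = sets borel"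
  using Z by (auto simp: is_Z_family_def)

lemma Z_finite: "0 < t \<Longrightarrow> finite_measure (Z t)"
  using Z_prob by (simp add: prob_space_def)

lemma u0_borel: "u0 \<in> borel_measurable borel"
  using u0_1 by (simp add: Lp_space_def)

text \<open>A single bounded h serves all t > 0, although the exceptional set of x depends on t. The
  orbit can thus be studied through convolutions defined at every point.\<close>

lemma S_op_eq_bounded:
  obtains h B where "integrable lborel h" "\<And>x. 0 \<le> h x" "\<And>x. h x \<le> B"
    "AE x in lborel. u0 x = h x"
    "\<forall>t>0. AE x in lborel. S_op Z t u0 x = measure_conv (Z t) h x"
proof -
  obtain h B where h: "integrable lborel h" "\<And>x. 0 \<le> h x" "\<And>x. h x \<le> B" "AE x in lborel. u0 x = h x"
    using bounded_nonneg_representative[OF u0_1 u0_infinity u0_nonneg] by blast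
  have hb: "h \<in> borel_measurable borel" using borel_measurable_integrable[OF h(1)] by simp
  have S: "AE x in lborel. S_op Z t u0 x = measure_conv (Z t) h x" if "0 < t" for t
    using measure_conv_cong_AE[OF Z_finite[OF that] Z_sets[OF that] u0_borel hb h(4)] that
    by (simp add: S_op_def)
  then show ?thesis using that[OF h] by blast
qed

lemma S_op_borel: "0 \<le> t \<Longrightarrow> S_op Z t u0 \<in> borel_measurable borel"
  using u0_borel borel_measurable_measure_conv[OF Z_finite Z_sets u0_borel, of t]
  by (auto simp: S_op_def)

lemma S_op_nonneg: "0 \<le> t \<Longrightarrow> AE x in lborel. 0 \<le> S_op Z t u0 x"
  and S_op_mass: "0 \<le> t \<Longrightarrow> (\<integral>\<^sup>+x. ennreal (S_op Z t u0 x) \<partial>lborel) = Lp_norm 1 u0"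
proof -
  assume t: "0 \<le> t"
  obtain h B where h: "integrable lborel h" "\<And>x. 0 \<le> h x" "\<And>x. h x \<le> B" "AE x in lborel. u0 x = h x"
    and S': "\<forall>t>0. AE x in lborel. S_op Z t u0 x = measure_conv (Z t) h x"
    using S_op_eq_bounded by blast
  note S = S'[rule_format]
  have hb: "h \<in> borel_measurable borel" using borel_measurable_integrable[OF h(1)] by simp
  have u0: "Lp_norm 1 u0 = (\<integral>\<^sup>+x. ennreal (h x) \<partial>lborel)"
    unfolding Lp_norm_1 using h(4,2) by (intro nn_integral_cong_AE) auto
  show "AE x in lborel. 0 \<le> S_op Z t u0 x"
  proof (cases "t = 0")
    case False
    then have "0 < t" using t by simp
    from S[OF this] show ?thesis
      using measure_conv_nonneg[OF Z_finite[OF \<open>0 < t\<close>] Z_sets[OF \<open>0 < t\<close>] hb h(2,3)] by auto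
  qed (use u0_nonneg in \<open>simp add: S_op_def\<close>)
  show "(\<integral>\<^sup>+x. ennreal (S_op Z t u0 x) \<partial>lborel) = Lp_norm 1 u0"
  proof (cases "t = 0")
    case True
    then show ?thesis
      unfolding S_op_def Lp_norm_1 using u0_nonneg by (auto intro!: nn_integral_cong_AE)
  next
    case False
    then have "0 < t" using t by simp
    have "(\<integral>\<^sup>+x. ennreal (S_op Z t u0 x) \<partial>lborel) = (\<integral>\<^sup>+x. ennreal (measure_conv (Z t) h x) \<partial>lborel)"
      using S[OF \<open>0 < t\<close>] by (intro nn_integral_cong_AE) auto
    also have "\<dots> = Lp_norm 1 u0"
      unfolding u0 by (rule nn_integral_measure_conv_prob[OF Z_prob Z_sets hb h(2,3)]) (use \<open>0 < t\<close> in auto)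
    finally show ?thesis .
  qed
qed

text \<open>Weak continuity of Z is available at positive times. The sequential form suffices
  because the left limit at the end point is tested along sequences.\<close>

lemma S_op_L1_tendsto:
  assumes X: "\<And>n. 0 < X n" and lim: "X \<longlonglongrightarrow> t" and t: "0 < t"
  shows "(\<lambda>n. \<integral>\<^sup>+x. ennreal \<bar>S_op Z (X n) u0 x - S_op Z t u0 x\<bar> \<partial>lborel) \<longlonglongrightarrow> 0"
proof -
  obtain h B where h: "integrable lborel h" "\<And>x. 0 \<le> h x" "\<And>x. h x \<le> B"
    and "AE x in lborel. u0 x = h x"
    and S': "\<forall>t>0. AE x in lborel. S_op Z t u0 x = measure_conv (Z t) h x"
    using S_op_eq_bounded by blast
  note S = S'[rule_format]
  have eq: "(\<integral>\<^sup>+x. ennreal \<bar>S_op Z (X n) u0 x - S_op Z t u0 x\<bar> \<partial>lborel) =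
    (\<integral>\<^sup>+x. ennreal \<bar>measure_conv (Z (X n)) h x - measure_conv (Z t) h x\<bar> \<partial>lborel)" for n
    using S[OF X[of n]] S[OF t] by (intro nn_integral_cong_AE) auto
  show ?thesis
    unfolding eq
  proof (rule measure_conv_L1_tendsto[OF _ _ _ _ _ h])
    fix f :: "'a \<Rightarrow> real" assume "continuous_on UNIV f" "bounded (range f)"
    then have "continuous_on {0<..} (\<lambda>t. LINT x|Z t. f x)"
      using Z by (simp add: is_Z_family_def)
    then show "(\<lambda>n. LINT x|Z (X n). f x) \<longlonglongrightarrow> (LINT x|Z t. f x)"
      by (rule continuous_on_tendsto_compose[OF _ lim]) (use X t in auto)
  qed (use Z_prob Z_sets X t in auto)
qed

end

section \<open>Mass balance\<close>

locale mild_problem = mild_representation K p C T Y u U + initial_datum \<alpha>1 \<alpha>2 c Z u0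
  for K :: "real \<Rightarrow> 'a::euclidean_space measure" and p C T Y u U \<alpha>1 \<alpha>2 c
    and Z :: "real \<Rightarrow> 'a measure" and u0
begin

text \<open>For almost every s in (0,T) this is the p-th power of the p-norm of \<open>u s\<close>,
  kept in the extended reals so that Tonelli applies before finiteness is known.\<close>

definition power_mass :: "real \<Rightarrow> ennreal" where
  "power_mass s = (\<integral>\<^sup>+x. ennreal (U s x powr p) \<partial>lborel)"

lemma power_mass_measurable [measurable]: "power_mass \<in> borel_measurable lebesgue"
proof -
  have "(\<lambda>z. ennreal (U (fst z) (snd z) powr p)) \<in> borel_measurable (lebesgue \<Otimes>\<^sub>M lborel)"
    using source_measurable by (simp add: case_prod_beta')
  from lborel.borel_measurable_nn_integral_fst[OF this] show ?thesis
    by (simp add: power_mass_def[abs_def])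
qed

lemma power_mass_eq_0: "s \<notin> {0<..<T} \<Longrightarrow> power_mass s = 0"
  using U_eq_0[of s] by (simp add: power_mass_def)

lemma power_mass_le:
  "AE s in lebesgue. s \<in> {0<..<T} \<longrightarrow> power_mass s \<le> ennreal (C powr (p - 1)) * Lp_norm 1 (u s)"
  using u_eq_U
proof eventually_elim
  case (elim s)
  show ?case
  proof
    assume s: "s \<in> {0<..<T}"
    then have [measurable]: "u s \<in> borel_measurable borel" by (rule u_borel)
    have "power_mass s \<le> (\<integral>\<^sup>+x. ennreal (C powr (p - 1)) * ennreal \<bar>u s x\<bar> \<partial>lborel)"
      unfolding power_mass_def
    proof (rule nn_integral_mono_AE)
      show "AE x in lborel. ennreal (U s x powr p) \<le> ennreal (C powr (p - 1)) * ennreal \<bar>u s x\<bar>"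
        using elim[rule_format, OF s]
      proof eventually_elim
        case (elim x)
        have "U s x powr p = U s x powr (p - 1) * U s x"
          using powr_mult_base[OF U_nonneg, of s x "p - 1"] by (simp add: mult.commute)
        also have "\<dots> \<le> C powr (p - 1) * U s x"
          using U_nonneg U_le p by (intro mult_right_mono powr_mono2) auto
        finally show ?case
          using elim U_nonneg[of s x] by (simp flip: ennreal_mult add: ennreal_leI)
      qed
    qed
    also have "\<dots> = ennreal (C powr (p - 1)) * Lp_norm 1 (u s)"
      unfolding Lp_norm_1 by (rule nn_integral_cmult) measurable
    finally show "power_mass s \<le> ennreal (C powr (p - 1)) * Lp_norm 1 (u s)" .
  qed
qed

lemma duhamel_mass:
  "(\<integral>\<^sup>+x. ennreal (duhamel t x) \<partial>lborel) = (\<integral>\<^sup>+r. emeasure (K r) UNIV * power_mass (t - r) \<partial>lebesgue)"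
  unfolding power_mass_def by (rule nn_integral_time_conv)

lemma mild_equation_representation:
  assumes "t \<le> T" and "mild_equation_at 1 p Z Y u0 u t"
  shows "AE x in lborel. u t x = S_op Z t u0 x + duhamel t x"
proof -
  obtain w where w: "has_Lp_bochner_integral 1 {0<..<t} (\<lambda>s. P_op Y (t - s) (\<lambda>x. max 0 (u s x) powr p)) w"
    and u: "AE x in lborel. u t x = S_op Z t u0 x + w x"
    using assms(2) by (auto simp: mild_equation_at_def)
  from u duhamel_unique[OF assms(1) w] show ?thesis by eventually_elim simp
qed

text \<open>All terms are nonnegative, so the mild equation can be integrated over space in the
  extended reals. Finiteness of the convolution term is read off from the left-hand side
  afterwards.\<close>

lemma mass_balance:
  assumes t: "0 \<le> t" "t \<le> T" and eq: "mild_equation_at 1 p Z Y u0 u t"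
  shows "Lp_norm 1 (u t) = Lp_norm 1 u0 + (\<integral>\<^sup>+r. emeasure (K r) UNIV * power_mass (t - r) \<partial>lebesgue)"
proof -
  note [measurable] = S_op_borel[OF t(1)]
  have "Lp_norm 1 (u t) = (\<integral>\<^sup>+x. ennreal (S_op Z t u0 x) + ennreal (duhamel t x) \<partial>lborel)"
    unfolding Lp_norm_1
  proof (rule nn_integral_cong_AE)
    show "AE x in lborel. ennreal \<bar>u t x\<bar> = ennreal (S_op Z t u0 x) + ennreal (duhamel t x)"
      using mild_equation_representation[OF t(2) eq] S_op_nonneg[OF t(1)]
      by eventually_elim (simp add: time_conv_nonneg flip: ennreal_plus)
  qed
  also have "\<dots> = (\<integral>\<^sup>+x. ennreal (S_op Z t u0 x) \<partial>lborel) + (\<integral>\<^sup>+x. ennreal (duhamel t x) \<partial>lborel)"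
    by (rule nn_integral_add) measurable
  finally show ?thesis by (simp add: S_op_mass[OF t(1)] duhamel_mass)
qed

lemma Lp_norm_p_eq:
  assumes "s \<in> {0<..<T}" "AE x in lborel. u s x = U s x" "power_mass s < \<infinity>"
  shows "u s \<in> Lp_space (ennreal p)"
    and "ennreal (enn2real (Lp_norm (ennreal p) (u s)) powr p) = power_mass s"
proof -
  have "(\<integral>\<^sup>+x. ennreal (\<bar>u s x\<bar> powr p) \<partial>lborel) = power_mass s"
    unfolding power_mass_def using assms(2) U_nonneg by (intro nn_integral_cong_AE) auto
  then show "u s \<in> Lp_space (ennreal p)"
    and "ennreal (enn2real (Lp_norm (ennreal p) (u s)) powr p) = power_mass s"
    using Lp_norm_real[of p "u s"] p assms(3) u_borel[OF assms(1)] by (simp_all add: Lp_space_def)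
qed

text \<open>Here T is the time at which the identity is claimed, and U represents the solution on
  (0,T).\<close>

lemma mass_identity:
  assumes T: "0 < T" and eq: "mild_equation_at 1 p Z Y u0 u T"
    and u1: "\<And>s. s \<in> {0<..<T} \<Longrightarrow> u s \<in> Lp_space 1"
    and \<psi>: "AE r in lebesgue. 0 < r \<longrightarrow> 0 \<le> \<psi> r \<and> emeasure (K r) UNIV = ennreal (\<psi> r)"
  shows "AE s in lebesgue_on {0<..<T}. u s \<in> Lp_space (ennreal p)"
    and "set_integrable lebesgue {0<..<T} (\<lambda>s. \<psi> (T - s) * enn2real (Lp_norm (ennreal p) (u s)) powr p)"
    and "enn2real (Lp_norm 1 (u T)) = enn2real (Lp_norm 1 u0) +
      (LINT s:{0<..<T}|lebesgue. \<psi> (T - s) * enn2real (Lp_norm (ennreal p) (u s)) powr p)"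
proof -
  let ?q = "\<lambda>s. enn2real (Lp_norm (ennreal p) (u s)) powr p"
  let ?f = "\<lambda>s. indicator {0<..<T} s * (\<psi> (T - s) * ?q s)"
  let ?m = "\<lambda>s. emeasure (K (T - s)) UNIV * power_mass s"
  have m_meas: "?m \<in> borel_measurable lebesgue"
    using measurable_kernel[of UNIV]
    by (intro borel_measurable_times_ennreal measurable_compose[OF lebesgue_measurable_reflect[of T]]
        power_mass_measurable) auto
  have q: "AE s in lebesgue. s \<in> {0<..<T} \<longrightarrow> u s \<in> Lp_space (ennreal p) \<and> ennreal (?q s) = power_mass s"
    using u_eq_U power_mass_le
  proof eventually_elim
    case (elim s)
    show ?case
    proof
      assume s: "s \<in> {0<..<T}"
      have "power_mass s < \<infinity>"
        using elim(2) s u1[OF s]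
        by (auto simp: Lp_space_def ennreal_mult_less_top intro: le_less_trans)
      then show "u s \<in> Lp_space (ennreal p) \<and> ennreal (?q s) = power_mass s"
        using Lp_norm_p_eq[OF s] elim(1) s by blast
    qed
  qed
  then show "AE s in lebesgue_on {0<..<T}. u s \<in> Lp_space (ennreal p)"
    by (subst AE_lebesgue_on_iff) (auto elim: eventually_mono)
  have f: "AE s in lebesgue. 0 \<le> ?f s \<and> ennreal (?f s) = ?m s"
    using q AE_lebesgue_reflect[OF \<psi>, of T]
  proof eventually_elim
    case (elim s)
    show ?case
    proof (cases "s \<in> {0<..<T}")
      case True
      then have "0 \<le> \<psi> (T - s)" "emeasure (K (T - s)) UNIV = ennreal (\<psi> (T - s))" "ennreal (?q s) = power_mass s"
        using elim by auto
      then show ?thesis using True by (simp add: ennreal_mult)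
    qed (simp add: power_mass_eq_0)
  qed
  have m_total: "(\<integral>\<^sup>+s. ?m s \<partial>lebesgue) = (\<integral>\<^sup>+r. emeasure (K r) UNIV * power_mass (T - r) \<partial>lebesgue)"
    using nn_integral_lebesgue_reflect[OF m_meas, of T] by simp
  have balance: "Lp_norm 1 (u T) = Lp_norm 1 u0 + (\<integral>\<^sup>+s. ?m s \<partial>lebesgue)"
    unfolding m_total using T eq by (intro mass_balance) auto
  have uT: "Lp_norm 1 (u T) < \<top>"
    using eq by (simp add: mild_equation_at_def Lp_space_def)
  \<comment> \<open>The left-hand side of the balance is finite since \<open>u T\<close> lies in
    L1.\<close>
  then have m_fin: "(\<integral>\<^sup>+s. ?m s \<partial>lebesgue) < \<infinity>"
    unfolding balance by (auto simp: less_top)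
  have nn: "(\<integral>\<^sup>+s. ennreal (?f s) \<partial>lebesgue) = (\<integral>\<^sup>+s. ?m s \<partial>lebesgue)"
    using f by (intro nn_integral_cong_AE) auto
  \<comment> \<open>The factors of the real integrand are tied to the kernel and to
    \<open>power_mass\<close> at almost every time only. Its measurability is inherited from
    \<open>?m\<close>, with which it agrees almost everywhere.\<close>
  have "(\<lambda>s. enn2real (?m s)) \<in> borel_measurable lebesgue"
    using m_meas by measurable
  then have "?f \<in> borel_measurable lebesgue"
  proof (rule borel_measurable_lebesgue_AE_eq)
    show "AE s in lebesgue. enn2real (?m s) = ?f s"
      using f
    proof eventually_elim
      case (elim s)
      then show ?case by (metis enn2real_ennreal)
    qed
  qed
  then have int: "integrable lebesgue ?f"
    using f m_fin by (intro integrableI_nonneg) (auto simp: nn elim: eventually_mono)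
  then show "set_integrable lebesgue {0<..<T} (\<lambda>s. \<psi> (T - s) * ?q s)"
    by (simp add: set_integrable_def)
  have "(\<integral>\<^sup>+s. ?m s \<partial>lebesgue) = ennreal (LINT s|lebesgue. ?f s)"
    unfolding nn[symmetric] using f by (intro nn_integral_eq_integral[OF int]) (auto elim: eventually_mono)
  moreover have "0 \<le> (LINT s|lebesgue. ?f s)"
    using f by (intro integral_nonneg_AE) (auto elim: eventually_mono)
  ultimately have "enn2real (Lp_norm 1 (u T)) = enn2real (Lp_norm 1 u0) + (LINT s|lebesgue. ?f s)"
    unfolding balance using u0_1 by (simp add: enn2real_plus Lp_space_def)
  then show "enn2real (Lp_norm 1 (u T)) = enn2real (Lp_norm 1 u0) +
      (LINT s:{0<..<T}|lebesgue. \<psi> (T - s) * ?q s)"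
    by (simp add: set_lebesgue_integral_def)
qed

end

section \<open>Extension of bounded solutions to the end point\<close>

lemma Lp_strongly_measurable_cong:
  assumes "\<And>t. t \<in> I \<Longrightarrow> f t = g t"
  shows "Lp_strongly_measurable q I f \<longleftrightarrow> Lp_strongly_measurable q I g"
  using assms unfolding Lp_strongly_measurable_def by (simp cong: AE_cong_simp)

lemma has_Lp_bochner_integral_cong:
  assumes "\<And>t. t \<in> I \<Longrightarrow> f t = g t"
  shows "has_Lp_bochner_integral q I f w \<longleftrightarrow> has_Lp_bochner_integral q I g w"
proof -
  have "(\<integral>\<^sup>+t. Lp_norm q (\<lambda>x. f t x - s t x) \<partial>lebesgue_on I) = (\<integral>\<^sup>+t. Lp_norm q (\<lambda>x. g t x - s t x) \<partial>lebesgue_on I)" for s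
    using assms by (intro nn_integral_cong) simp
  moreover have "Lp_strongly_measurable q I f \<longleftrightarrow> Lp_strongly_measurable q I g"
    by (rule Lp_strongly_measurable_cong[OF assms])
  ultimately show ?thesis unfolding has_Lp_bochner_integral_def by simp
qed

text \<open>The Duhamel integral runs over (0,t), so a change at a later time leaves the equation at
  t untouched.\<close>

lemma mild_equation_at_cong:
  assumes "\<And>s. 0 < s \<Longrightarrow> s \<le> t \<Longrightarrow> u s = v s" and "u t = v t"
  shows "mild_equation_at q p Z Y u0 u t \<longleftrightarrow> mild_equation_at q p Z Y u0 v t"
proof -
  have "has_Lp_bochner_integral q {0<..<t} (\<lambda>s. P_op Y (t - s) (\<lambda>x. max 0 (u s x) powr p)) w \<longleftrightarrow>
    has_Lp_bochner_integral q {0<..<t} (\<lambda>s. P_op Y (t - s) (\<lambda>x. max 0 (v s x) powr p)) w" for w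
    by (rule has_Lp_bochner_integral_cong) (simp add: assms(1))
  then show ?thesis unfolding mild_equation_at_def assms(2) by simp
qed

section \<open>Uniform mass bound up to the end point\<close>

locale bounded_mild_solution = mild_problem K p C T Y u U \<alpha>1 \<alpha>2 c Z u0
  for K :: "real \<Rightarrow> 'a::euclidean_space measure" and p C T Y u U \<alpha>1 \<alpha>2 c
    and Z :: "real \<Rightarrow> 'a measure" and u0 +
  assumes T_pos: "0 < T"
    and mild: "0 < T' \<Longrightarrow> T' < T \<Longrightarrow> mild_solution p Z Y u0 T' u"
    and u_bound: "AE t in lebesgue_on {0<..<T}. Lp_norm \<infinity> (u t) \<le> ennreal C"
begin

lemma mild_equation_1: "0 \<le> t \<Longrightarrow> t < T \<Longrightarrow> mild_equation_at 1 p Z Y u0 u t"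
  using mild[of "(t + T) / 2"] T_pos by (auto simp: mild_solution_def)

lemma L1_continuous: "0 \<le> T' \<Longrightarrow> T' < T \<Longrightarrow> continuous_on_Lp 1 {0..T'} u"
proof -
  assume T': "0 \<le> T'" "T' < T"
  then have "continuous_on_Lp 1 {0..(T' + T) / 2} u"
    using mild[of "(T' + T) / 2"] by (auto simp: mild_solution_def)
  moreover have "{0..T'} \<subseteq> {0..(T' + T) / 2}" using T' by auto
  ultimately show ?thesis
    unfolding continuous_on_Lp_def by (blast intro: tendsto_within_subset)
qed

text \<open>Choosing \<open>\<delta>\<close> with \<open>C\<^sup>p\<^sup>-\<^sup>1 \<integral>\<^sub>0\<^sup>\<delta> \<psi> \<le> 1/2\<close> lets the contribution of the most recent
  times be absorbed into the left-hand side, which replaces a Gronwall argument.\<close>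

lemma L1_bounded: "\<exists>M\<ge>0. \<forall>t. 0 \<le> t \<and> t < T \<longrightarrow> Lp_norm 1 (u t) \<le> ennreal M"
proof -
  define a where "a = C powr (p - 1)"
  have a: "0 \<le> a" by (simp add: a_def)
  \<comment> \<open>Chosen to give a * e \<le> 1/2; the added 1 covers a = 0, which occurs for C =
    0.\<close>
  define e where "e = 1 / (2 * (a + 1))"
  have e: "0 < e" "a * e \<le> 1 / 2" using a by (auto simp: e_def field_simps)
  obtain \<delta> where \<delta>: "0 < \<delta>" "\<delta> < T"
    and small: "(\<integral>\<^sup>+r\<in>{..\<delta>}. emeasure (K r) UNIV \<partial>lebesgue) \<le> ennreal e"
    using exists_small_mass[OF e(1) T_pos] by blast
  obtain s0 where s0: "s0 \<in> {0..T - \<delta>}" "\<And>t. t \<in> {0..T - \<delta>} \<Longrightarrow> Lp_norm 1 (u t) \<le> Lp_norm 1 (u s0)"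
    and "Lp_norm 1 (u s0) < \<infinity>"
    using L1_norm_attains_max[OF L1_continuous[of "T - \<delta>"]] \<delta> by auto
  define M0 where "M0 = enn2real (Lp_norm 1 (u s0))"
  have M0: "Lp_norm 1 (u t) \<le> ennreal M0" if "0 \<le> t" "t \<le> T - \<delta>" for t
    using s0(2)[of t] that \<open>Lp_norm 1 (u s0) < \<infinity>\<close> by (simp add: M0_def)
  have "0 \<le> M0" by (simp add: M0_def)
  define m0 where "m0 = enn2real (Lp_norm 1 u0)"
  have m0: "Lp_norm 1 u0 = ennreal m0" "0 \<le> m0"
    using u0_1 by (auto simp: m0_def Lp_space_def)
  define k where "k = enn2real (\<integral>\<^sup>+r\<in>{..T}. emeasure (K r) UNIV \<partial>lebesgue)"
  have k: "(\<integral>\<^sup>+r\<in>{..T}. emeasure (K r) UNIV \<partial>lebesgue) = ennreal k" "0 \<le> k"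
    using kernel_mass_finite[of T] by (auto simp: k_def)
  \<comment> \<open>At a late maximum point the balance reads S \<le> A + a * S * e with a * e \<le>
    1/2, whence S \<le> 2 * A.\<close>
  define A where "A = m0 + a * M0 * k"
  have "Lp_norm 1 (u t) \<le> ennreal (max M0 (2 * A))" if t: "0 \<le> t" "t < T" for t
  proof -
    \<comment> \<open>The balance is used at the point of [0,t] with the largest norm, so that this
      norm bounds the source at all earlier times and occurs on both sides.\<close>
    obtain s where s: "s \<in> {0..t}" and smax: "\<And>r. r \<in> {0..t} \<Longrightarrow> Lp_norm 1 (u r) \<le> Lp_norm 1 (u s)"
      and sfin: "Lp_norm 1 (u s) < \<infinity>"
      using L1_norm_attains_max[OF L1_continuous[OF t] t(1)] by blast
    define S where "S = enn2real (Lp_norm 1 (u s))"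
    have S: "Lp_norm 1 (u s) = ennreal S" "0 \<le> S" using sfin by (auto simp: S_def)
    have "S \<le> max M0 (2 * A)"
    proof (cases "s \<le> T - \<delta>")
      case True
      then have "ennreal S \<le> ennreal M0" using M0[of s] s S by simp
      then show ?thesis using \<open>0 \<le> M0\<close> by simp
    next
      case False
      \<comment> \<open>For r \<le> \<delta> the source is bounded through the maximum S. For r >
        \<delta> the source time s - r lies before T - \<delta>, where \<open>M0\<close>
        applies.\<close>
      have bd: "AE r in lebesgue. emeasure (K r) UNIV * power_mass (s - r) \<le>
        ennreal (a * S) * (emeasure (K r) UNIV * indicator {..\<delta>} r) +
        ennreal (a * M0) * (emeasure (K r) UNIV * indicator {..T} r)"
        using AE_lebesgue_reflect[OF power_mass_le, of s]
      proof eventually_elim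
        case (elim r)
        show ?case
        proof (cases "0 < r \<and> r < s")
          case True
          then have N: "power_mass (s - r) \<le> ennreal a * Lp_norm 1 (u (s - r))"
            using elim s t by (auto simp: a_def)
          have r_le: "r \<le> T" using True s t by auto
          show ?thesis
          proof (cases "r \<le> \<delta>")
            case True
            have "Lp_norm 1 (u (s - r)) \<le> ennreal S"
              using smax[of "s - r"] \<open>0 < r \<and> r < s\<close> s S by auto
            then have "power_mass (s - r) \<le> ennreal (a * S)"
              using order_trans[OF N mult_left_mono] a S(2) by (simp add: ennreal_mult)
            then have "emeasure (K r) UNIV * power_mass (s - r) \<le> emeasure (K r) UNIV * ennreal (a * S)"
              by (rule mult_left_mono) simp
            then show ?thesis
              using True by (intro add_increasing2) (auto simp: mult.commute)
          next
            case False
            have "Lp_norm 1 (u (s - r)) \<le> ennreal M0"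
              using M0[of "s - r"] \<open>0 < r \<and> r < s\<close> False s t by auto
            then have "power_mass (s - r) \<le> ennreal (a * M0)"
              using order_trans[OF N mult_left_mono] a \<open>0 \<le> M0\<close> by (simp add: ennreal_mult)
            then have "emeasure (K r) UNIV * power_mass (s - r) \<le> emeasure (K r) UNIV * ennreal (a * M0)"
              by (rule mult_left_mono) simp
            then show ?thesis
              using False r_le by (simp add: mult.commute)
          qed
        next
          case False
          then have "emeasure (K r) UNIV * power_mass (s - r) = 0"
            using kernel_nonpos[of r] power_mass_eq_0[of "s - r"] by (cases "r \<le> 0") auto
          then show ?thesis by (metis zero_le)
        qed
      qed
      have "ennreal S = Lp_norm 1 u0 + (\<integral>\<^sup>+r. emeasure (K r) UNIV * power_mass (s - r) \<partial>lebesgue)"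
        unfolding S(1)[symmetric] using s t by (intro mass_balance mild_equation_1) auto
      also have "\<dots> \<le> Lp_norm 1 u0 + (\<integral>\<^sup>+r. ennreal (a * S) * (emeasure (K r) UNIV * indicator {..\<delta>} r) +
        ennreal (a * M0) * (emeasure (K r) UNIV * indicator {..T} r) \<partial>lebesgue)"
        by (intro add_left_mono nn_integral_mono_AE bd)
      also have "\<dots> = Lp_norm 1 u0 + (ennreal (a * S) * (\<integral>\<^sup>+r\<in>{..\<delta>}. emeasure (K r) UNIV \<partial>lebesgue) +
        ennreal (a * M0) * (\<integral>\<^sup>+r\<in>{..T}. emeasure (K r) UNIV \<partial>lebesgue))"
        by (simp add: nn_integral_add nn_integral_cmult)
      also have "\<dots> \<le> ennreal m0 + (ennreal (a * S) * ennreal e + ennreal (a * M0) * ennreal k)"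
        unfolding m0(1) k(1) by (intro add_left_mono add_right_mono mult_left_mono small) simp
      also have "\<dots> = ennreal (m0 + (a * S * e + a * M0 * k))"
        using m0(2) a S(2) e(1) \<open>0 \<le> M0\<close> k(2) by (simp add: ennreal_mult)
      finally have "S \<le> m0 + (a * S * e + a * M0 * k)"
        by (subst (asm) ennreal_le_iff) (use m0(2) a S(2) e(1) \<open>0 \<le> M0\<close> k(2) in auto)
      moreover have "a * S * e \<le> S / 2"
        using mult_right_mono[OF e(2) S(2)] by (simp add: mult_ac)
      ultimately have "S \<le> 2 * A" by (simp add: A_def)
      then show ?thesis by simp
    qed
    then have "ennreal S \<le> ennreal (max M0 (2 * A))" by (rule ennreal_leI)
    then show ?thesis using smax[of t] t S(1) by auto
  qed
  then show ?thesis using \<open>0 \<le> M0\<close> by (intro exI[of _ "max M0 (2 * A)"]) auto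
qed

lemma power_mass_bounded: "\<exists>G\<ge>0. AE s in lebesgue. power_mass s \<le> ennreal G"
proof -
  obtain M where M: "0 \<le> M" "\<And>t. 0 \<le> t \<Longrightarrow> t < T \<Longrightarrow> Lp_norm 1 (u t) \<le> ennreal M"
    using L1_bounded by auto
  have "AE s in lebesgue. power_mass s \<le> ennreal (C powr (p - 1) * M)"
    using power_mass_le
  proof eventually_elim
    case (elim s)
    show ?case
    proof (cases "s \<in> {0<..<T}")
      case True
      then have "power_mass s \<le> ennreal (C powr (p - 1)) * Lp_norm 1 (u s)" using elim by simp
      also have "\<dots> \<le> ennreal (C powr (p - 1)) * ennreal M"
        using M(2)[of s] True by (intro mult_left_mono) auto
      finally show ?thesis using M(1) by (simp add: ennreal_mult)
    qed (simp add: power_mass_eq_0)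
  qed
  then show ?thesis using M(1) by (intro exI[of _ "C powr (p - 1) * M"]) auto
qed

section \<open>Convergence of the Duhamel term at the end point\<close>

lemma duhamel_finite: "(\<integral>\<^sup>+x. ennreal (duhamel T x) \<partial>lborel) < \<infinity>"
proof -
  obtain G where G: "0 \<le> G" "AE s in lebesgue. power_mass s \<le> ennreal G"
    using power_mass_bounded by blast
  have "(\<integral>\<^sup>+x. ennreal (duhamel T x) \<partial>lborel) \<le> (\<integral>\<^sup>+r. ennreal G * (emeasure (K r) UNIV * indicator {..T} r) \<partial>lebesgue)"
    unfolding duhamel_mass
  proof (rule nn_integral_mono_AE)
    show "AE r in lebesgue. emeasure (K r) UNIV * power_mass (T - r) \<le> ennreal G * (emeasure (K r) UNIV * indicator {..T} r)"
      using AE_lebesgue_reflect[OF G(2), of T]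
    proof eventually_elim
      case (elim r)
      then have "emeasure (K r) UNIV * power_mass (T - r) \<le> emeasure (K r) UNIV * ennreal G"
        by (rule mult_left_mono) simp
      then show ?case
        by (cases "r \<le> T") (auto simp: mult.commute power_mass_eq_0)
    qed
  qed
  also have "\<dots> = ennreal G * (\<integral>\<^sup>+r\<in>{..T}. emeasure (K r) UNIV \<partial>lebesgue)"
    by (rule nn_integral_cmult) measurable
  also have "\<dots> < \<infinity>"
    using kernel_mass_finite[of T] by (simp add: ennreal_mult_less_top)
  finally show ?thesis .
qed

lemma source_diff_measurable [measurable]:
  "(\<lambda>r. \<integral>\<^sup>+x. ennreal \<bar>U (t - r) x powr p - U (t' - r) x powr p\<bar> \<partial>lborel) \<in> borel_measurable lebesgue"
proof -
  have m: "(\<lambda>z. U (t - fst z) (snd z) powr p) \<in> borel_measurable (lebesgue \<Otimes>\<^sub>M lborel)" for t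
    by (rule source_compose_measurable) measurable
  have "(\<lambda>z. ennreal \<bar>U (t - fst z) (snd z) powr p - U (t' - fst z) (snd z) powr p\<bar>) \<in> borel_measurable (lebesgue \<Otimes>\<^sub>M lborel)"
    using m[of t] m[of t'] by measurable
  from lborel.borel_measurable_nn_integral_fst[OF this] show ?thesis by simp
qed

text \<open>At a fixed age r > 0 the source time T - r stays away from the end point, so L1
  continuity of u is available there and passes to the power by the Lipschitz bound on
  [0,C].\<close>

lemma source_diff_L1_tendsto:
  assumes X: "\<And>n. 0 < X n" "\<And>n. X n < T" "X \<longlonglongrightarrow> T"
  shows "AE r in lebesgue. 0 < r \<and> r < T \<longrightarrow>
    (\<lambda>n. \<integral>\<^sup>+x. ennreal \<bar>U (X n - r) x powr p - U (T - r) x powr p\<bar> \<partial>lborel) \<longlonglongrightarrow> 0"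
proof -
  \<comment> \<open>Along a fixed sequence only countably many null sets of r arise; this is why
    limits are taken along sequences.\<close>
  have "AE r in lebesgue. \<forall>n. X n - r \<in> {0<..<T} \<longrightarrow> (AE x in lborel. u (X n - r) x = U (X n - r) x)"
    unfolding AE_all_countable by (intro allI AE_lebesgue_reflect[OF u_eq_U])
  then show ?thesis
    using AE_lebesgue_reflect[OF u_eq_U, of T]
  proof eventually_elim
    case (elim r)
    show ?case
    proof
      assume r: "0 < r \<and> r < T"
      define L where "L = p * C powr (p - 1)"
      have L: "0 \<le> L" using p by (simp add: L_def)
      let ?d = "\<lambda>n. Lp_norm 1 (\<lambda>x. u (X n - r) x - u (T - r) x)"
      have "continuous_on_Lp 1 {0..T - r / 2} u" using r by (intro L1_continuous) auto
      then have cont: "((\<lambda>s. Lp_norm 1 (\<lambda>x. u s x - u (T - r) x)) \<longlongrightarrow> 0) (at (T - r) within {0..T - r / 2})"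
        using r unfolding continuous_on_Lp_def by auto
      have "(\<lambda>n. X n - r) \<longlonglongrightarrow> T - r" by (intro tendsto_intros X)
      moreover have pos: "\<forall>\<^sub>F n in sequentially. 0 < X n - r"
        using order_tendstoD(1)[OF X(3), of r] r by (auto elim: eventually_mono)
      moreover have "X n - r \<noteq> T - r" "X n - r \<le> T - r / 2" for n using X(2)[of n] r by auto
      ultimately have "filterlim (\<lambda>n. X n - r) (at (T - r) within {0..T - r / 2}) sequentially"
        unfolding filterlim_at by (auto elim!: eventually_mono)
      from filterlim_compose[OF cont this] have d: "?d \<longlonglongrightarrow> 0" .
      have le: "\<forall>\<^sub>F n in sequentially. (\<integral>\<^sup>+x. ennreal \<bar>U (X n - r) x powr p - U (T - r) x powr p\<bar> \<partial>lborel) \<le> ennreal L * ?d n"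
        using pos
      proof eventually_elim
        case (elim n)
        then have n: "X n - r \<in> {0<..<T}" "T - r \<in> {0<..<T}" using X(2)[of n] r by auto
        note [measurable] = u_borel[OF n(1)] u_borel[OF n(2)]
        have "(\<integral>\<^sup>+x. ennreal \<bar>U (X n - r) x powr p - U (T - r) x powr p\<bar> \<partial>lborel)
          \<le> (\<integral>\<^sup>+x. ennreal L * ennreal \<bar>u (X n - r) x - u (T - r) x\<bar> \<partial>lborel)"
        proof (rule nn_integral_mono_AE)
          have "AE x in lborel. u (X n - r) x = U (X n - r) x" "AE x in lborel. u (T - r) x = U (T - r) x"
            using \<open>\<forall>n. X n - r \<in> {0<..<T} \<longrightarrow> _\<close> \<open>T - r \<in> {0<..<T} \<longrightarrow> _\<close> n by auto
          then show "AE x in lborel. ennreal \<bar>U (X n - r) x powr p - U (T - r) x powr p\<bar>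
            \<le> ennreal L * ennreal \<bar>u (X n - r) x - u (T - r) x\<bar>"
          proof eventually_elim
            case (elim x)
            show ?case
              unfolding elim using L powr_diff_le[OF U_nonneg U_le U_nonneg U_le p, of "X n - r" x "T - r" x]
              by (simp add: L_def flip: ennreal_mult)
          qed
        qed
        also have "\<dots> = ennreal L * ?d n"
          unfolding Lp_norm_1 by (rule nn_integral_cmult) measurable
        finally show ?case .
      qed
      have "(\<lambda>n. ennreal L * ?d n) \<longlonglongrightarrow> ennreal L * 0"
        by (rule ennreal_tendsto_cmult[OF _ d]) simp
      then have Ld: "(\<lambda>n. ennreal L * ?d n) \<longlonglongrightarrow> 0" by simp
      show "(\<lambda>n. \<integral>\<^sup>+x. ennreal \<bar>U (X n - r) x powr p - U (T - r) x powr p\<bar> \<partial>lborel) \<longlonglongrightarrow> 0"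
        by (rule tendsto_sandwich[OF _ le tendsto_const Ld]) simp
    qed
  qed
qed

lemma duhamel_L1_tendsto:
  assumes X: "\<And>n. 0 < X n" "\<And>n. X n < T" "X \<longlonglongrightarrow> T"
  shows "(\<lambda>n. \<integral>\<^sup>+x. ennreal \<bar>duhamel (X n) x - duhamel T x\<bar> \<partial>lborel) \<longlonglongrightarrow> 0"
proof -
  obtain G where G: "0 \<le> G" "AE s in lebesgue. power_mass s \<le> ennreal G"
    using power_mass_bounded by blast
  let ?D = "\<lambda>n r. \<integral>\<^sup>+x. ennreal \<bar>U (X n - r) x powr p - U (T - r) x powr p\<bar> \<partial>lborel"
  have "(\<lambda>n. \<integral>\<^sup>+r. emeasure (K r) UNIV * ?D n r \<partial>lebesgue) \<longlonglongrightarrow> (\<integral>\<^sup>+r. 0 \<partial>(lebesgue :: real measure))"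
  \<comment> \<open>The constant 2 * G bounds the sum of the power masses at \<open>X n - r\<close>
    and T - r. For r > T both sources vanish, which justifies the indicator.\<close>
  proof (rule nn_integral_dominated_convergence[where w="\<lambda>r. ennreal (2 * G) * (emeasure (K r) UNIV * indicator {..T} r)"])
    show "(\<lambda>r. emeasure (K r) UNIV * ?D n r) \<in> borel_measurable lebesgue" for n
      using measurable_kernel[of UNIV] by (intro borel_measurable_times_ennreal source_diff_measurable) auto
    show "AE r in lebesgue. emeasure (K r) UNIV * ?D n r \<le> ennreal (2 * G) * (emeasure (K r) UNIV * indicator {..T} r)" for n
      using AE_lebesgue_reflect[OF G(2), of T] AE_lebesgue_reflect[OF G(2), of "X n"]
    proof eventually_elim
      case (elim r)
      show ?case
      proof (cases "r \<le> T")
        case True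
        have "?D n r \<le> (\<integral>\<^sup>+x. ennreal (U (X n - r) x powr p) + ennreal (U (T - r) x powr p) \<partial>lborel)"
        proof (intro nn_integral_mono)
          fix x
          have "\<bar>U (X n - r) x powr p - U (T - r) x powr p\<bar> \<le> U (X n - r) x powr p + U (T - r) x powr p"
            by (simp add: abs_le_iff)
          then show "ennreal \<bar>U (X n - r) x powr p - U (T - r) x powr p\<bar> \<le> ennreal (U (X n - r) x powr p) + ennreal (U (T - r) x powr p)"
            by (simp flip: ennreal_plus add: ennreal_leI)
        qed
        also have "\<dots> = power_mass (X n - r) + power_mass (T - r)"
          unfolding power_mass_def by (rule nn_integral_add) measurable
        also have "\<dots> \<le> ennreal G + ennreal G" by (intro add_mono elim)
        also have "\<dots> = ennreal (2 * G)" using G(1) by (simp flip: ennreal_plus)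
        finally have "emeasure (K r) UNIV * ?D n r \<le> emeasure (K r) UNIV * ennreal (2 * G)"
          by (rule mult_left_mono) simp
        then show ?thesis using True by (simp add: mult.commute)
      next
        case False
        then show ?thesis using X(2)[of n] by (simp add: U_eq_0)
      qed
    qed
    show "(\<integral>\<^sup>+r. ennreal (2 * G) * (emeasure (K r) UNIV * indicator {..T} r) \<partial>lebesgue) < \<infinity>"
      using kernel_mass_finite[of T] by (simp add: nn_integral_cmult ennreal_mult_less_top)
    show "AE r in lebesgue. (\<lambda>n. emeasure (K r) UNIV * ?D n r) \<longlonglongrightarrow> 0"
      using source_diff_L1_tendsto[OF X]
    proof eventually_elim
      case (elim r)
      consider "r \<le> 0" | "0 < r" "r < T" | "T \<le> r" by linarith
      then show ?case
      proof cases
        case 2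
        then have "(\<lambda>n. ?D n r) \<longlonglongrightarrow> 0" using elim by simp
        from ennreal_tendsto_cmult[OF _ this, of "emeasure (K r) UNIV"] show ?thesis
          by (simp add: top.not_eq_extremum[symmetric])
      next
        case 3
        then have "?D n r = 0" for n using X(2)[of n] by (simp add: U_eq_0)
        then show ?thesis by simp
      qed (simp add: kernel_nonpos)
    qed
  qed measurable
  then have lim: "(\<lambda>n. \<integral>\<^sup>+r. emeasure (K r) UNIV * ?D n r \<partial>lebesgue) \<longlonglongrightarrow> 0" by simp
  show ?thesis
    by (rule tendsto_sandwich[OF _ always_eventually[OF allI[OF time_conv_diff_le]] tendsto_const lim]) simp
qed

section \<open>The solution extended to the closed interval\<close>

definition extension :: "real \<Rightarrow> 'a \<Rightarrow> real" where
  "extension = u(T := \<lambda>x. S_op Z T u0 x + duhamel T x)"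

lemma extension_T: "extension T x = S_op Z T u0 x + duhamel T x"
  and extension_eq: "t \<noteq> T \<Longrightarrow> extension t = u t"
  by (auto simp: extension_def)

lemma extension_equation: "mild_equation_at 1 p Z Y u0 extension T"
proof -
  have [measurable]: "S_op Z T u0 \<in> borel_measurable borel" using S_op_borel T_pos by simp
  have S: "S_op Z T u0 \<in> Lp_space 1"
  proof -
    have "Lp_norm 1 (S_op Z T u0) = (\<integral>\<^sup>+x. ennreal (S_op Z T u0 x) \<partial>lborel)"
      unfolding Lp_norm_1 using S_op_nonneg[of T] T_pos by (intro nn_integral_cong_AE) auto
    also have "\<dots> = Lp_norm 1 u0" using S_op_mass[of T] T_pos by simp
    finally show ?thesis using u0_1 by (simp add: Lp_space_def)
  qed
  have D: "duhamel T \<in> Lp_space 1"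
    using duhamel_finite by (simp add: Lp_space_def Lp_norm_1 time_conv_nonneg)
  have "extension T \<in> Lp_space 1"
    using S D unfolding Lp_space_1_iff extension_T[abs_def] by auto
  \<comment> \<open>The integral runs over the open interval, so the new value at T does not enter
    it.\<close>
  moreover have "has_Lp_bochner_integral 1 {0<..<T} (\<lambda>s. P_op Y (T - s) (\<lambda>x. max 0 (extension s x) powr p)) (duhamel T)"
    using duhamel_has_integral[OF order_refl duhamel_finite]
    by (subst has_Lp_bochner_integral_cong) (auto simp: extension_eq)
  ultimately show ?thesis
    using S unfolding mild_equation_at_def by (intro conjI exI[of _ "duhamel T"]) (auto simp: extension_T)
qed

lemma extension_L1_tendsto:
  assumes X: "\<And>n. 0 < X n" "\<And>n. X n < T" "X \<longlonglongrightarrow> T"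
  shows "(\<lambda>n. Lp_norm 1 (\<lambda>x. extension (X n) x - extension T x)) \<longlonglongrightarrow> 0"
proof -
  let ?S = "\<lambda>n. \<integral>\<^sup>+x. ennreal \<bar>S_op Z (X n) u0 x - S_op Z T u0 x\<bar> \<partial>lborel"
  let ?D = "\<lambda>n. \<integral>\<^sup>+x. ennreal \<bar>duhamel (X n) x - duhamel T x\<bar> \<partial>lborel"
  have le: "Lp_norm 1 (\<lambda>x. extension (X n) x - extension T x) \<le> ?S n + ?D n" for n
  proof -
    note [measurable] = S_op_borel[OF less_imp_le[OF X(1)[of n]]] S_op_borel[OF less_imp_le[OF T_pos]]
    have "Lp_norm 1 (\<lambda>x. extension (X n) x - extension T x)
      \<le> (\<integral>\<^sup>+x. ennreal \<bar>S_op Z (X n) u0 x - S_op Z T u0 x\<bar> + ennreal \<bar>duhamel (X n) x - duhamel T x\<bar> \<partial>lborel)"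
      unfolding Lp_norm_1
    proof (rule nn_integral_mono_AE)
      have "AE x in lborel. u (X n) x = S_op Z (X n) u0 x + duhamel (X n) x"
        using X(1,2)[of n] by (intro mild_equation_representation mild_equation_1) auto
      then show "AE x in lborel. ennreal \<bar>extension (X n) x - extension T x\<bar>
        \<le> ennreal \<bar>S_op Z (X n) u0 x - S_op Z T u0 x\<bar> + ennreal \<bar>duhamel (X n) x - duhamel T x\<bar>"
      proof eventually_elim
        case (elim x)
        have "extension (X n) x = S_op Z (X n) u0 x + duhamel (X n) x"
          using elim X(2)[of n] by (simp add: extension_eq)
        then show ?case
          unfolding extension_T by (simp flip: ennreal_plus)
      qed
    qed
    also have "\<dots> = ?S n + ?D n" by (rule nn_integral_add) measurable
    finally show ?thesis .
  qed
  have "(\<lambda>n. ?S n + ?D n) \<longlonglongrightarrow> 0 + 0"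
    using X T_pos by (intro tendsto_add S_op_L1_tendsto duhamel_L1_tendsto) auto
  then have lim: "(\<lambda>n. ?S n + ?D n) \<longlonglongrightarrow> 0" by simp
  show ?thesis
    by (rule tendsto_sandwich[OF _ always_eventually[OF allI[OF le]] tendsto_const lim]) simp
qed

lemma extension_L1_continuous: "continuous_on_Lp 1 {0..T} extension"
  unfolding continuous_on_Lp_def
proof (intro ballI conjI)
  fix t assume t: "t \<in> {0..T}"
  show "extension t \<in> Lp_space 1"
    using extension_equation mild_equation_1[of t] t
    by (cases "t = T") (auto simp: mild_equation_at_def extension_eq)
  show "((\<lambda>r. Lp_norm 1 (\<lambda>x. extension r x - extension t x)) \<longlongrightarrow> 0) (at t within {0..T})"
  proof (cases "t = T")
    case True
    have "((\<lambda>r. Lp_norm 1 (\<lambda>x. extension r x - extension T x)) \<longlongrightarrow> 0) (at_left T)"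
      by (rule tendsto_at_left_sequentially[OF T_pos]) (rule extension_L1_tendsto)
    then show ?thesis using True T_pos by (simp add: at_within_Icc_at_left)
  next
    case False
    \<comment> \<open>Continuity at t < T is local: the neighbourhood \<open>{..<T'}\<close> of t
      does not see the new value at T.\<close>
    define T' where "T' = (t + T) / 2"
    have T': "t < T'" "T' < T" "0 \<le> T'" using t False by (auto simp: T'_def)
    have "((\<lambda>r. Lp_norm 1 (\<lambda>x. u r x - u t x)) \<longlongrightarrow> 0) (at t within {0..T'})"
      using L1_continuous[OF T'(3,2)] t T' unfolding continuous_on_Lp_def by auto
    also have "at t within {0..T'} = at t within {0..T}"
      by (rule at_within_nhd[where S="{..<T'}"]) (use T' in auto)
    finally have lim: "((\<lambda>r. Lp_norm 1 (\<lambda>x. u r x - u t x)) \<longlongrightarrow> 0) (at t within {0..T})" .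
    have "\<forall>\<^sub>F r in at t within {0..T}. r < T"
      using order_tendstoD(2)[OF tendsto_ident_at, of t T] t False by simp
    then have "\<forall>\<^sub>F r in at t within {0..T}. Lp_norm 1 (\<lambda>x. u r x - u t x) = Lp_norm 1 (\<lambda>x. extension r x - extension t x)"
      by eventually_elim (use False in \<open>simp add: extension_eq\<close>)
    then show ?thesis by (rule Lim_transform_eventually[OF lim])
  qed
qed

text \<open>The L-infinity bound, strong measurability and the L-infinity equation concern the open
  interval or almost every time there, so they are inherited from u. Only L1 continuity and the L1
  equation involve the time T itself.\<close>

lemma extension_mild_solution: "mild_solution p Z Y u0 T extension"
  unfolding mild_solution_def
proof (intro conjI ballI)
  have eq: "extension t = u t" if "t \<in> {0<..<T}" for t using that by (simp add: extension_eq)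
  have mild_cong: "mild_equation_at q p Z Y u0 extension t \<longleftrightarrow> mild_equation_at q p Z Y u0 u t" if "t < T" for q t
    by (rule mild_equation_at_cong) (use that in \<open>auto simp: extension_eq\<close>)
  show "continuous_on_Lp 1 {0..T} extension" by (rule extension_L1_continuous)
  have "Lp_strongly_measurable \<infinity> {0<..<T} u"
    using mild by (intro Lp_strongly_measurable_exhaust[OF T_pos]) (simp add: mild_solution_def)
  then show "Lp_strongly_measurable \<infinity> {0<..<T} extension"
    by (subst Lp_strongly_measurable_cong[OF eq])
  show "\<exists>C. AE t in lebesgue_on {0<..<T}. Lp_norm \<infinity> (extension t) \<le> ennreal C"
  proof
    show "AE t in lebesgue_on {0<..<T}. Lp_norm \<infinity> (extension t) \<le> ennreal C"
      using u_bound AE_space[of "lebesgue_on {0<..<T}"]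
    proof eventually_elim
      case (elim t)
      then show ?case using eq[of t] by simp
    qed
  qed
  show "mild_equation_at 1 p Z Y u0 extension t" if "t \<in> {0..T}" for t
    using extension_equation mild_equation_1[of t] that mild_cong[of t 1] by (cases "t = T") auto
  have "AE t in lebesgue_on {0<..<T}. mild_equation_at \<infinity> p Z Y u0 u t"
    using mild by (intro AE_lebesgue_on_exhaust[OF T_pos]) (simp add: mild_solution_def)
  then show "AE t in lebesgue_on {0<..<T}. mild_equation_at \<infinity> p Z Y u0 extension t"
    using AE_space[of "lebesgue_on {0<..<T}"]
  proof eventually_elim
    case (elim t)
    then show ?case using mild_cong[of t \<infinity>] by simp
  qed
qed

end

section \<open>Proof of the theorem\<close>

lemma (in initial_datum) exists_mild_problem:
  assumes K: "time_kernel K" "AE r in lebesgue. 0 < r \<longrightarrow> K r = Y r" and p: "1 < p"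
    and meas: "Lp_strongly_measurable \<infinity> {0<..<T} u"
    and bd: "AE t in lebesgue_on {0<..<T}. Lp_norm \<infinity> (u t) \<le> ennreal C" and C: "0 \<le> C"
    and nn: "\<And>t. t \<in> {0<..<T} \<Longrightarrow> AE x in lborel. 0 \<le> u t x"
    and ub: "\<And>t. t \<in> {0<..<T} \<Longrightarrow> u t \<in> borel_measurable borel"
  obtains U where "mild_problem K p C T Y u U \<alpha>1 \<alpha>2 c Z u0"
proof -
  have "AE t in lebesgue_on {0<..<T}. AE x in lborel. 0 \<le> u t x"
    by (rule AE_I2) (use nn in simp)
  from bounded_joint_representative[OF meas bd C this]
  obtain U where "(\<lambda>(s, x). U s x) \<in> borel_measurable (lebesgue \<Otimes>\<^sub>M borel)"
    "\<And>s x. 0 \<le> U s x" "\<And>s x. U s x \<le> C" "\<And>s x. s \<notin> {0<..<T} \<Longrightarrow> U s x = 0"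
    "AE s in lebesgue. s \<in> {0<..<T} \<longrightarrow> (AE x in lborel. u s x = U s x)"
    by blast
  then have "mild_representation_axioms K p C T Y u U"
    using K(2) p ub by unfold_locales
  then have "mild_problem K p C T Y u U \<alpha>1 \<alpha>2 c Z u0"
    using K(1) initial_datum_axioms by (intro mild_problem.intro mild_representation.intro)
  then show ?thesis by (rule that)
qed

theorem proposition3p6:
  fixes \<alpha>1 \<alpha>2 c p :: real
    and \<psi> :: "real \<Rightarrow> real"
    and Z Y :: "real \<Rightarrow> (real ^ 'n) measure"
    and u0 :: "real ^ 'n \<Rightarrow> real"
    and u :: "real \<Rightarrow> real ^ 'n \<Rightarrow> real"
    and Tmax :: ereal
  assumes "0 < \<alpha>1" "\<alpha>1 < 1" "0 < \<alpha>2" "\<alpha>2 < 1" "0 < c" "1 < p"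
    and "bernstein_function (\<lambda>s::real. inverse (Psi \<alpha>1 \<alpha>2 c s))"
    and "is_laplace_original_of_Psi \<alpha>1 \<alpha>2 c \<psi>"
    and "is_Z_family \<alpha>1 \<alpha>2 c Z"
    and "is_Y_family \<alpha>1 \<alpha>2 c \<psi> Y"
    and "u0 \<in> Lp_space 1" "u0 \<in> Lp_space \<infinity>" "AE x in lborel. 0 \<le> u0 x"
    and "maximal_mild_solution p Z Y u0 Tmax u"
    and "\<forall>t. 0 \<le> t \<and> ereal t < Tmax \<longrightarrow> (AE x in lborel. 0 \<le> u t x)"
  shows
    "(\<forall>t. 0 < t \<and> ereal t < Tmax \<longrightarrow>
        (AE s in lebesgue_on {0<..<t}. u s \<in> Lp_space (ennreal p)) \<and>
        set_integrable lebesgue {0<..<t}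
          (\<lambda>s. \<psi> (t - s) * enn2real (Lp_norm (ennreal p) (u s)) powr p) \<and>
        enn2real (Lp_norm 1 (u t)) =
          enn2real (Lp_norm 1 u0) +
          (LINT s:{0<..<t}|lebesgue. \<psi> (t - s) * enn2real (Lp_norm (ennreal p) (u s)) powr p)) \<and>
     (\<forall>Tm. Tmax = ereal Tm \<longrightarrow>
        (\<forall>T. 0 < T \<and> T < Tm \<longrightarrow>
           (\<lambda>t. Lp_norm \<infinity> (u t)) \<in> borel_measurable (lebesgue_on {T<..<Tm}) \<and>
           esssup (lebesgue_on {T<..<Tm}) (\<lambda>t. Lp_norm \<infinity> (u t)) = \<infinity>) \<and>
        (\<forall>v. continuous_on_Lp \<infinity> {0<..<Tm} v \<and>
             (AE t in lebesgue_on {0<..<Tm}. AE x in lborel. v t x = u t x) \<longrightarrow>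
           Limsup (at_left Tm) (\<lambda>t. Lp_norm \<infinity> (v t)) = \<infinity>))"
proof (rule conjI)
  interpret initial_datum \<alpha>1 \<alpha>2 c Z u0
    using assms(9,11-13) by unfold_locales
  obtain K where K: "time_kernel K"
    and KY: "AE r in lebesgue. 0 < r \<longrightarrow> K r = Y r \<and> 0 \<le> \<psi> r \<and> emeasure (K r) UNIV = ennreal (\<psi> r)"
    using exists_time_kernel[OF assms(10,8)] by blast
  have K_eq: "AE r in lebesgue. 0 < r \<longrightarrow> K r = Y r"
    using KY by eventually_elim simp
  have K_mass: "AE r in lebesgue. 0 < r \<longrightarrow> 0 \<le> \<psi> r \<and> emeasure (K r) UNIV = ennreal (\<psi> r)"
    using KY by eventually_elim metis
  have mild: "mild_solution p Z Y u0 t u" if "0 < t" "ereal t < Tmax" for t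
    using assms(14) that by (auto simp: maximal_mild_solution_def)
  have uL1: "u t \<in> Lp_space 1" if "0 < t" "ereal t < Tmax" for t
    using mild[OF that] that by (auto simp: mild_solution_def mild_equation_at_def)
  then have ub: "u t \<in> borel_measurable borel" if "0 < t" "ereal t < Tmax" for t
    using that by (simp add: Lp_space_def)
  have u_nonneg: "AE x in lborel. 0 \<le> u t x" if "0 < t" "ereal t < Tmax" for t
    using assms(15) that by auto
  have bound: "\<exists>C\<ge>0. AE s in lebesgue_on {0<..<t}. Lp_norm \<infinity> (u s) \<le> ennreal C"
    if t: "0 < t" "ereal t < Tmax" for t
  proof -
    obtain C where "AE s in lebesgue_on {0<..<t}. Lp_norm \<infinity> (u s) \<le> ennreal C"
      using mild[OF t] by (auto simp: mild_solution_def)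
    \<comment> \<open>\<open>ennreal\<close> sends negative reals to 0, so the constant may be
      replaced by its positive part.\<close>
    then show ?thesis
      by (intro exI[of _ "max 0 C"]) (auto simp: ennreal_max_0)
  qed
  show "\<forall>t. 0 < t \<and> ereal t < Tmax \<longrightarrow>
        (AE s in lebesgue_on {0<..<t}. u s \<in> Lp_space (ennreal p)) \<and>
        set_integrable lebesgue {0<..<t}
          (\<lambda>s. \<psi> (t - s) * enn2real (Lp_norm (ennreal p) (u s)) powr p) \<and>
        enn2real (Lp_norm 1 (u t)) =
          enn2real (Lp_norm 1 u0) +
          (LINT s:{0<..<t}|lebesgue. \<psi> (t - s) * enn2real (Lp_norm (ennreal p) (u s)) powr p)"
  proof (intro allI impI)
    fix t assume "0 < t \<and> ereal t < Tmax"
    then have t: "0 < t" "ereal t < Tmax" by auto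
    have before: "0 < s" "ereal s < Tmax" if "s \<in> {0<..<t}" for s
      using that t le_less_trans[of "ereal s" "ereal t" Tmax] by auto
    obtain C where C: "0 \<le> C" "AE s in lebesgue_on {0<..<t}. Lp_norm \<infinity> (u s) \<le> ennreal C"
      using bound[OF t] by blast
    have "Lp_strongly_measurable \<infinity> {0<..<t} u" using mild[OF t] by (simp add: mild_solution_def)
    \<comment> \<open>The representation is built anew for each t, because the bound C may grow as t
      approaches \<open>Tmax\<close>.\<close>
    from exists_mild_problem[OF K K_eq assms(6) this C(2,1) u_nonneg[OF before] ub[OF before]]
    obtain U where "mild_problem K p C t Y u U \<alpha>1 \<alpha>2 c Z u0" by blast
    then interpret mild_problem K p C t Y u U \<alpha>1 \<alpha>2 c Z u0 .
    have "mild_equation_at 1 p Z Y u0 u t"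
      using mild[OF t] t by (simp add: mild_solution_def)
    note mass_identity[OF t(1) this uL1[OF before] K_mass]
    then show "(AE s in lebesgue_on {0<..<t}. u s \<in> Lp_space (ennreal p)) \<and>
        set_integrable lebesgue {0<..<t}
          (\<lambda>s. \<psi> (t - s) * enn2real (Lp_norm (ennreal p) (u s)) powr p) \<and>
        enn2real (Lp_norm 1 (u t)) =
          enn2real (Lp_norm 1 u0) +
          (LINT s:{0<..<t}|lebesgue. \<psi> (t - s) * enn2real (Lp_norm (ennreal p) (u s)) powr p)"
      by blast
  qed
  show "\<forall>Tm. Tmax = ereal Tm \<longrightarrow>
        (\<forall>T. 0 < T \<and> T < Tm \<longrightarrow>
           (\<lambda>t. Lp_norm \<infinity> (u t)) \<in> borel_measurable (lebesgue_on {T<..<Tm}) \<and>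
           esssup (lebesgue_on {T<..<Tm}) (\<lambda>t. Lp_norm \<infinity> (u t)) = \<infinity>) \<and>
        (\<forall>v. continuous_on_Lp \<infinity> {0<..<Tm} v \<and>
             (AE t in lebesgue_on {0<..<Tm}. AE x in lborel. v t x = u t x) \<longrightarrow>
           Limsup (at_left Tm) (\<lambda>t. Lp_norm \<infinity> (v t)) = \<infinity>)"
  proof (intro allI impI)
    fix Tm assume Tmax: "Tmax = ereal Tm"
    have Tm: "0 < Tm" using assms(14) Tmax by (simp add: maximal_mild_solution_def)
    have mild': "mild_solution p Z Y u0 T' u" if "0 < T'" "T' < Tm" for T'
      using mild that Tmax by simp
    have meas: "Lp_strongly_measurable \<infinity> {0<..<Tm} u"
      using mild' by (intro Lp_strongly_measurable_exhaust[OF Tm]) (simp add: mild_solution_def)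
    have ub': "u t \<in> borel_measurable borel" if "t \<in> {0<..<Tm}" for t
      using ub that Tmax by simp
    have norm_meas: "(\<lambda>t. Lp_norm \<infinity> (u t)) \<in> borel_measurable (lebesgue_on {T<..<Tm})" if "0 < T" for T
    proof -
      have "(\<lambda>t. Lp_norm \<infinity> (u t)) \<in> borel_measurable (lebesgue_on {0<..<Tm})"
        by (rule Lp_norm_infinity_measurable[OF _ meas ub']) auto
      then show ?thesis by (rule measurable_restrict_mono) (use that in auto)
    qed
    have blowup: "esssup (lebesgue_on {T<..<Tm}) (\<lambda>t. Lp_norm \<infinity> (u t)) = \<infinity>" if T: "0 < T" "T < Tm" for T
    proof (rule ccontr)
      define E where "E = esssup (lebesgue_on {T<..<Tm}) (\<lambda>t. Lp_norm \<infinity> (u t))"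
      assume "esssup (lebesgue_on {T<..<Tm}) (\<lambda>t. Lp_norm \<infinity> (u t)) \<noteq> \<infinity>"
      then have E: "E = ennreal (enn2real E)" by (simp add: E_def less_top)
      have "AE t in lebesgue_on {T<..<Tm}. Lp_norm \<infinity> (u t) \<le> E"
        unfolding E_def by (rule esssup_AE)
      then have late: "AE t in lebesgue. t \<in> {T<..<Tm} \<longrightarrow> Lp_norm \<infinity> (u t) \<le> E"
        by (subst (asm) AE_lebesgue_on_iff) auto
      \<comment> \<open>The assumed bound covers (T,Tm) and the mild solution property covers
        (0,T1). As T < T1, these intervals overlap and exhaust (0,Tm).\<close>
      define T1 where "T1 = (T + Tm) / 2"
      have T1: "T < T1" "T1 < Tm" using T by (auto simp: T1_def)
      obtain C1 where C1: "0 \<le> C1" "AE t in lebesgue_on {0<..<T1}. Lp_norm \<infinity> (u t) \<le> ennreal C1"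
        using bound[of T1] T T1 Tmax by auto
      then have early: "AE t in lebesgue. t \<in> {0<..<T1} \<longrightarrow> Lp_norm \<infinity> (u t) \<le> ennreal C1"
        by (subst (asm) AE_lebesgue_on_iff) auto
      define C where "C = max C1 (enn2real E)"
      have C_nonneg: "0 \<le> C" using C1(1) by (simp add: C_def)
      have "AE t in lebesgue. t \<in> {0<..<Tm} \<longrightarrow> Lp_norm \<infinity> (u t) \<le> ennreal C"
        using early late
      proof eventually_elim
        case (elim t)
        have "ennreal C1 \<le> ennreal C" "E \<le> ennreal C"
          unfolding C_def by (auto intro: ennreal_leI) (subst E, auto intro: ennreal_leI)
        then show ?case
          using elim T1 by (cases "t < T1") (auto intro: order_trans)
      qed
      then have bd: "AE t in lebesgue_on {0<..<Tm}. Lp_norm \<infinity> (u t) \<le> ennreal C"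
        by (subst AE_lebesgue_on_iff) auto
      obtain U where U: "mild_problem K p C Tm Y u U \<alpha>1 \<alpha>2 c Z u0"
        using exists_mild_problem[OF K K_eq assms(6) meas bd C_nonneg _ ub'] u_nonneg Tmax by auto
      then have "bounded_mild_solution K p C Tm Y u U \<alpha>1 \<alpha>2 c Z u0"
        using Tm mild' bd by (intro bounded_mild_solution.intro bounded_mild_solution_axioms.intro)
      then interpret bounded_mild_solution K p C Tm Y u U \<alpha>1 \<alpha>2 c Z u0 .
      have "{t. 0 \<le> t \<and> ereal t < Tmax} \<subset> {0..Tm}"
        using Tm Tmax by (auto simp: psubset_eq set_eq_iff intro!: exI[of _ Tm])
      moreover have "\<forall>t. 0 \<le> t \<and> ereal t < Tmax \<longrightarrow> (AE x in lborel. extension t x = u t x)"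
        using Tmax by (auto simp: extension_eq)
      ultimately show False
        using assms(14) extension_mild_solution unfolding maximal_mild_solution_def by blast
    qed
    have "Limsup (at_left Tm) (\<lambda>t. Lp_norm \<infinity> (v t)) = \<infinity>"
      if v: "continuous_on_Lp \<infinity> {0<..<Tm} v"
        and vu: "AE t in lebesgue_on {0<..<Tm}. AE x in lborel. v t x = u t x" for v
    proof (rule ccontr)
      assume "Limsup (at_left Tm) (\<lambda>t. Lp_norm \<infinity> (v t)) \<noteq> \<infinity>"
      \<comment> \<open>A finite level strictly above the limsup, below which the norm of v stays
        near \<open>Tm\<close>.\<close>
      then obtain y where y: "Limsup (at_left Tm) (\<lambda>t. Lp_norm \<infinity> (v t)) < y" "y < \<top>"
        using dense[of "Limsup (at_left Tm) (\<lambda>t. Lp_norm \<infinity> (v t))" \<top>] by (auto simp: less_top)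
      have "\<forall>\<^sub>F t in at_left Tm. Lp_norm \<infinity> (v t) < y"
        by (rule Limsup_lessD[OF y(1)])
      then obtain b where b: "b < Tm" "\<And>t. b < t \<Longrightarrow> t < Tm \<Longrightarrow> Lp_norm \<infinity> (v t) < y"
        unfolding eventually_at_left_field by auto
      \<comment> \<open>The value Tm/2 keeps T positive when b is negative.\<close>
      define T where "T = max b (Tm / 2)"
      have T: "0 < T" "T < Tm" "b \<le> T" using b(1) Tm by (auto simp: T_def)
      have "AE t in lebesgue. t \<in> {0<..<Tm} \<longrightarrow> (AE x in lborel. v t x = u t x)"
        using vu by (subst (asm) AE_lebesgue_on_iff) auto
      then have "AE t in lebesgue. t \<in> {T<..<Tm} \<longrightarrow> Lp_norm \<infinity> (u t) \<le> y"
      proof eventually_elim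
        case (elim t)
        show ?case
        proof
          assume t: "t \<in> {T<..<Tm}"
          then have t': "t \<in> {0<..<Tm}" using T by auto
          then have "v t \<in> borel_measurable borel"
            using v by (auto simp: continuous_on_Lp_def Lp_space_def)
          from Lp_norm_infinity_cong_AE[OF this ub'[OF t']] elim t'
          have "Lp_norm \<infinity> (v t) = Lp_norm \<infinity> (u t)" by auto
          then show "Lp_norm \<infinity> (u t) \<le> y" using b(2)[of t] t T by auto
        qed
      qed
      then have "AE t in lebesgue_on {T<..<Tm}. Lp_norm \<infinity> (u t) \<le> y"
        by (subst AE_lebesgue_on_iff) auto
      \<comment> \<open>A bound almost everywhere limits \<open>esssup\<close> for measurable
        functions only, hence the appeal to \<open>norm_meas\<close>.\<close>
      then have "esssup (lebesgue_on {T<..<Tm}) (\<lambda>t. Lp_norm \<infinity> (u t)) \<le> y"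
        by (intro esssup_I norm_meas T)
      then show False using blowup[OF T(1,2)] y(2) by (simp add: top_unique)
    qed
    then show "(\<forall>T. 0 < T \<and> T < Tm \<longrightarrow>
           (\<lambda>t. Lp_norm \<infinity> (u t)) \<in> borel_measurable (lebesgue_on {T<..<Tm}) \<and>
           esssup (lebesgue_on {T<..<Tm}) (\<lambda>t. Lp_norm \<infinity> (u t)) = \<infinity>) \<and>
        (\<forall>v. continuous_on_Lp \<infinity> {0<..<Tm} v \<and>
             (AE t in lebesgue_on {0<..<Tm}. AE x in lborel. v t x = u t x) \<longrightarrow>
           Limsup (at_left Tm) (\<lambda>t. Lp_norm \<infinity> (v t)) = \<infinity>)"
      using norm_meas blowup by blast
  qed
qed

end
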